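(* Let $(M,g)$ be a Riemannian manifold, $T>0$, $m_0\in\mathcal{P}(M)$, $H:[0,T]\times TM\to\mathbb{R}$, $(t,x,p)\mapsto H(t,x,p)$ with $p\in T_xM$, $F:[0,T]\times M\times\mathcal{P}(M)\to\mathbb{R}$ and $G:M\times\mathcal{P}(M)\to\mathbb{R}$. Suppose that $G$ is monotone, that $F$ is strictly monotone (i.e. $F(t,\cdot,\cdot)$ is strictly monotone for every $t$), and that $H$ is convex in the $p$ variable. Then the solution $(v,\mu)$ to the mean field game system $$\begin{cases}-\partial_tv-\Delta_gv+H(t,x,\nabla_gv)=F(t,x,\mu_t) & \text{on }[0,T)\times M,\\ \partial_t\mu-\operatorname{div}_g\big(D_pH(t,x,\nabla_gv)\,\mu\big)-\Delta_g\mu=0 & \text{on }[0,T)\times M,\\ \mu_{t=0}=m_0,\quad v(T,\cdot)=G(\cdot,\mu_T) & \text{on }M\end{cases}$$ is unique.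
   Context: $\Delta_g,\nabla_g,\operatorname{div}_g$ are the Laplace-Beltrami operator, gradient and divergence of $g$; $\mathcal{P}(M)$ is the set of Borel probability measures on $M$ with the weak topology. The Hamiltonian $H$ is assumed regular, so that it is continuous and its derivative $D_pH(t,x,p)\in T_xM$ with respect to $p$ exists and is continuous (the tangent and cotangent spaces being identified through $g$). Monotone: a function $\Phi:M\times\mathcal{P}(M)\to\mathbb{R}$ is monotone if $\int_M(\Phi(x,\mu)-\Phi(x,\nu))\,(\mu(dx)-\nu(dx))\ge0$ for all $\mu,\nu\in\mathcal{P}(M)$, and strictly monotone if this integral is $>0$ for all $\mu\ne\nu$ in $\mathcal{P}(M)$. Solution: a pair $(v,\mu)$ where $v\in C_b^{1,2}([0,T]\times M)$ (bounded, $C^1$ in time and $C^2$ in space with bounded derivatives) satisfies the first equation and the terminal condition in the classical sense, and $\mu\in C([0,T],\mathcal{P}(M))$ is a probability flow solution of the second equation: the drift $B(t,x)=-D_pH(t,x,\nabla_gv(t,x))$ belongs to $L^\infty([0,T],C_b^1(TM))$ (bounded $C^1$ vector fields with bounded covariant derivative), $\mu_0=m_0$, and for every $\varphi\in C_b^{1,2}([0,T]\times M)$ and $t\in[0,T]$, $$\int_M\varphi(t,x)\,\mu_t(dx)-\int_M\varphi(0,x)\,m_0(dx)=\int_0^t\int_M\big(\partial_t\varphi+B\cdot\nabla_g\varphi+\Delta_g\varphi\big)\,d\mu_s\,ds.$$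
   Formalization: The Riemannian manifold M is assumed connected (the usual convention); without this the solution need not be unique, e.g. on the disjoint union of a circle and an open interval with m_0 carried by the circle. *)

theory Defs
  imports "HOL-Probability.Probability"
begin

section \<open>Maps of class \<open>C\<^sup>k\<close> between Euclidean spaces\<close>

text \<open>Only used on open sets \<open>S\<close>.\<close>

primrec Ck_on :: "nat \<Rightarrow> 'a::euclidean_space set \<Rightarrow> ('a \<Rightarrow> 'b::euclidean_space) \<Rightarrow> bool" where
  "Ck_on 0 S f \<longleftrightarrow> continuous_on S f"
| "Ck_on (Suc k) S f \<longleftrightarrow>
     (\<forall>y\<in>S. f differentiable (at y)) \<and> (\<forall>w. Ck_on k S (\<lambda>y. frechet_derivative f (at y) w))"

definition smooth_on :: "'a::euclidean_space set \<Rightarrow> ('a \<Rightarrow> 'b::euclidean_space) \<Rightarrow> bool" where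
  "smooth_on S f \<longleftrightarrow> (\<forall>k. Ck_on k S f)"

definition partial :: "'n \<Rightarrow> (real^'n::finite \<Rightarrow> real) \<Rightarrow> real^'n \<Rightarrow> real" where
  "partial i f y = frechet_derivative f (at y) (axis i 1)"


section \<open>Smooth manifolds and their tangent spaces\<close>

text \<open>
  The manifold \<open>M\<close> is a type \<open>'m\<close>; its dimension is \<open>CARD('n)\<close>. A chart is a pair of an open
  domain and a coordinate map. The smooth structure is given by an atlas, not assumed maximal.
\<close>

type_synonym ('m, 'n) chart = "'m set \<times> ('m \<Rightarrow> real^'n)"

definition chart_image :: "('m, 'n::finite) chart \<Rightarrow> (real^'n) set" where
  "chart_image c = snd c ` fst c"

definition chart_inv :: "('m, 'n::finite) chart \<Rightarrow> real^'n \<Rightarrow> 'm" where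
  "chart_inv c = inv_into (fst c) (snd c)"

definition is_chart :: "('m::topological_space, 'n::finite) chart \<Rightarrow> bool" where
  "is_chart c \<longleftrightarrow> open (fst c) \<and> open (chart_image c) \<and>
     homeomorphism (fst c) (chart_image c) (snd c) (chart_inv c)"

definition smooth_atlas :: "('m::topological_space, 'n::finite) chart set \<Rightarrow> bool" where
  "smooth_atlas A \<longleftrightarrow> (\<forall>c\<in>A. is_chart c) \<and> (\<Union>c\<in>A. fst c) = UNIV \<and>
     (\<forall>c\<in>A. \<forall>d\<in>A. smooth_on (snd c ` (fst c \<inter> fst d)) (\<lambda>y. snd d (chart_inv c y)))"

definition charts_at :: "('m, 'n::finite) chart set \<Rightarrow> 'm \<Rightarrow> ('m, 'n) chart set" where
  "charts_at A x = {c \<in> A. x \<in> fst c}"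

definition transition_deriv ::
    "('m, 'n::finite) chart \<Rightarrow> ('m, 'n) chart \<Rightarrow> 'm \<Rightarrow> real^'n \<Rightarrow> real^'n" where
  "transition_deriv c d x = frechet_derivative (\<lambda>y. snd d (chart_inv c y)) (at (snd c x))"

text \<open>
  A tangent vector at \<open>x\<close> is the family of its coordinate vectors in all charts around \<open>x\<close>, which
  transform by the derivative of the change of coordinates. Vector operations are pointwise.
\<close>

type_synonym ('m, 'n) tvec = "('m, 'n) chart \<Rightarrow> real^'n"

definition tangent_space :: "('m, 'n::finite) chart set \<Rightarrow> 'm \<Rightarrow> ('m, 'n) tvec set" where
  "tangent_space A x = {p.
     (\<forall>c\<in>charts_at A x. \<forall>d\<in>charts_at A x. p d = transition_deriv c d x (p c)) \<and>
     (\<forall>c. c \<notin> charts_at A x \<longrightarrow> p c = 0)}"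

text \<open>The tangent vector at \<open>x\<close> with coordinates \<open>w\<close> in the chart \<open>c\<close>.\<close>

definition tangent_vec ::
    "('m, 'n::finite) chart set \<Rightarrow> ('m, 'n) chart \<Rightarrow> 'm \<Rightarrow> real^'n \<Rightarrow> ('m, 'n) tvec" where
  "tangent_vec A c x w = (\<lambda>d. if d \<in> charts_at A x then transition_deriv c d x w else 0)"


section \<open>Riemannian metrics\<close>

type_synonym ('m, 'n) metric = "'m \<Rightarrow> ('m, 'n) tvec \<Rightarrow> ('m, 'n) tvec \<Rightarrow> real"

definition riemannian_metric ::
    "('m::topological_space, 'n::finite) chart set \<Rightarrow> ('m, 'n) metric \<Rightarrow> bool" where
  "riemannian_metric A g \<longleftrightarrow>
     (\<forall>x. \<forall>p\<in>tangent_space A x. \<forall>q\<in>tangent_space A x. g x p q = g x q p) \<and>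
     (\<forall>x. \<forall>p\<in>tangent_space A x. \<forall>q\<in>tangent_space A x. \<forall>r\<in>tangent_space A x. \<forall>a b.
        g x (\<lambda>c. a *\<^sub>R p c + b *\<^sub>R q c) r = a * g x p r + b * g x q r) \<and>
     (\<forall>x. \<forall>p\<in>tangent_space A x. p \<noteq> (\<lambda>c. 0) \<longrightarrow> g x p p > 0) \<and>
     (\<forall>c\<in>A. \<forall>u w. smooth_on (chart_image c)
        (\<lambda>y. g (chart_inv c y) (tangent_vec A c (chart_inv c y) u) (tangent_vec A c (chart_inv c y) w)))"

text \<open>
  Hausdorff and second countable by the type classes; manifolds are connected, by convention.
  Connectedness is needed for uniqueness: on the disjoint union of a circle and a bounded open
  interval, with \<open>m\<^sub>0\<close> carried by the circle, the values of \<open>v\<close> on the interval are not determined.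
\<close>

definition riemannian_manifold ::
    "('m::{second_countable_topology, t2_space}, 'n::finite) chart set \<Rightarrow> ('m, 'n) metric \<Rightarrow> bool" where
  "riemannian_manifold A g \<longleftrightarrow>
     connected (UNIV :: 'm set) \<and> smooth_atlas A \<and> riemannian_metric A g"

definition tnorm :: "('m, 'n::finite) metric \<Rightarrow> 'm \<Rightarrow> ('m, 'n) tvec \<Rightarrow> real" where
  "tnorm g x p = sqrt (g x p p)"

definition grad ::
    "('m, 'n::finite) chart set \<Rightarrow> ('m, 'n) metric \<Rightarrow> ('m \<Rightarrow> real) \<Rightarrow> 'm \<Rightarrow> ('m, 'n) tvec" where
  "grad A g f x = (THE X. X \<in> tangent_space A x \<and>
     (\<forall>c\<in>charts_at A x.
        ((\<lambda>y. f (chart_inv c y)) has_derivative (\<lambda>w. g x X (tangent_vec A c x w))) (at (snd c x))))"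

text \<open>
  Components \<open>g\<^sub>i\<^sub>j\<close> of the metric, and Christoffel symbols of its Levi-Civita connection
  (\<open>christoffel A g c y k i j\<close> has upper index \<open>k\<close>), in the coordinates \<open>y\<close> of the chart \<open>c\<close>.
\<close>

definition metric_matrix ::
    "('m, 'n::finite) chart set \<Rightarrow> ('m, 'n) metric \<Rightarrow> ('m, 'n) chart \<Rightarrow> real^'n \<Rightarrow> real^'n^'n" where
  "metric_matrix A g c y = (\<chi> i j. g (chart_inv c y)
     (tangent_vec A c (chart_inv c y) (axis i 1)) (tangent_vec A c (chart_inv c y) (axis j 1)))"

definition christoffel ::
    "('m, 'n::finite) chart set \<Rightarrow> ('m, 'n) metric \<Rightarrow> ('m, 'n) chart \<Rightarrow> real^'n \<Rightarrow>
      'n \<Rightarrow> 'n \<Rightarrow> 'n \<Rightarrow> real" where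
  "christoffel A g c y k i j = (1/2) * (\<Sum>l\<in>UNIV. matrix_inv (metric_matrix A g c y) $ k $ l *
     (partial i (\<lambda>z. metric_matrix A g c z $ j $ l) y +
      partial j (\<lambda>z. metric_matrix A g c z $ i $ l) y -
      partial l (\<lambda>z. metric_matrix A g c z $ i $ j) y))"

text \<open>The covariant derivative of the vector field \<open>X\<close> at \<open>x\<close> in the direction \<open>p\<close>.\<close>

definition cov_deriv ::
    "('m, 'n::finite) chart set \<Rightarrow> ('m, 'n) metric \<Rightarrow> ('m \<Rightarrow> ('m, 'n) tvec) \<Rightarrow>
      'm \<Rightarrow> ('m, 'n) tvec \<Rightarrow> ('m, 'n) tvec" where
  "cov_deriv A g X x p = (\<lambda>c. if c \<in> charts_at A x then
       (\<chi> k. (\<Sum>i\<in>UNIV. p c $ i * partial i (\<lambda>y. X (chart_inv c y) c $ k) (snd c x)) +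
             (\<Sum>i\<in>UNIV. \<Sum>j\<in>UNIV. christoffel A g c (snd c x) k i j * p c $ i * X x c $ j))
     else 0)"

text \<open>The divergence of \<open>X\<close> at \<open>x\<close> is the trace of \<open>p \<mapsto> cov_deriv A g X x p\<close>.\<close>

definition divergence ::
    "('m, 'n::finite) chart set \<Rightarrow> ('m, 'n) metric \<Rightarrow> ('m \<Rightarrow> ('m, 'n) tvec) \<Rightarrow> 'm \<Rightarrow> real" where
  "divergence A g X x = (THE r. \<forall>c\<in>charts_at A x.
     r = (\<Sum>k\<in>UNIV. cov_deriv A g X x (tangent_vec A c x (axis k 1)) c $ k))"

definition laplace_beltrami ::
    "('m, 'n::finite) chart set \<Rightarrow> ('m, 'n) metric \<Rightarrow> ('m \<Rightarrow> real) \<Rightarrow> 'm \<Rightarrow> real" where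
  "laplace_beltrami A g f x = divergence A g (grad A g f) x"


section \<open>Function spaces\<close>

text \<open>Only the values for times in \<open>[0,T]\<close> matter; time derivatives at the end points are one-sided.\<close>

definition time_deriv :: "real \<Rightarrow> (real \<Rightarrow> 'm \<Rightarrow> real) \<Rightarrow> real \<Rightarrow> 'm \<Rightarrow> real" where
  "time_deriv T v t x = vector_derivative (\<lambda>s. v s x) (at t within {0..T})"

text \<open>Boundedness of the second derivative is expressed by the covariant derivative of the gradient.\<close>

definition C12b ::
    "('m::topological_space, 'n::finite) chart set \<Rightarrow> ('m, 'n) metric \<Rightarrow> real \<Rightarrow>
      (real \<Rightarrow> 'm \<Rightarrow> real) set" where
  "C12b A g T = {v.
     continuous_on ({0..T} \<times> UNIV) (\<lambda>(t, x). v t x) \<and>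
     (\<forall>t\<in>{0..T}. \<forall>x. (\<lambda>s. v s x) differentiable (at t within {0..T})) \<and>
     continuous_on ({0..T} \<times> UNIV) (\<lambda>(t, x). time_deriv T v t x) \<and>
     (\<forall>c\<in>A. \<forall>t\<in>{0..T}. Ck_on 2 (chart_image c) (\<lambda>y. v t (chart_inv c y))) \<and>
     (\<forall>c\<in>A. \<forall>i. continuous_on ({0..T} \<times> chart_image c)
        (\<lambda>(t, y). partial i (\<lambda>z. v t (chart_inv c z)) y)) \<and>
     (\<forall>c\<in>A. \<forall>i j. continuous_on ({0..T} \<times> chart_image c)
        (\<lambda>(t, y). partial j (partial i (\<lambda>z. v t (chart_inv c z))) y)) \<and>
     (\<exists>K. \<forall>t\<in>{0..T}. \<forall>x.
        \<bar>v t x\<bar> \<le> K \<and> \<bar>time_deriv T v t x\<bar> \<le> K \<and> tnorm g x (grad A g (v t) x) \<le> K \<and>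
        (\<forall>p\<in>tangent_space A x. tnorm g x (cov_deriv A g (grad A g (v t)) x p) \<le> K * tnorm g x p))}"

definition C1_vector_field ::
    "('m::topological_space, 'n::finite) chart set \<Rightarrow> ('m \<Rightarrow> ('m, 'n) tvec) \<Rightarrow> bool" where
  "C1_vector_field A X \<longleftrightarrow> (\<forall>x. X x \<in> tangent_space A x) \<and>
     (\<forall>c\<in>A. Ck_on 1 (chart_image c) (\<lambda>y. X (chart_inv c y) c))"

text \<open>
  The essential bound of \<open>L\<^sup>\<infinity>([0,T], C\<^sub>b\<^sup>1(TM))\<close>. Measurability in time is not listed: the only fields
  considered, \<open>- D\<^sub>pH(t,x,\<nabla>v)\<close>, are continuous in \<open>(t,x)\<close>.
\<close>

definition Linf_C1b ::
    "('m::topological_space, 'n::finite) chart set \<Rightarrow> ('m, 'n) metric \<Rightarrow> real \<Rightarrow>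
      (real \<Rightarrow> 'm \<Rightarrow> ('m, 'n) tvec) set" where
  "Linf_C1b A g T = {B. \<exists>K. AE t in lborel. t \<in> {0..T} \<longrightarrow>
     C1_vector_field A (B t) \<and>
     (\<forall>x. tnorm g x (B t x) \<le> K \<and>
        (\<forall>p\<in>tangent_space A x. tnorm g x (cov_deriv A g (B t) x p) \<le> K * tnorm g x p))}"


section \<open>Hamiltonians\<close>

definition fibre_grad ::
    "('m, 'n::finite) chart set \<Rightarrow> ('m, 'n) metric \<Rightarrow> (real \<Rightarrow> 'm \<Rightarrow> ('m, 'n) tvec \<Rightarrow> real) \<Rightarrow>
      real \<Rightarrow> 'm \<Rightarrow> ('m, 'n) tvec \<Rightarrow> ('m, 'n) tvec \<Rightarrow> bool" where
  "fibre_grad A g H t x p X \<longleftrightarrow> X \<in> tangent_space A x \<and>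
     (\<forall>c\<in>charts_at A x.
        ((\<lambda>w. H t x (tangent_vec A c x w)) has_derivative (\<lambda>w. g x X (tangent_vec A c x w))) (at (p c)))"

definition DpH ::
    "('m, 'n::finite) chart set \<Rightarrow> ('m, 'n) metric \<Rightarrow> (real \<Rightarrow> 'm \<Rightarrow> ('m, 'n) tvec \<Rightarrow> real) \<Rightarrow>
      real \<Rightarrow> 'm \<Rightarrow> ('m, 'n) tvec \<Rightarrow> ('m, 'n) tvec" where
  "DpH A g H t x p = (THE X. fibre_grad A g H t x p X)"

text \<open>
  Continuity on \<open>[0,T] \<times> TM\<close> is continuity in the bundle charts, which send the tangent vector with
  coordinates \<open>w\<close> at the point with coordinates \<open>y\<close> to \<open>(y, w)\<close>.
\<close>

definition regular_hamiltonian ::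
    "('m, 'n::finite) chart set \<Rightarrow> ('m, 'n) metric \<Rightarrow> real \<Rightarrow>
      (real \<Rightarrow> 'm \<Rightarrow> ('m, 'n) tvec \<Rightarrow> real) \<Rightarrow> bool" where
  "regular_hamiltonian A g T H \<longleftrightarrow>
     (\<forall>c\<in>A. continuous_on ({0..T} \<times> chart_image c \<times> UNIV)
        (\<lambda>(t, y, w). H t (chart_inv c y) (tangent_vec A c (chart_inv c y) w))) \<and>
     (\<forall>t\<in>{0..T}. \<forall>x. \<forall>p\<in>tangent_space A x. \<exists>X. fibre_grad A g H t x p X) \<and>
     (\<forall>c\<in>A. continuous_on ({0..T} \<times> chart_image c \<times> UNIV)
        (\<lambda>(t, y, w). DpH A g H t (chart_inv c y) (tangent_vec A c (chart_inv c y) w) c))"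

definition convex_hamiltonian ::
    "('m, 'n::finite) chart set \<Rightarrow> real \<Rightarrow> (real \<Rightarrow> 'm \<Rightarrow> ('m, 'n) tvec \<Rightarrow> real) \<Rightarrow> bool" where
  "convex_hamiltonian A T H \<longleftrightarrow>
     (\<forall>t\<in>{0..T}. \<forall>x. \<forall>p\<in>tangent_space A x. \<forall>q\<in>tangent_space A x. \<forall>a\<in>{0..1}.
        H t x (\<lambda>c. (1 - a) *\<^sub>R p c + a *\<^sub>R q c) \<le> (1 - a) * H t x p + a * H t x q)"


section \<open>Probability measures and monotone couplings\<close>

definition borel_probs :: "'m::topological_space measure set" where
  "borel_probs = {\<mu>. prob_space \<mu> \<and> sets \<mu> = sets borel}"

definition weak_topology :: "'m::topological_space measure topology" where
  "weak_topology = topology_generated_by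
     {{\<mu> \<in> borel_probs. (\<integral>x. f x \<partial>\<mu>) \<in> U} | f U.
        continuous_on UNIV f \<and> bounded (range f) \<and> open (U :: real set)}"

text \<open>
  The integral against the signed measure \<open>\<mu> - \<nu>\<close> is the difference of the two integrals. The
  Bochner integral of a non-integrable function is 0, so no integrability of \<open>\<Phi>\<close> is assumed.
\<close>

definition monotone_integral ::
    "('m::topological_space \<Rightarrow> 'm measure \<Rightarrow> real) \<Rightarrow> 'm measure \<Rightarrow> 'm measure \<Rightarrow> real" where
  "monotone_integral \<Phi> \<mu> \<nu> = (\<integral>x. \<Phi> x \<mu> - \<Phi> x \<nu> \<partial>\<mu>) - (\<integral>x. \<Phi> x \<mu> - \<Phi> x \<nu> \<partial>\<nu>)"

definition monotone_coupling :: "('m::topological_space \<Rightarrow> 'm measure \<Rightarrow> real) \<Rightarrow> bool" where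
  "monotone_coupling \<Phi> \<longleftrightarrow>
     (\<forall>\<mu>\<in>borel_probs. \<forall>\<nu>\<in>borel_probs. monotone_integral \<Phi> \<mu> \<nu> \<ge> 0)"

definition strictly_monotone_coupling :: "('m::topological_space \<Rightarrow> 'm measure \<Rightarrow> real) \<Rightarrow> bool" where
  "strictly_monotone_coupling \<Phi> \<longleftrightarrow>
     (\<forall>\<mu>\<in>borel_probs. \<forall>\<nu>\<in>borel_probs. \<mu> \<noteq> \<nu> \<longrightarrow> monotone_integral \<Phi> \<mu> \<nu> > 0)"


section \<open>Solutions of the mean field game system\<close>

definition prob_flow_solution ::
    "('m::topological_space, 'n::finite) chart set \<Rightarrow> ('m, 'n) metric \<Rightarrow> real \<Rightarrow> 'm measure \<Rightarrow>
      (real \<Rightarrow> 'm \<Rightarrow> ('m, 'n) tvec) \<Rightarrow> (real \<Rightarrow> 'm measure) \<Rightarrow> bool" where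
  "prob_flow_solution A g T m0 B \<mu> \<longleftrightarrow>
     continuous_map (top_of_set {0..T}) weak_topology \<mu> \<and>
     B \<in> Linf_C1b A g T \<and>
     \<mu> 0 = m0 \<and>
     (\<forall>\<phi>\<in>C12b A g T. \<forall>t\<in>{0..T}.
        (\<integral>x. \<phi> t x \<partial>\<mu> t) - (\<integral>x. \<phi> 0 x \<partial>m0) =
        (LINT s:{0..t}|lborel. (\<integral>x. time_deriv T \<phi> s x + g x (B s x) (grad A g (\<phi> s) x)
            + laplace_beltrami A g (\<phi> s) x \<partial>\<mu> s)))"

definition mfg_drift ::
    "('m, 'n::finite) chart set \<Rightarrow> ('m, 'n) metric \<Rightarrow> (real \<Rightarrow> 'm \<Rightarrow> ('m, 'n) tvec \<Rightarrow> real) \<Rightarrow>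
      (real \<Rightarrow> 'm \<Rightarrow> real) \<Rightarrow> real \<Rightarrow> 'm \<Rightarrow> ('m, 'n) tvec" where
  "mfg_drift A g H v t x = (\<lambda>c. - DpH A g H t x (grad A g (v t) x) c)"

definition mfg_solution ::
    "('m::topological_space, 'n::finite) chart set \<Rightarrow> ('m, 'n) metric \<Rightarrow> real \<Rightarrow> 'm measure \<Rightarrow>
      (real \<Rightarrow> 'm \<Rightarrow> ('m, 'n) tvec \<Rightarrow> real) \<Rightarrow> (real \<Rightarrow> 'm \<Rightarrow> 'm measure \<Rightarrow> real) \<Rightarrow>
      ('m \<Rightarrow> 'm measure \<Rightarrow> real) \<Rightarrow> (real \<Rightarrow> 'm \<Rightarrow> real) \<Rightarrow> (real \<Rightarrow> 'm measure) \<Rightarrow> bool" where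
  "mfg_solution A g T m0 H F G v \<mu> \<longleftrightarrow>
     v \<in> C12b A g T \<and>
     (\<forall>t\<in>{0..<T}. \<forall>x.
        - time_deriv T v t x - laplace_beltrami A g (v t) x + H t x (grad A g (v t) x) = F t x (\<mu> t)) \<and>
     (\<forall>x. v T x = G x (\<mu> T)) \<and>
     prob_flow_solution A g T m0 (mfg_drift A g H v) \<mu>"

end

theory Submission
  imports Defs
begin

text \<open>
  Lasry--Lions: testing both Fokker--Planck equations with \<open>w = v\<^sub>1 - v\<^sub>2\<close> gives
  \<open>\<integral>\<^sub>0\<^sup>T\<close> of (monotonicity integral of \<open>F\<close>) plus (two convexity remainders of \<open>H\<close>) equal to minus
  the monotonicity integral of \<open>G\<close>, so all these nonnegative terms vanish for almost every time.
  Strict monotonicity yields \<open>\<mu>\<^sub>1 = \<mu>\<^sub>2 = \<mu>\<close>, first for almost every and then by weak continuity for every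
  time.

  For \<open>v\<^sub>1 = v\<^sub>2\<close> the maximum principle is not available, since \<open>M\<close> need not be compact or complete. Instead,
  \<open>\<mu>\<^sub>t\<close> has full support for \<open>t > 0\<close>: a compactly supported subsolution of the backward equation, carried
  by a ball that moves within a chart, propagates the support at infinite speed, and \<open>M\<close> is connected.
  Hence the convexity remainder vanishes everywhere, \<open>w\<close> solves \<open>\<partial>\<^sub>t w + \<Delta> w + B\<^sub>1 \<cdot> \<nabla> w = 0\<close>, and
  testing with \<open>w\<^sup>2\<close> gives \<open>\<integral>\<integral> 2 |\<nabla> w|\<^sup>2 d\<mu> dt \<le> 0\<close>. So \<open>\<nabla> w = 0\<close>, then \<open>\<partial>\<^sub>t w = 0\<close>, and \<open>w(T) = 0\<close>.
\<close>

section \<open>Time dependent functions of class \<open>C\<^sup>k\<close> in space\<close>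

text \<open>The evolution of the measures is accessible only through bounded test functions, so
  every step is a choice of test function. On a noncompact \<open>M\<close> this rests on the bounds
  in \<open>C12b\<close>: \<open>w\<close> and its square are again admissible, and a bound on the
  covariant Hessian bounds the Laplacian uniformly, because the trace can be taken in an orthonormal
  basis for the metric. \<open>F\<close> comes without any integrability in \<open>x\<close>. Its
  difference along the two flows is read off from the Hamilton-Jacobi equations as a combination of
  the generator of \<open>w\<close> and a convexity remainder, and so is bounded and continuous. The
  values of \<open>H\<close> along the gradients may be unbounded, but they cancel in the sum of the
  two remainders; both being nonnegative, each is bounded. Gradient and divergence are defined by
  \<open>THE\<close> over all charts, so chart independence comes before any computation. Its core
  is the transformation law of the Christoffel symbols, where symmetry of second derivatives
  enters.\<close>

primrec Ctk_on :: "nat \<Rightarrow> real set \<Rightarrow> 'a::euclidean_space set \<Rightarrow> (real \<Rightarrow> 'a \<Rightarrow> real) \<Rightarrow> bool" where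
  "Ctk_on 0 I S f \<longleftrightarrow> continuous_on (I \<times> S) (\<lambda>(t, y). f t y)"
| "Ctk_on (Suc k) I S f \<longleftrightarrow> continuous_on (I \<times> S) (\<lambda>(t, y). f t y) \<and>
     (\<forall>t\<in>I. \<forall>y\<in>S. f t differentiable (at y)) \<and>
     (\<forall>w. Ctk_on k I S (\<lambda>t y. frechet_derivative (f t) (at y) w))"

lemma Ctk_on_continuous: "Ctk_on k I S f \<Longrightarrow> continuous_on (I \<times> S) (\<lambda>(t, y). f t y)"
  by (cases k) auto

lemma Ctk_on_SucD: "Ctk_on (Suc k) I S f \<Longrightarrow> Ctk_on k I S f"
  by (induction k arbitrary: f) auto

lemma frechet_derivative_cong_open:
  assumes "open S" "y \<in> S" "\<And>z. z \<in> S \<Longrightarrow> f z = g z"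
  shows "frechet_derivative f (at y) = frechet_derivative g (at y)"
    and "f differentiable (at y) \<longleftrightarrow> g differentiable (at y)"
proof -
  have "(f has_derivative D) (at y) \<longleftrightarrow> (g has_derivative D) (at y)" for D
    using assms by (metis has_derivative_transform_within_open)
  then show "frechet_derivative f (at y) = frechet_derivative g (at y)"
    and "f differentiable (at y) \<longleftrightarrow> g differentiable (at y)"
    by (auto simp: frechet_derivative_def differentiable_def)
qed

text \<open>Openness of \<open>S\<close> makes derivatives depend on the values in \<open>S\<close>
  alone. By this an object defined through \<open>THE\<close>, such as a gradient, inherits the
  regularity of its coordinate formula.\<close>

lemma Ctk_on_cong:
  assumes "open S" "\<And>t y. t \<in> I \<Longrightarrow> y \<in> S \<Longrightarrow> f t y = g t y"
  shows "Ctk_on k I S f \<longleftrightarrow> Ctk_on k I S g"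
  using assms(2)
proof (induction k arbitrary: f g)
  case 0
  then show ?case by (auto intro!: continuous_on_cong)
next
  case (Suc k)
  have "continuous_on (I \<times> S) (\<lambda>(t, y). f t y) \<longleftrightarrow> continuous_on (I \<times> S) (\<lambda>(t, y). g t y)"
    using Suc.prems by (auto intro!: continuous_on_cong)
  moreover have "(\<forall>t\<in>I. \<forall>y\<in>S. f t differentiable (at y)) \<longleftrightarrow> (\<forall>t\<in>I. \<forall>y\<in>S. g t differentiable (at y))"
    using frechet_derivative_cong_open(2)[OF assms(1), of _ "f _" "g _"] Suc.prems by blast
  moreover have "Ctk_on k I S (\<lambda>t y. frechet_derivative (f t) (at y) w) \<longleftrightarrow>
      Ctk_on k I S (\<lambda>t y. frechet_derivative (g t) (at y) w)" for w
    by (rule Suc.IH) (metis frechet_derivative_cong_open(1)[OF assms(1)] Suc.prems)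
  ultimately show ?case by simp
qed

text \<open>Regularity is shown by exhibiting the derivative as a formula \<open>D\<close>:
  \<open>frechet_derivative\<close> is a choice, and only uniqueness of the derivative makes it
  computable.\<close>

lemma Ctk_on_SucI:
  assumes "open S" "continuous_on (I \<times> S) (\<lambda>(t, y). f t y)"
    and "\<And>t y. t \<in> I \<Longrightarrow> y \<in> S \<Longrightarrow> (f t has_derivative (\<lambda>w. D t y w)) (at y)"
    and "\<And>w. Ctk_on k I S (\<lambda>t y. D t y w)"
  shows "Ctk_on (Suc k) I S f"
proof -
  have "frechet_derivative (f t) (at y) = D t y" if "t \<in> I" "y \<in> S" for t y
    using frechet_derivative_at[OF assms(3)[OF that]] by simp
  then have "Ctk_on k I S (\<lambda>t y. frechet_derivative (f t) (at y) w)" for w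
    using Ctk_on_cong[OF assms(1), of I "\<lambda>t y. frechet_derivative (f t) (at y) w" "\<lambda>t y. D t y w" k]
      assms(4) by simp
  then show ?thesis using assms(2,3) by (auto simp: differentiable_def)
qed

lemma Ctk_on_SucE:
  assumes "Ctk_on (Suc k) I S f"
  shows "\<And>t y. t \<in> I \<Longrightarrow> y \<in> S \<Longrightarrow> (f t has_derivative frechet_derivative (f t) (at y)) (at y)"
    and "\<And>w. Ctk_on k I S (\<lambda>t y. frechet_derivative (f t) (at y) w)"
  using assms by (auto simp flip: frechet_derivative_works)

text \<open>Continuity in time suffices because the class differentiates in space only. This covers
  the moving centre and the exponential factor of the barrier.\<close>

lemma Ctk_on_time:
  assumes "open S" "continuous_on I a"
  shows "Ctk_on k I S (\<lambda>t y. a t)"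
proof -
  have c: "continuous_on (I \<times> S) (\<lambda>(t, y). a t)" if "continuous_on I a" for a :: "real \<Rightarrow> real"
    unfolding case_prod_beta by (rule continuous_on_compose2[OF that]) (auto intro!: continuous_intros)
  show ?thesis
    using assms(2)
  proof (induction k arbitrary: a)
    case 0
    then show ?case using c by simp
  next
    case (Suc k)
    then show ?case using c by simp
  qed
qed

lemma Ctk_on_const: "open S \<Longrightarrow> Ctk_on k I S (\<lambda>t y. a)"
  by (rule Ctk_on_time) auto

lemma Ctk_on_add:
  assumes "open S" "Ctk_on k I S f" "Ctk_on k I S g"
  shows "Ctk_on k I S (\<lambda>t y. f t y + g t y)"
  using assms(2,3)
proof (induction k arbitrary: f g)
  case 0
  then show ?case by (auto simp: case_prod_beta intro!: continuous_intros)
next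
  case (Suc k)
  note f = Ctk_on_SucE[OF Suc.prems(1)] and g = Ctk_on_SucE[OF Suc.prems(2)]
  show ?case
  proof (rule Ctk_on_SucI[OF assms(1)])
    show "continuous_on (I \<times> S) (\<lambda>(t, y). f t y + g t y)"
      using Suc.prems[THEN Ctk_on_continuous] by (auto simp: case_prod_beta intro!: continuous_intros)
    show "((\<lambda>y. f t y + g t y) has_derivative
        (\<lambda>w. frechet_derivative (f t) (at y) w + frechet_derivative (g t) (at y) w)) (at y)"
      if "t \<in> I" "y \<in> S" for t y
      by (rule has_derivative_add[OF f(1) g(1)]) (use that in auto)
    show "Ctk_on k I S (\<lambda>t y. frechet_derivative (f t) (at y) w + frechet_derivative (g t) (at y) w)" for w
      by (rule Suc.IH) (use f(2) g(2) in auto)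
  qed
qed

lemma Ctk_on_mult:
  assumes "open S" "Ctk_on k I S f" "Ctk_on k I S g"
  shows "Ctk_on k I S (\<lambda>t y. f t y * g t y)"
  using assms(2,3)
proof (induction k arbitrary: f g)
  case 0
  then show ?case by (auto simp: case_prod_beta intro!: continuous_intros)
next
  case (Suc k)
  note f = Ctk_on_SucE[OF Suc.prems(1)] and g = Ctk_on_SucE[OF Suc.prems(2)]
  show ?case
  proof (rule Ctk_on_SucI[OF assms(1)])
    show "continuous_on (I \<times> S) (\<lambda>(t, y). f t y * g t y)"
      using Suc.prems[THEN Ctk_on_continuous] by (auto simp: case_prod_beta intro!: continuous_intros)
    show "((\<lambda>y. f t y * g t y) has_derivative
        (\<lambda>w. f t y * frechet_derivative (g t) (at y) w + frechet_derivative (f t) (at y) w * g t y)) (at y)"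
      if "t \<in> I" "y \<in> S" for t y
      by (rule has_derivative_mult[OF f(1) g(1)]) (use that in auto)
    show "Ctk_on k I S (\<lambda>t y. f t y * frechet_derivative (g t) (at y) w
        + frechet_derivative (f t) (at y) w * g t y)" for w
      by (intro Ctk_on_add[OF assms(1)] Suc.IH Ctk_on_SucD[OF Suc.prems(1)] Ctk_on_SucD[OF Suc.prems(2)] f(2) g(2))
  qed
qed

lemma Ctk_on_minus: "open S \<Longrightarrow> Ctk_on k I S f \<Longrightarrow> Ctk_on k I S (\<lambda>t y. - f t y)"
  using Ctk_on_mult[of S k I "\<lambda>_ _. -1" f] Ctk_on_const[of S k I "-1"] by simp

lemma Ctk_on_diff:
  "open S \<Longrightarrow> Ctk_on k I S f \<Longrightarrow> Ctk_on k I S g \<Longrightarrow> Ctk_on k I S (\<lambda>t y. f t y - g t y)"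
  using Ctk_on_add[of S k I f "\<lambda>t y. - g t y"] Ctk_on_minus[of S k I g] by simp

lemma Ctk_on_sum:
  assumes "open S" "\<And>i. i \<in> J \<Longrightarrow> Ctk_on k I S (f i)"
  shows "Ctk_on k I S (\<lambda>t y. \<Sum>i\<in>J. f i t y)"
  using assms(2)
  by (induction J rule: infinite_finite_induct) (auto intro: Ctk_on_const Ctk_on_add assms(1))

lemma Ctk_on_prod:
  assumes "open S" "\<And>i. i \<in> J \<Longrightarrow> Ctk_on k I S (f i)"
  shows "Ctk_on k I S (\<lambda>t y. \<Prod>i\<in>J. f i t y)"
  using assms(2)
  by (induction J rule: infinite_finite_induct) (auto intro: Ctk_on_const Ctk_on_mult assms(1))

text \<open>The derivative of the reciprocal contains the reciprocal again, but there one order of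
  regularity less is required, so the induction hypothesis applies to it.\<close>

lemma Ctk_on_inverse:
  assumes "open S" "Ctk_on k I S f" "\<And>t y. t \<in> I \<Longrightarrow> y \<in> S \<Longrightarrow> f t y \<noteq> 0"
  shows "Ctk_on k I S (\<lambda>t y. inverse (f t y))"
  using assms(2)
proof (induction k)
  case 0
  then show ?case using assms(3) by (auto simp: case_prod_beta intro!: continuous_intros)
next
  case (Suc k)
  note f = Ctk_on_SucE[OF Suc.prems(1)]
  note inv = Suc.IH[OF Ctk_on_SucD[OF Suc.prems(1)]]
  show ?case
  proof (rule Ctk_on_SucI[OF assms(1)])
    show "continuous_on (I \<times> S) (\<lambda>(t, y). inverse (f t y))"
      using Suc.prems[THEN Ctk_on_continuous] assms(3) by (auto simp: case_prod_beta intro!: continuous_intros)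
    show "((\<lambda>y. inverse (f t y)) has_derivative
        (\<lambda>w. - (inverse (f t y) * frechet_derivative (f t) (at y) w * inverse (f t y)))) (at y)"
      if "t \<in> I" "y \<in> S" for t y
      by (rule Deriv.has_derivative_inverse) (use that assms(3) f(1) in auto)
    show "Ctk_on k I S (\<lambda>t y. - (inverse (f t y) * frechet_derivative (f t) (at y) w * inverse (f t y)))" for w
      by (intro Ctk_on_minus Ctk_on_mult assms(1) inv f(2))
  qed
qed

lemma Ctk_on_of_Ck_on:
  assumes "open S" "Ck_on k S f"
  shows "Ctk_on k I S (\<lambda>t. f)"
proof -
  have c: "continuous_on (I \<times> S) (\<lambda>(t, y). f y)" if "continuous_on S f" for f :: "'a \<Rightarrow> real"
    unfolding case_prod_beta by (rule continuous_on_compose2[OF that]) (auto intro!: continuous_intros)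
  show ?thesis
    using assms(2)
  proof (induction k arbitrary: f)
    case 0
    then show ?case using c by simp
  next
    case (Suc k)
    moreover have "continuous_on S f"
      using Suc.prems by (auto intro!: continuous_at_imp_continuous_on differentiable_imp_continuous_within)
    ultimately show ?case using c by simp
  qed
qed

lemma Ck_on_of_Ctk_on:
  assumes "Ctk_on k I S f" "t \<in> I"
  shows "Ck_on k S (f t)"
proof -
  have "Ctk_on k I S f \<Longrightarrow> Ck_on k S (f t)"
  proof (induction k arbitrary: f)
    case 0
    then have "continuous_on S ((\<lambda>(t, y). f t y) \<circ> (\<lambda>y. (t, y)))"
      by (intro continuous_on_compose) (auto intro!: continuous_intros elim: continuous_on_subset simp: \<open>t \<in> I\<close>)
    then show ?case by (simp add: o_def)
  next
    case (Suc k)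
    then show ?case using \<open>t \<in> I\<close> by auto
  qed
  then show ?thesis using assms by blast
qed

lemma Ctk_on_subset:
  assumes "Ctk_on k I S f" "J \<subseteq> I" "S' \<subseteq> S"
  shows "Ctk_on k J S' f"
  using assms(1)
proof (induction k arbitrary: f)
  case 0
  then show ?case using assms(2,3) by (auto elim!: continuous_on_subset)
next
  case (Suc k)
  then have "continuous_on (J \<times> S') (\<lambda>(t, y). f t y)"
    using assms(2,3) by (auto elim!: continuous_on_subset)
  with Suc show ?case using assms(2,3) by (simp add: subset_iff)
qed

text \<open>The neighbourhoods have the form \<open>UNIV \<times> U\<close>: localising in space
  only leaves the time set \<open>I\<close>, usually a compact interval, untouched.\<close>

lemma continuous_on_Times_local:
  fixes f :: "'a::t2_space \<times> 'b::t2_space \<Rightarrow> 'c::topological_space"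
  assumes loc: "\<And>y. y \<in> S \<Longrightarrow> \<exists>U. open U \<and> y \<in> U \<and> continuous_on (I \<times> (U \<inter> S)) f"
  shows "continuous_on (I \<times> S) f"
  unfolding continuous_on_eq_continuous_within
proof
  fix p assume p: "p \<in> I \<times> S"
  then obtain U where U: "open U" "snd p \<in> U" "continuous_on (I \<times> (U \<inter> S)) f"
    using loc[of "snd p"] by auto
  then have "continuous (at p within (I \<times> S) \<inter> (UNIV \<times> U)) f"
    using p unfolding continuous_on_eq_continuous_within
    by (cases p) (auto simp: Int_commute Times_Int_Times)
  moreover have "at p within I \<times> S = at p within (I \<times> S) \<inter> (UNIV \<times> U)"
  proof (rule at_within_nhd)
    show "open ((UNIV :: 'a set) \<times> U)" using U(1) by (intro open_Times) auto
  qed (use U(2) in \<open>cases p, auto\<close>)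
  ultimately show "continuous (at p within I \<times> S) f" by simp
qed

lemma Ctk_on_local:
  assumes "\<And>y. y \<in> S \<Longrightarrow> \<exists>U. open U \<and> y \<in> U \<and> Ctk_on k I (U \<inter> S) f"
  shows "Ctk_on k I S f"
proof -
  note c = continuous_on_Times_local
  show ?thesis
    using assms
  proof (induction k arbitrary: f)
    case 0
    show ?case unfolding Ctk_on.simps by (rule c) (rule 0[unfolded Ctk_on.simps])
  next
    case (Suc k)
    have loc: "\<exists>U. open U \<and> y \<in> U \<and> continuous_on (I \<times> (U \<inter> S)) (\<lambda>(t, y). f t y) \<and>
        (\<forall>t\<in>I. \<forall>z\<in>U \<inter> S. f t differentiable (at z)) \<and>
        (\<forall>w. Ctk_on k I (U \<inter> S) (\<lambda>t y. frechet_derivative (f t) (at y) w))" if "y \<in> S" for y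
      using Suc.prems[OF that] by simp
    have "continuous_on (I \<times> S) (\<lambda>(t, y). f t y)"
      by (rule c) (use loc in meson)
    moreover have "f t differentiable at y" if "t \<in> I" "y \<in> S" for t y
      using loc[OF that(2)] that by (meson IntI)
    moreover have "Ctk_on k I S (\<lambda>t y. frechet_derivative (f t) (at y) w)" for w
      by (rule Suc.IH) (use loc in meson)
    ultimately show ?case by simp
  qed
qed

lemma frechet_derivative_eq_sum_partial:
  fixes f :: "real^'n::finite \<Rightarrow> real"
  assumes "f differentiable (at y)"
  shows "frechet_derivative f (at y) w = (\<Sum>i\<in>UNIV. w $ i * partial i f y)"
proof -
  interpret linear "frechet_derivative f (at y)"
    using assms by (rule linear_frechet_derivative)
  have "frechet_derivative f (at y) w = frechet_derivative f (at y) (\<Sum>i\<in>UNIV. (w $ i) *\<^sub>R axis i 1)"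
    using basis_expansion[of w] by (simp add: scalar_mult_eq_scaleR)
  then show ?thesis by (simp add: sum scale partial_def)
qed

text \<open>The derivative of the composite is a sum of products of derivatives of the components of
  \<open>\<tau>\<close> with partial derivatives of \<open>f\<close> at \<open>\<tau> y\<close>. The
  latter are composites of the same kind with \<open>k\<close> lowered, which is why the induction
  runs over all \<open>f\<close>.\<close>

lemma Ctk_on_compose:
  fixes f :: "real \<Rightarrow> real^'n::finite \<Rightarrow> real" and \<tau> :: "'a::euclidean_space \<Rightarrow> real^'n"
  assumes "open S" "open S'" "\<tau> ` S \<subseteq> S'"
    and "Ctk_on k I S' f" "\<And>i. Ctk_on k I S (\<lambda>t y. \<tau> y $ i)"
    and "continuous_on S \<tau>"
  shows "Ctk_on k I S (\<lambda>t y. f t (\<tau> y))"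
proof -
  have c: "continuous_on (I \<times> S) (\<lambda>(t, y). f t (\<tau> y))"
    if "continuous_on (I \<times> S') (\<lambda>(t, y). f t y)" for f
  proof -
    have "continuous_on (I \<times> S) (\<lambda>p. (fst p, \<tau> (snd p)))"
      by (intro continuous_intros continuous_on_compose2[OF assms(6)]) auto
    from continuous_on_compose2[OF that this]
    show ?thesis using assms(3) by (force simp: case_prod_beta)
  qed
  show ?thesis
    using assms(4,5)
  proof (induction k arbitrary: f)
    case 0
    then show ?case using c by simp
  next
    case (Suc k)
    note f = Ctk_on_SucE[OF Suc.prems(1)]
    \<comment> \<open>The regularity of \<open>\<tau>\<close> is recorded by \<open>Ctk_on\<close>
      over \<open>I\<close> and says nothing for empty \<open>I\<close>; a time in \<open>I\<close>
      has to be at hand before \<open>\<tau>\<close> can be differentiated.\<close>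
    have \<tau>i: "((\<lambda>y. \<tau> y $ i) has_derivative frechet_derivative (\<lambda>y. \<tau> y $ i) (at y)) (at y)"
      if "t \<in> I" "y \<in> S" for t y i
      using Ctk_on_SucE(1)[OF Suc.prems(2) that] .
    have \<tau>: "(\<tau> has_derivative (\<lambda>w. \<chi> i. frechet_derivative (\<lambda>y. \<tau> y $ i) (at y) w)) (at y)"
      if "t \<in> I" "y \<in> S" for t y
      unfolding has_derivative_componentwise_within[of \<tau>]
      using \<tau>i[OF that] by (auto simp: Basis_vec_def inner_axis)
    show ?case
    proof (rule Ctk_on_SucI[OF assms(1)])
      show "continuous_on (I \<times> S) (\<lambda>(t, y). f t (\<tau> y))"
        by (rule c[OF Ctk_on_continuous[OF Suc.prems(1)]])
      show "((\<lambda>y. f t (\<tau> y)) has_derivative (\<lambda>w. \<Sum>i\<in>UNIV.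
          frechet_derivative (\<lambda>y. \<tau> y $ i) (at y) w * partial i (f t) (\<tau> y))) (at y)"
        if "t \<in> I" "y \<in> S" for t y
      proof -
        have "\<tau> y \<in> S'" using that assms(3) by auto
        note D = has_derivative_compose[OF \<tau>[OF that] f(1)[OF that(1) this]]
        have "f t differentiable at (\<tau> y)"
          using f(1)[OF that(1) \<open>\<tau> y \<in> S'\<close>] by (auto simp: differentiable_def)
        from D show ?thesis
          unfolding frechet_derivative_eq_sum_partial[OF \<open>f t differentiable at (\<tau> y)\<close>] by simp
      qed
      show "Ctk_on k I S (\<lambda>t y. \<Sum>i\<in>UNIV.
          frechet_derivative (\<lambda>y. \<tau> y $ i) (at y) w * partial i (f t) (\<tau> y))" for w
      proof (intro Ctk_on_sum Ctk_on_mult assms(1) Ctk_on_SucE(2)[OF Suc.prems(2)])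
        show "Ctk_on k I S (\<lambda>t y. partial i (f t) (\<tau> y))" for i
          unfolding partial_def
          by (rule Suc.IH[OF f(2) Ctk_on_SucD[OF Suc.prems(2)]])
      qed
    qed
  qed
qed

lemma Ctk_on_coord:
  assumes "open S"
  shows "Ctk_on k I S (\<lambda>t y. (y :: real^'n::finite) $ i)"
proof -
  have c: "continuous_on (I \<times> S) (\<lambda>(t, y). y $ i)"
    unfolding case_prod_beta by (intro continuous_intros)
  show ?thesis
  proof (cases k)
    case 0
    then show ?thesis using c by simp
  next
    case (Suc l)
    have "Ctk_on (Suc l) I S (\<lambda>t y. y $ i)"
      by (rule Ctk_on_SucI[OF assms c, where D = "\<lambda>t y w. w $ i"])
        (auto intro!: Ctk_on_const assms bounded_linear_imp_has_derivative bounded_linear_vec_nth)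
    then show ?thesis using Suc by simp
  qed
qed

text \<open>Meant for powers of the positive part, which are not smooth. Of \<open>h'\<close> along
  \<open>f\<close> it asks just the order that the chain rule leaves, so the powers can be treated
  in increasing order.\<close>

lemma Ctk_on_real_compose:
  fixes h h' :: "real \<Rightarrow> real"
  assumes "open S" "Ctk_on (Suc k) I S f" "\<And>u. (h has_real_derivative h' u) (at u)"
    and "Ctk_on k I S (\<lambda>t y. h' (f t y))"
  shows "Ctk_on (Suc k) I S (\<lambda>t y. h (f t y))"
proof (rule Ctk_on_SucI[OF assms(1)])
  note f = Ctk_on_SucE[OF assms(2)]
  have "continuous_on UNIV h"
    using assms(3) DERIV_isCont by (auto simp: continuous_on_eq_continuous_at)
  from continuous_on_compose2[OF this Ctk_on_continuous[OF assms(2)]]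
  show "continuous_on (I \<times> S) (\<lambda>(t, y). h (f t y))" by (simp add: case_prod_beta)
  show "((\<lambda>y. h (f t y)) has_derivative (\<lambda>w. h' (f t y) * frechet_derivative (f t) (at y) w)) (at y)"
    if "t \<in> I" "y \<in> S" for t y
    using has_derivative_compose[OF f(1)[OF that] assms(3)[unfolded has_field_derivative_def]] .
  show "Ctk_on k I S (\<lambda>t y. h' (f t y) * frechet_derivative (f t) (at y) w)" for w
    by (intro Ctk_on_mult assms f)
qed

section \<open>Symmetry of mixed second derivatives\<close>

lemma second_difference:
  fixes f :: "'a::euclidean_space \<Rightarrow> real"
  assumes conv: "\<And>a b. a \<in> {0..s} \<Longrightarrow> b \<in> {0..s} \<Longrightarrow> y + a *\<^sub>R u + b *\<^sub>R w \<in> S" and "s > 0"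
    and f: "\<And>z. z \<in> S \<Longrightarrow> f differentiable (at z)"
    and fu: "\<And>z. z \<in> S \<Longrightarrow> (\<lambda>z. frechet_derivative f (at z) u) differentiable (at z)"
  shows "\<exists>a\<in>{0..s}. \<exists>b\<in>{0..s}. f (y + s *\<^sub>R u + s *\<^sub>R w) - f (y + s *\<^sub>R u) - f (y + s *\<^sub>R w) + f y =
     s\<^sup>2 * frechet_derivative (\<lambda>z. frechet_derivative f (at z) u) (at (y + a *\<^sub>R u + b *\<^sub>R w)) w"
proof -
  \<comment> \<open>The second difference of \<open>f\<close> is the increment of \<open>F\<close>
    over \<open>[0,s]\<close>. The mean value theorem along \<open>u\<close> turns it into an
    increment of \<open>D\<close> along \<open>w\<close>, and a second application turns that into a
    mixed derivative.\<close>
  define F where "F = (\<lambda>a. f (y + a *\<^sub>R u + s *\<^sub>R w) - f (y + a *\<^sub>R u))"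
  define D where "D = (\<lambda>z. frechet_derivative f (at z) u)"
  have fd: "(f has_derivative frechet_derivative f (at z)) (at z)" if "z \<in> S" for z
    using f[OF that] frechet_derivative_works by blast
  have Dd: "(D has_derivative frechet_derivative D (at z)) (at z)" if "z \<in> S" for z
    using fu[OF that] frechet_derivative_works unfolding D_def by blast
  have *: "((\<lambda>a. f (y + a *\<^sub>R u + b *\<^sub>R w)) has_real_derivative D (y + a *\<^sub>R u + b *\<^sub>R w)) (at a)"
    if "a \<in> {0..s}" "b \<in> {0..s}" for a b
  proof -
    have "((\<lambda>a. y + a *\<^sub>R u + b *\<^sub>R w) has_derivative (\<lambda>h. h *\<^sub>R u)) (at a)"
      by (auto intro!: derivative_eq_intros)
    from has_derivative_compose[OF this fd[OF conv[OF that]]]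
    have "((\<lambda>a. f (y + a *\<^sub>R u + b *\<^sub>R w)) has_derivative
        (\<lambda>h. frechet_derivative f (at (y + a *\<^sub>R u + b *\<^sub>R w)) (h *\<^sub>R u))) (at a)" .
    moreover have "linear (frechet_derivative f (at (y + a *\<^sub>R u + b *\<^sub>R w)))"
      by (rule linear_frechet_derivative[OF f[OF conv[OF that]]])
    ultimately show ?thesis
      unfolding has_field_derivative_def D_def by (simp add: linear_cmul mult_commute_abs)
  qed
  have "\<exists>a>0. a < s \<and> F s - F 0 = (s - 0) * (D (y + a *\<^sub>R u + s *\<^sub>R w) - D (y + a *\<^sub>R u))"
  proof (rule MVT2[OF \<open>s > 0\<close>])
    fix a assume "0 \<le> a" "a \<le> s"
    then show "(F has_real_derivative (D (y + a *\<^sub>R u + s *\<^sub>R w) - D (y + a *\<^sub>R u))) (at a)"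
      unfolding F_def using *[of a s] *[of a 0] \<open>s > 0\<close> by (auto intro!: derivative_eq_intros)
  qed
  then obtain a where a: "0 < a" "a < s" "F s - F 0 = s * (D (y + a *\<^sub>R u + s *\<^sub>R w) - D (y + a *\<^sub>R u))"
    by auto
  have "\<exists>b>0. b < s \<and> D (y + a *\<^sub>R u + s *\<^sub>R w) - D (y + a *\<^sub>R u + 0 *\<^sub>R w) =
      (s - 0) * frechet_derivative D (at (y + a *\<^sub>R u + b *\<^sub>R w)) w"
  proof (rule MVT2[OF \<open>s > 0\<close>])
    fix b assume b: "0 \<le> b" "b \<le> s"
    have S: "y + a *\<^sub>R u + b *\<^sub>R w \<in> S" using a b by (intro conv) auto
    have "((\<lambda>b. y + a *\<^sub>R u + b *\<^sub>R w) has_derivative (\<lambda>h. h *\<^sub>R w)) (at b)"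
      by (auto intro!: derivative_eq_intros)
    from has_derivative_compose[OF this Dd[OF S]]
    have "((\<lambda>b. D (y + a *\<^sub>R u + b *\<^sub>R w)) has_derivative
        (\<lambda>h. frechet_derivative D (at (y + a *\<^sub>R u + b *\<^sub>R w)) (h *\<^sub>R w))) (at b)" .
    moreover have "linear (frechet_derivative D (at (y + a *\<^sub>R u + b *\<^sub>R w)))"
      using fu[OF S] linear_frechet_derivative unfolding D_def by blast
    ultimately show "((\<lambda>b. D (y + a *\<^sub>R u + b *\<^sub>R w)) has_real_derivative
        frechet_derivative D (at (y + a *\<^sub>R u + b *\<^sub>R w)) w) (at b)"
      unfolding has_field_derivative_def by (simp add: linear_cmul mult_commute_abs)
  qed
  then obtain b where b: "0 < b" "b < s" "D (y + a *\<^sub>R u + s *\<^sub>R w) - D (y + a *\<^sub>R u) =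
      s * frechet_derivative D (at (y + a *\<^sub>R u + b *\<^sub>R w)) w"
    by auto
  have "F s - F 0 = s\<^sup>2 * frechet_derivative D (at (y + a *\<^sub>R u + b *\<^sub>R w)) w"
    using a(3) b(3) by (simp add: power2_eq_square)
  then show ?thesis using a b unfolding F_def D_def by (intro bexI[of _ a] bexI[of _ b]) auto
qed

text \<open>The second difference is symmetric in \<open>u\<close> and \<open>w\<close>, while the
  mean value formula evaluates it once by \<open>P\<close> and once by \<open>Q\<close>. So a value
  of \<open>P\<close> and a value of \<open>Q\<close> at points arbitrarily near \<open>y\<close>
  coincide, and continuity carries this to \<open>y\<close>.\<close>

lemma frechet_derivative_symmetric:
  fixes f :: "'a::euclidean_space \<Rightarrow> real"
  assumes "open S" "y \<in> S" "Ck_on 2 S f"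
  shows "frechet_derivative (\<lambda>z. frechet_derivative f (at z) u) (at y) w =
    frechet_derivative (\<lambda>z. frechet_derivative f (at z) w) (at y) u"
proof -
  have C: "\<And>z. z \<in> S \<Longrightarrow> f differentiable (at z)"
    "\<And>z u. z \<in> S \<Longrightarrow> (\<lambda>z. frechet_derivative f (at z) u) differentiable (at z)"
    "\<And>u w. continuous_on S (\<lambda>z. frechet_derivative (\<lambda>z. frechet_derivative f (at z) u) (at z) w)"
    using assms(3) by (auto simp: numeral_2_eq_2)
  define P where "P = (\<lambda>z. frechet_derivative (\<lambda>z. frechet_derivative f (at z) u) (at z) w)"
  define Q where "Q = (\<lambda>z. frechet_derivative (\<lambda>z. frechet_derivative f (at z) w) (at z) u)"
  have "isCont P y" "isCont Q y"
    using C(3) assms(1,2) unfolding P_def Q_def by (auto simp: continuous_on_eq_continuous_at)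
  have "\<bar>P y - Q y\<bar> \<le> e" if "e > 0" for e
  proof -
    obtain d where d: "d > 0" "ball y d \<subseteq> S" using assms(1,2) openE by blast
    obtain d1 where d1: "d1 > 0" "\<And>z. dist z y < d1 \<Longrightarrow> \<bar>P z - P y\<bar> < e/2"
      using \<open>isCont P y\<close> \<open>e > 0\<close> unfolding continuous_at_eps_delta
      by (metis dist_real_def half_gt_zero)
    obtain d2 where d2: "d2 > 0" "\<And>z. dist z y < d2 \<Longrightarrow> \<bar>Q z - Q y\<bar> < e/2"
      using \<open>isCont Q y\<close> \<open>e > 0\<close> unfolding continuous_at_eps_delta
      by (metis dist_real_def half_gt_zero)
    define m where "m = min d (min d1 d2)"
    \<comment> \<open>The summand 1 keeps \<open>N\<close> positive when \<open>u\<close> and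
      \<open>w\<close> are both zero. With \<open>s = m / (2 * N)\<close> the whole parallelogram
      stays within distance \<open>m\<close> of \<open>y\<close>.\<close>
    define N where "N = norm u + norm w + 1"
    define s where "s = m / (2 * N)"
    have m: "m > 0" using d d1 d2 by (simp add: m_def)
    have np: "N > 0" unfolding N_def using norm_ge_zero[of u] norm_ge_zero[of w] by linarith
    then have s: "s > 0" using m by (simp add: s_def)
    have near: "dist (y + a *\<^sub>R u + b *\<^sub>R w) y < m" if "a \<in> {0..s}" "b \<in> {0..s}" for a b
    proof -
      have "dist (y + a *\<^sub>R u + b *\<^sub>R w) y = norm (a *\<^sub>R u + b *\<^sub>R w)" by (simp add: dist_norm add.assoc)
      also have "\<dots> \<le> a * norm u + b * norm w"
        using that norm_triangle_ineq[of "a *\<^sub>R u" "b *\<^sub>R w"] by simp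
      also have "\<dots> \<le> s * norm u + s * norm w"
        using that by (intro add_mono mult_right_mono) auto
      also have "\<dots> < s * N" using s by (simp add: N_def algebra_simps)
      also have "\<dots> = m / 2" using np by (simp add: s_def)
      finally show ?thesis using m by simp
    qed
    have inS: "y + a *\<^sub>R u + b *\<^sub>R w \<in> S" "y + b *\<^sub>R w + a *\<^sub>R u \<in> S" if "a \<in> {0..s}" "b \<in> {0..s}" for a b
      using near[OF that] d(2) by (auto simp: m_def dist_commute subset_iff add_ac)
    obtain a b where ab: "a \<in> {0..s}" "b \<in> {0..s}"
      "f (y + s *\<^sub>R u + s *\<^sub>R w) - f (y + s *\<^sub>R u) - f (y + s *\<^sub>R w) + f y = s\<^sup>2 * P (y + a *\<^sub>R u + b *\<^sub>R w)"
      using second_difference[of s y u w S f, OF inS(1) s C(1) C(2)] unfolding P_def by blast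
    obtain a' b' where ab': "a' \<in> {0..s}" "b' \<in> {0..s}"
      "f (y + s *\<^sub>R w + s *\<^sub>R u) - f (y + s *\<^sub>R w) - f (y + s *\<^sub>R u) + f y = s\<^sup>2 * Q (y + a' *\<^sub>R w + b' *\<^sub>R u)"
      using second_difference[of s y w u S f, OF inS(2) s C(1) C(2)] unfolding Q_def by blast
    have com: "y + s *\<^sub>R w + s *\<^sub>R u = y + s *\<^sub>R u + s *\<^sub>R w" by simp
    have "s\<^sup>2 * P (y + a *\<^sub>R u + b *\<^sub>R w) = s\<^sup>2 * Q (y + a' *\<^sub>R w + b' *\<^sub>R u)"
      using ab(3) ab'(3)[unfolded com] by linarith
    then have "P (y + a *\<^sub>R u + b *\<^sub>R w) = Q (y + a' *\<^sub>R w + b' *\<^sub>R u)" using s by simp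
    moreover have "\<bar>P (y + a *\<^sub>R u + b *\<^sub>R w) - P y\<bar> < e/2"
      using near[OF ab(1,2)] d1(2) by (simp add: m_def)
    moreover have "\<bar>Q (y + a' *\<^sub>R w + b' *\<^sub>R u) - Q y\<bar> < e/2"
    proof (rule d2(2))
      have com': "y + a' *\<^sub>R w + b' *\<^sub>R u = y + b' *\<^sub>R u + a' *\<^sub>R w" by simp
      show "dist (y + a' *\<^sub>R w + b' *\<^sub>R u) y < d2"
        unfolding com' using near[OF ab'(2,1)] by (simp add: m_def)
    qed
    ultimately show ?thesis by linarith
  qed
  then have "\<bar>P y - Q y\<bar> \<le> 0" by (rule dense_ge)
  then have "P y = Q y" by simp
  then show ?thesis by (simp add: P_def Q_def)
qed

section \<open>Charts, tangent vectors and the metric in coordinates\<close>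

text \<open>Changes of coordinates are vector valued while \<open>Ctk_on\<close> speaks of scalar
  functions; their regularity enters through the components.\<close>

lemma Ctk_on_component:
  fixes \<tau> :: "'a::euclidean_space \<Rightarrow> real^'n::finite"
  assumes "open S" "Ck_on k S \<tau>"
  shows "Ctk_on k I S (\<lambda>t y. \<tau> y $ i)"
proof -
  have c: "continuous_on (I \<times> S) (\<lambda>(t, y). \<tau> y $ i)" if "continuous_on S \<tau>" for \<tau> :: "'a \<Rightarrow> real^'n"
    unfolding case_prod_beta
    by (rule continuous_on_component, rule continuous_on_compose2[OF that]) (auto intro!: continuous_intros)
  show ?thesis
    using assms(2)
  proof (induction k arbitrary: \<tau>)
    case 0
    then show ?case using c by simp
  next
    case (Suc k)
    have cont: "continuous_on S \<tau>"
      using Suc.prems by (auto intro!: continuous_at_imp_continuous_on differentiable_imp_continuous_within)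
    show ?case
    proof (rule Ctk_on_SucI[OF assms(1) c[OF cont]])
      show "((\<lambda>y. \<tau> y $ i) has_derivative (\<lambda>w. frechet_derivative \<tau> (at y) w $ i)) (at y)"
        if "y \<in> S" for y
        using Suc.prems that frechet_derivative_works[of \<tau> "at y"]
        by (auto intro: bounded_linear.has_derivative[OF bounded_linear_vec_nth])
      show "Ctk_on k I S (\<lambda>t y. frechet_derivative \<tau> (at y) w $ i)" for w
        by (rule Suc.IH) (use Suc.prems in simp)
    qed
  qed
qed

lemma frechet_derivative_component:
  fixes \<tau> :: "'a::euclidean_space \<Rightarrow> real^'n::finite"
  assumes "\<tau> differentiable (at y)"
  shows "frechet_derivative (\<lambda>z. \<tau> z $ i) (at y) w = frechet_derivative \<tau> (at y) w $ i"
    and "(\<lambda>z. \<tau> z $ i) differentiable (at y)"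
proof -
  have "((\<lambda>z. \<tau> z $ i) has_derivative (\<lambda>w. frechet_derivative \<tau> (at y) w $ i)) (at y)"
    using assms frechet_derivative_works[of \<tau> "at y"]
    by (auto intro: bounded_linear.has_derivative[OF bounded_linear_vec_nth])
  from frechet_derivative_at[OF this] this
  show "frechet_derivative (\<lambda>z. \<tau> z $ i) (at y) w = frechet_derivative \<tau> (at y) w $ i"
    and "(\<lambda>z. \<tau> z $ i) differentiable (at y)"
    by (simp_all add: fun_eq_iff differentiable_def) (metis | auto)+
qed

lemma differentiable_vec:
  fixes \<tau> :: "'a::euclidean_space \<Rightarrow> real^'n::finite"
  assumes "\<And>i. (\<lambda>z. \<tau> z $ i) differentiable (at y)"
  shows "\<tau> differentiable (at y)"
proof -
  have "(\<tau> has_derivative (\<lambda>w. \<chi> i. frechet_derivative (\<lambda>y. \<tau> y $ i) (at y) w)) (at y)"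
    unfolding has_derivative_componentwise_within[of \<tau>]
    using assms by (auto simp: Basis_vec_def inner_axis frechet_derivative_works)
  then show ?thesis by (auto simp: differentiable_def)
qed

lemma linear_vec_expand:
  fixes L :: "real^'n::finite \<Rightarrow> 'b::real_vector"
  assumes "linear L"
  shows "L w = (\<Sum>i\<in>UNIV. w $ i *\<^sub>R L (axis i 1))"
proof -
  have "L w = L (\<Sum>i\<in>UNIV. (w $ i) *\<^sub>R axis i 1)"
    using basis_expansion[of w] by (simp add: scalar_mult_eq_scaleR)
  then show ?thesis using assms by (simp add: linear_sum linear_cmul)
qed

lemma inner_matrix_vector_sum:
  fixes a b :: "real^'n::finite"
  shows "a \<bullet> (B *v b) = (\<Sum>i\<in>UNIV. \<Sum>j\<in>UNIV. a $ i * b $ j * B $ i $ j)"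
  by (simp add: inner_vec_def matrix_vector_mult_def sum_distrib_left algebra_simps)

locale riemannian =
  fixes A :: "('m::{second_countable_topology, t2_space}, 'n::finite) chart set"
    and g :: "('m, 'n) metric"
  assumes manifold: "riemannian_manifold A g"
begin

abbreviation "TS x \<equiv> tangent_space A x"
abbreviation "tv c x w \<equiv> tangent_vec A c x w"
abbreviation "mm c y \<equiv> metric_matrix A g c y"
abbreviation "tr c d \<equiv> (\<lambda>y. snd d (chart_inv c y))"

section \<open>Charts and changes of coordinates\<close>

lemma chart:
  assumes "c \<in> A"
  shows open_dom: "open (fst c)" and open_chart_image: "open (chart_image c)"
    and chart_inv_left: "\<And>x. x \<in> fst c \<Longrightarrow> chart_inv c (snd c x) = x"
    and chart_inv_right: "\<And>y. y \<in> chart_image c \<Longrightarrow> snd c (chart_inv c y) = y"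
    and chart_inv_in: "\<And>y. y \<in> chart_image c \<Longrightarrow> chart_inv c y \<in> fst c"
    and chart_in: "\<And>x. x \<in> fst c \<Longrightarrow> snd c x \<in> chart_image c"
    and continuous_chart: "continuous_on (fst c) (snd c)"
    and continuous_chart_inv: "continuous_on (chart_image c) (chart_inv c)"
proof -
  have "is_chart c"
    using manifold assms by (auto simp: riemannian_manifold_def smooth_atlas_def)
  then show "open (fst c)" "open (chart_image c)"
    "\<And>x. x \<in> fst c \<Longrightarrow> chart_inv c (snd c x) = x"
    "\<And>y. y \<in> chart_image c \<Longrightarrow> snd c (chart_inv c y) = y"
    "\<And>y. y \<in> chart_image c \<Longrightarrow> chart_inv c y \<in> fst c"
    "\<And>x. x \<in> fst c \<Longrightarrow> snd c x \<in> chart_image c"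
    "continuous_on (fst c) (snd c)" "continuous_on (chart_image c) (chart_inv c)"
    unfolding is_chart_def homeomorphism_def by auto
qed

lemma charts_atD:
  assumes "c \<in> charts_at A x"
  shows "c \<in> A" "x \<in> fst c" "snd c x \<in> chart_image c" "chart_inv c (snd c x) = x"
  using assms chart_in chart_inv_left by (auto simp: charts_at_def)

lemma charts_atI: "c \<in> A \<Longrightarrow> y \<in> chart_image c \<Longrightarrow> c \<in> charts_at A (chart_inv c y)"
  using chart_inv_in by (auto simp: charts_at_def)

lemma ex_chart: obtains c where "c \<in> charts_at A x"
proof -
  have "x \<in> (\<Union>c\<in>A. fst c)"
    using manifold by (simp add: riemannian_manifold_def smooth_atlas_def)
  then show ?thesis using that by (auto simp: charts_at_def)
qed

definition overlap :: "('m, 'n) chart \<Rightarrow> ('m, 'n) chart \<Rightarrow> (real^'n) set" where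
  "overlap c d = snd c ` (fst c \<inter> fst d)"

lemma overlap_eq:
  assumes "c \<in> A"
  shows "overlap c d = {y \<in> chart_image c. chart_inv c y \<in> fst d}"
  using chart_in[OF assms] chart_inv_left[OF assms] chart_inv_right[OF assms] chart_inv_in[OF assms]
  by (force simp: overlap_def)

lemma open_overlap:
  assumes "c \<in> A" "d \<in> A"
  shows "open (overlap c d)"
proof -
  have "open (chart_image c \<inter> chart_inv c -` fst d)"
    by (rule continuous_open_preimage[OF continuous_chart_inv open_chart_image open_dom]) fact+
  then show ?thesis by (simp add: overlap_eq[OF assms(1)] vimage_def Int_def)
qed

lemma overlap_trans:
  assumes "c \<in> A" "d \<in> A" "y \<in> overlap c d"
  shows "tr c d y \<in> overlap d c" "chart_inv d (tr c d y) = chart_inv c y" "tr c d y \<in> chart_image d"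
    "chart_inv c y \<in> fst c" "chart_inv c y \<in> fst d" "y \<in> chart_image c"
  using assms chart_inv_in[OF assms(1)] chart_in[OF assms(2)] chart_inv_left[OF assms(2)]
  by (auto simp: overlap_eq)

lemma overlap_at:
  assumes "c \<in> charts_at A x" "d \<in> charts_at A x"
  shows "snd c x \<in> overlap c d"
  using assms by (auto simp: overlap_def charts_at_def)

lemma transition_Ck:
  assumes "c \<in> A" "d \<in> A"
  shows "Ck_on k (overlap c d) (tr c d)"
  using manifold assms by (auto simp: riemannian_manifold_def smooth_atlas_def smooth_on_def overlap_def)

lemma transition_Ctk:
  assumes "c \<in> A" "d \<in> A"
  shows "Ctk_on k I (overlap c d) (\<lambda>t y. tr c d y $ i)"
  by (rule Ctk_on_component[OF open_overlap transition_Ck]) fact+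

lemma transition_differentiable:
  assumes "c \<in> A" "d \<in> A" "y \<in> overlap c d"
  shows "tr c d differentiable (at y)"
  using transition_Ck[OF assms(1,2), of 1] assms(3) by simp

lemma transition_deriv:
  assumes "c \<in> charts_at A x" "d \<in> charts_at A x"
  shows "(tr c d has_derivative transition_deriv c d x) (at (snd c x))"
  using transition_differentiable[OF _ _ overlap_at[OF assms]] assms
  unfolding transition_deriv_def by (auto simp: frechet_derivative_works charts_at_def)

lemma linear_transition:
  "c \<in> charts_at A x \<Longrightarrow> d \<in> charts_at A x \<Longrightarrow> linear (transition_deriv c d x)"
  using transition_deriv has_derivative_linear by blast

text \<open>The chain rule on the overlap. This cocycle identity makes \<open>tangent_vec\<close>
  consistent across charts and, with \<open>c = e\<close>, makes every transition derivative
  invertible.\<close>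

lemma transition_deriv_compose:
  assumes "c \<in> charts_at A x" "d \<in> charts_at A x" "e \<in> charts_at A x"
  shows "transition_deriv d e x (transition_deriv c d x w) = transition_deriv c e x w"
proof -
  note cA = charts_atD[OF assms(1)] and dA = charts_atD[OF assms(2)] and eA = charts_atD[OF assms(3)]
  have "tr c d (snd c x) = snd d x" using cA by simp
  then have "((\<lambda>y. tr d e (tr c d y)) has_derivative
      (\<lambda>w. transition_deriv d e x (transition_deriv c d x w))) (at (snd c x))"
    using has_derivative_compose[OF transition_deriv[OF assms(1,2)], of "tr d e" "transition_deriv d e x"]
      transition_deriv[OF assms(2,3)] by simp
  moreover have "tr d e (tr c d y) = tr c e y" if "y \<in> overlap c d" for y
    using overlap_trans[OF cA(1) dA(1) that] by simp
  ultimately have "(tr c e has_derivative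
      (\<lambda>w. transition_deriv d e x (transition_deriv c d x w))) (at (snd c x))"
    by (rule has_derivative_transform_within_open[OF _ open_overlap[OF cA(1) dA(1)] overlap_at[OF assms(1,2)]])
  from fun_cong[OF has_derivative_unique[OF this transition_deriv[OF assms(1,3)]], of w]
  show ?thesis .
qed

lemma transition_deriv_self:
  assumes "c \<in> charts_at A x"
  shows "transition_deriv c c x w = w"
proof -
  note cA = charts_atD[OF assms]
  have "(tr c c has_derivative (\<lambda>w. w)) (at (snd c x))"
    by (rule has_derivative_transform_within_open[OF has_derivative_ident open_chart_image cA(3)])
      (use cA chart_inv_right in auto)
  from fun_cong[OF has_derivative_unique[OF this transition_deriv[OF assms assms]], of w]
  show ?thesis by simp
qed

section \<open>Tangent vectors in coordinates\<close>

lemma tv_in: "c \<in> charts_at A x \<Longrightarrow> tv c x w \<in> TS x"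
  by (auto simp: tangent_space_def tangent_vec_def transition_deriv_compose)

lemma tv_apply: "d \<in> charts_at A x \<Longrightarrow> tv c x w d = transition_deriv c d x w"
  by (simp add: tangent_vec_def)

lemma tv_self: "c \<in> charts_at A x \<Longrightarrow> tv c x w c = w"
  by (simp add: tv_apply transition_deriv_self)

text \<open>One chart determines the whole family: in charts around \<open>x\<close> the entries are
  forced by the transition derivatives, and in all others they are 0 by convention.\<close>

lemma tv_eq:
  assumes "p \<in> TS x" "c \<in> charts_at A x"
  shows "tv c x (p c) = p"
proof
  show "tv c x (p c) d = p d" for d
  proof (cases "d \<in> charts_at A x")
    case True
    then have "p d = transition_deriv c d x (p c)"
      using assms unfolding tangent_space_def by blast
    with True show ?thesis by (simp add: tangent_vec_def)
  next
    case False
    with assms(1) have "p d = 0" unfolding tangent_space_def by blast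
    with False show ?thesis by (simp add: tangent_vec_def)
  qed
qed

lemma TS_eqI: "p \<in> TS x \<Longrightarrow> q \<in> TS x \<Longrightarrow> c \<in> charts_at A x \<Longrightarrow> p c = q c \<Longrightarrow> p = q"
  using tv_eq by metis

lemma tv_linear:
  assumes "c \<in> charts_at A x"
  shows "tv c x (a *\<^sub>R u + b *\<^sub>R w) = (\<lambda>d. a *\<^sub>R tv c x u d + b *\<^sub>R tv c x w d)"
  using linear_transition[OF assms]
  by (auto simp: tangent_vec_def fun_eq_iff linear_add linear_cmul)

lemma TS_lincomb:
  assumes "p \<in> TS x" "q \<in> TS x"
  shows "(\<lambda>c. a *\<^sub>R p c + b *\<^sub>R q c) \<in> TS x"
proof -
  obtain c where c: "c \<in> charts_at A x" by (rule ex_chart)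
  have "(\<lambda>d. a *\<^sub>R p d + b *\<^sub>R q d) = tv c x (a *\<^sub>R p c + b *\<^sub>R q c)"
    using tv_linear[OF c] tv_eq[OF assms(1) c] tv_eq[OF assms(2) c] by simp
  then show ?thesis using tv_in[OF c] by simp
qed

lemma TS_minus: "p \<in> TS x \<Longrightarrow> (\<lambda>c. - p c) \<in> TS x"
  using TS_lincomb[of p x p "-1" 0] by simp

lemma TS_diff: "p \<in> TS x \<Longrightarrow> q \<in> TS x \<Longrightarrow> (\<lambda>c. p c - q c) \<in> TS x"
  using TS_lincomb[of p x q 1 "-1"] by simp

section \<open>The metric in coordinates\<close>

lemma metric_sym: "p \<in> TS x \<Longrightarrow> q \<in> TS x \<Longrightarrow> g x p q = g x q p"
  using manifold by (auto simp: riemannian_manifold_def riemannian_metric_def)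

lemma metric_lincomb:
  "p \<in> TS x \<Longrightarrow> q \<in> TS x \<Longrightarrow> r \<in> TS x \<Longrightarrow>
    g x (\<lambda>c. a *\<^sub>R p c + b *\<^sub>R q c) r = a * g x p r + b * g x q r"
  using manifold unfolding riemannian_manifold_def riemannian_metric_def by blast

lemma metric_pos: "p \<in> TS x \<Longrightarrow> p \<noteq> (\<lambda>c. 0) \<Longrightarrow> g x p p > 0"
  using manifold by (auto simp: riemannian_manifold_def riemannian_metric_def)

lemma metric_coords:
  assumes "p \<in> TS x" "q \<in> TS x" "c \<in> charts_at A x"
  shows "g x p q = p c \<bullet> (mm c (snd c x) *v q c)"
proof -
  define b where "b = (\<lambda>u w. g x (tv c x u) (tv c x w))"
  have lin: "linear (\<lambda>u. b u w)" for w
  proof (rule linearI)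
    show "b (u + v) w = b u w + b v w" for u v
      using metric_lincomb[OF tv_in tv_in tv_in, OF assms(3,3,3), of 1 u 1 v w] tv_linear[OF assms(3), of 1 u 1 v]
      by (simp add: b_def)
    show "b (r *\<^sub>R u) w = r *\<^sub>R b u w" for r u
      using metric_lincomb[OF tv_in tv_in tv_in, OF assms(3,3,3), of r u 0 u w] tv_linear[OF assms(3), of r u 0 u]
      by (simp add: b_def)
  qed
  have sym: "b u w = b w u" for u w
    unfolding b_def by (rule metric_sym) (use tv_in assms(3) in auto)
  have e1: "b u w = (\<Sum>i\<in>UNIV. u $ i * b (axis i 1) w)" for u w
    using linear_vec_expand[OF lin[of w], of u] by (simp only: real_scaleR_def)
  \<comment> \<open>Linearity of \<open>g\<close> is postulated in the first argument; in the second
    it comes from symmetry.\<close>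
  have e2: "b (axis i 1) w = (\<Sum>j\<in>UNIV. w $ j * b (axis i 1) (axis j 1))" for i w
    using e1[of w "axis i 1"] unfolding sym[of w] sym[of "axis _ 1" "axis i 1"] .
  have "g x p q = b (p c) (q c)"
    by (simp add: b_def tv_eq assms)
  also have "\<dots> = (\<Sum>i\<in>UNIV. p c $ i * (\<Sum>j\<in>UNIV. q c $ j * b (axis i 1) (axis j 1)))"
    by (simp only: e1[of "p c" "q c"] e2[of _ "q c"])
  also have "\<dots> = (\<Sum>i\<in>UNIV. \<Sum>j\<in>UNIV. p c $ i * q c $ j * b (axis i 1) (axis j 1))"
    by (simp add: sum_distrib_left mult.assoc)
  also have "\<dots> = p c \<bullet> (mm c (snd c x) *v q c)"
    by (simp add: inner_matrix_vector_sum metric_matrix_def b_def charts_atD[OF assms(3)])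
  finally show ?thesis .
qed

lemma metric_tv:
  assumes "c \<in> A" "y \<in> chart_image c"
  shows "g (chart_inv c y) (tv c (chart_inv c y) u) (tv c (chart_inv c y) w) = u \<bullet> (mm c y *v w)"
  using metric_coords[OF tv_in tv_in, of c "chart_inv c y" c c u w] charts_atI[OF assms]
  by (simp add: tv_self chart_inv_right assms)

lemma mm_sym:
  assumes "c \<in> A" "y \<in> chart_image c"
  shows "mm c y $ i $ j = mm c y $ j $ i" "transpose (mm c y) = mm c y"
    "u \<bullet> (mm c y *v w) = w \<bullet> (mm c y *v u)"
proof -
  show *: "mm c y $ i $ j = mm c y $ j $ i" for i j
    by (simp add: metric_matrix_def metric_sym tv_in charts_atI assms)
  then show "transpose (mm c y) = mm c y"
    by (simp add: transpose_def vec_eq_iff)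
  then show "u \<bullet> (mm c y *v w) = w \<bullet> (mm c y *v u)"
    by (metis dot_lmul_matrix inner_commute vector_transpose_matrix)
qed

lemma mm_pos:
  assumes "c \<in> A" "y \<in> chart_image c" "w \<noteq> 0"
  shows "w \<bullet> (mm c y *v w) > 0"
proof -
  have "tv c (chart_inv c y) w \<noteq> (\<lambda>c. 0)"
    using tv_self[OF charts_atI[OF assms(1,2)], of w] assms(3) by auto
  from metric_pos[OF tv_in[OF charts_atI[OF assms(1,2)]] this] metric_tv[OF assms(1,2)]
  show ?thesis by simp
qed

lemma mm_invertible:
  assumes "c \<in> A" "y \<in> chart_image c"
  shows "invertible (mm c y)"
proof -
  have "x = 0" if "mm c y *v x = 0" for x
    using mm_pos[OF assms, of x] that by (cases "x = 0") auto
  then show ?thesis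
    by (metis invertible_left_inverse matrix_left_invertible_ker)
qed

lemma mm_inv:
  assumes "c \<in> A" "y \<in> chart_image c"
  shows "mm c y ** matrix_inv (mm c y) = mat 1" "matrix_inv (mm c y) ** mm c y = mat 1"
    "mm c y *v (matrix_inv (mm c y) *v w) = w" "matrix_inv (mm c y) *v (mm c y *v w) = w"
proof -
  show *: "mm c y ** matrix_inv (mm c y) = mat 1" "matrix_inv (mm c y) ** mm c y = mat 1"
    using someI_ex[OF mm_invertible[OF assms, unfolded invertible_def]]
    unfolding matrix_inv_def by auto
  show "mm c y *v (matrix_inv (mm c y) *v w) = w" "matrix_inv (mm c y) *v (mm c y *v w) = w"
    by (simp_all add: matrix_vector_mul_assoc *)
qed

text \<open>Substituting \<open>w = mm c y *v u\<close> reduces this to \<open>mm_pos\<close>. It is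
  the ellipticity of the Laplacian, whose second-order coefficients are the inverse metric.\<close>

lemma mm_inv_pos:
  assumes "c \<in> A" "y \<in> chart_image c" "w \<noteq> 0"
  shows "w \<bullet> (matrix_inv (mm c y) *v w) > 0"
proof -
  define u where "u = matrix_inv (mm c y) *v w"
  have "mm c y *v u = w" by (simp add: u_def mm_inv assms)
  moreover have "u \<noteq> 0" using calculation assms(3) by auto
  ultimately show ?thesis
    using mm_pos[OF assms(1,2), of u] by (simp add: inner_commute u_def)
qed

text \<open>Nondegeneracy, tested with \<open>u - v\<close>. Identities between coordinate vectors
  are obtained below by pairing both sides with arbitrary vectors.\<close>

lemma mm_cancel:
  assumes "c \<in> A" "y \<in> chart_image c" "\<And>w. u \<bullet> (mm c y *v w) = v \<bullet> (mm c y *v w)"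
  shows "u = v"
proof -
  have "(u - v) \<bullet> (mm c y *v (u - v)) = 0"
    using assms(3) by (simp add: inner_diff_left)
  then show ?thesis using mm_pos[OF assms(1,2), of "u - v"] by force
qed

lemma mm_Ctk:
  assumes "c \<in> A"
  shows "Ctk_on k I (chart_image c) (\<lambda>t y. mm c y $ i $ j)"
proof -
  have "Ck_on k (chart_image c) (\<lambda>y. g (chart_inv c y)
      (tv c (chart_inv c y) (axis i 1)) (tv c (chart_inv c y) (axis j 1)))"
    using manifold assms unfolding riemannian_manifold_def riemannian_metric_def smooth_on_def by blast
  then show ?thesis
    unfolding metric_matrix_def by (simp add: Ctk_on_of_Ck_on[OF open_chart_image[OF assms]])
qed

lemma Ctk_on_det:
  assumes "open S" "\<And>i j. Ctk_on k I S (\<lambda>t y. B y $ i $ j)"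
  shows "Ctk_on k I S (\<lambda>t y. det (B y :: real^'n^'n))"
  unfolding det_def
  by (intro Ctk_on_sum Ctk_on_mult Ctk_on_const Ctk_on_prod assms)

lemma mm_inv_Ctk:
  assumes "c \<in> A"
  shows "Ctk_on k I (chart_image c) (\<lambda>t y. matrix_inv (mm c y) $ i $ j)"
proof -
  let ?S = "chart_image c"
  note op = open_chart_image[OF assms]
  \<comment> \<open>Cramer's rule: column \<open>i\<close> of the inverse problem is replaced by the
    unit vector with index \<open>j\<close>. The entry of the inverse becomes a quotient of
    determinants, hence as regular as the metric.\<close>
  define N where "N = (\<lambda>y. (\<chi> a b. if b = i then axis j 1 $ a else mm c y $ a $ b) :: real^'n^'n)"
  have nz: "det (mm c y) \<noteq> 0" if "y \<in> ?S" for y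
    using mm_invertible[OF assms that] invertible_det_nz by blast
  have "matrix_inv (mm c y) $ i $ j = det (N y) * inverse (det (mm c y))" if "y \<in> ?S" for y
  proof -
    have "mm c y *v (matrix_inv (mm c y) *v axis j 1) = axis j 1"
      by (rule mm_inv(3)[OF assms that])
    then have "matrix_inv (mm c y) *v axis j 1 =
        (\<chi> k. det (\<chi> a b. if b = k then axis j 1 $ a else mm c y $ a $ b) / det (mm c y))"
      using cramer[OF nz[OF that]] by blast
    then have "(matrix_inv (mm c y) *v axis j 1) $ i = det (N y) / det (mm c y)"
      by (simp add: N_def)
    then show ?thesis
      by (simp add: matrix_vector_mul_component inner_axis divide_inverse)
  qed
  moreover have "Ctk_on k I ?S (\<lambda>t y. det (N y) * inverse (det (mm c y)))"
  proof (intro Ctk_on_mult Ctk_on_inverse Ctk_on_det op mm_Ctk[OF assms])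
    show "Ctk_on k I ?S (\<lambda>t y. N y $ a $ b)" for a b
      by (cases "b = i") (auto simp: N_def intro: Ctk_on_const op mm_Ctk[OF assms])
  qed (use nz in auto)
  ultimately show ?thesis
    using Ctk_on_cong[OF op, of I "\<lambda>t y. matrix_inv (mm c y) $ i $ j"
        "\<lambda>t y. det (N y) * inverse (det (mm c y))" k] by simp
qed

lemma christoffel_Ctk:
  assumes "c \<in> A"
  shows "Ctk_on 0 I (chart_image c) (\<lambda>t y. christoffel A g c y k i j)"
proof -
  have p: "Ctk_on 0 I (chart_image c) (\<lambda>t y. partial a (\<lambda>z. mm c z $ b $ d) y)" for a b d
    unfolding partial_def using Ctk_on_SucE(2)[OF mm_Ctk[OF assms, of "Suc 0"]] .
  show ?thesis
    unfolding christoffel_def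
    by (intro Ctk_on_sum Ctk_on_mult Ctk_on_const Ctk_on_diff Ctk_on_add open_chart_image[OF assms]
        mm_inv_Ctk[OF assms] p)
qed

end

lemma vec_eqI: "(\<And>i. x $ i = y $ i) \<Longrightarrow> x = y"
  by (simp add: vec_eq_iff)

context riemannian
begin

section \<open>Gradients and covariant derivatives\<close>

abbreviation "loc c f \<equiv> (\<lambda>y. f (chart_inv c y))"

definition mdiff :: "('m \<Rightarrow> real) \<Rightarrow> 'm \<Rightarrow> bool" where
  "mdiff f x \<longleftrightarrow> (\<forall>c\<in>charts_at A x. loc c f differentiable (at (snd c x)))"

text \<open>The components of the differential of \<open>f\<close> in the chart
  \<open>c\<close>.\<close>

definition pvec :: "('m, 'n) chart \<Rightarrow> ('m \<Rightarrow> real) \<Rightarrow> real^'n \<Rightarrow> real^'n" where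
  "pvec c f y = (\<chi> j. partial j (loc c f) y)"

text \<open>The gradient is the differential with its index raised. Formed in one chart, it meets
  the defining condition in every other chart by the chain rule, and nondegeneracy of the metric
  leaves no second candidate; so the \<open>THE\<close> is determined.\<close>

lemma grad_char:
  assumes "mdiff f x"
  shows grad_in: "grad A g f x \<in> TS x"
    and grad_has_derivative: "\<And>c. c \<in> charts_at A x \<Longrightarrow>
      (loc c f has_derivative (\<lambda>w. g x (grad A g f x) (tv c x w))) (at (snd c x))"
proof -
  define P where "P = (\<lambda>X. X \<in> TS x \<and>
     (\<forall>c\<in>charts_at A x. (loc c f has_derivative (\<lambda>w. g x X (tv c x w))) (at (snd c x))))"
  obtain c where c: "c \<in> charts_at A x" by (rule ex_chart)
  note cA = charts_atD[OF c]
  have Dc: "(loc c f has_derivative (\<lambda>w. w \<bullet> pvec c f (snd c x))) (at (snd c x))"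
  proof -
    have d: "loc c f differentiable (at (snd c x))" using assms c by (auto simp: mdiff_def)
    then have "frechet_derivative (loc c f) (at (snd c x)) = (\<lambda>w. w \<bullet> pvec c f (snd c x))"
      by (auto simp: fun_eq_iff frechet_derivative_eq_sum_partial inner_vec_def pvec_def)
    with d show ?thesis by (metis frechet_derivative_works)
  qed
  define X where "X = tv c x (matrix_inv (mm c (snd c x)) *v pvec c f (snd c x))"
  have X: "X \<in> TS x" by (simp add: X_def tv_in c)
  have gX: "g x X q = q c \<bullet> pvec c f (snd c x)" if "q \<in> TS x" for q
    using metric_coords[OF that X c] metric_sym[OF X that]
    by (simp add: X_def tv_self[OF c] mm_inv[OF cA(1,3)])
  have "P X"
    unfolding P_def
  proof (intro conjI X ballI)
    fix d assume d: "d \<in> charts_at A x"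
    note dA = charts_atD[OF d]
    have "tr d c (snd d x) = snd c x" using dA by simp
    then have "((\<lambda>y. loc c f (tr d c y)) has_derivative
        (\<lambda>w. transition_deriv d c x w \<bullet> pvec c f (snd c x))) (at (snd d x))"
      using has_derivative_compose[OF transition_deriv[OF d c], of "loc c f"] Dc by simp
    moreover have "(\<lambda>w. transition_deriv d c x w \<bullet> pvec c f (snd c x)) = (\<lambda>w. g x X (tv d x w))"
      using gX[OF tv_in[OF d]] tv_apply[OF c] by simp
    ultimately have "((\<lambda>y. loc c f (tr d c y)) has_derivative (\<lambda>w. g x X (tv d x w))) (at (snd d x))"
      by simp
    then show "(loc d f has_derivative (\<lambda>w. g x X (tv d x w))) (at (snd d x))"
      by (rule has_derivative_transform_within_open[OF _ open_overlap[OF dA(1) cA(1)] overlap_at[OF d c]])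
        (use overlap_trans[OF dA(1) cA(1)] in auto)
  qed
  moreover have "Y = X" if "P Y" for Y
  proof (rule TS_eqI[OF _ X c])
    show Y: "Y \<in> TS x" using that by (simp add: P_def)
    have "(\<lambda>w. g x Y (tv c x w)) = (\<lambda>w. g x X (tv c x w))"
      using that \<open>P X\<close> c has_derivative_unique unfolding P_def by blast
    then have "g x Y (tv c x w) = g x X (tv c x w)" for w by metis
    then have "Y c \<bullet> (mm c (snd c x) *v w) = X c \<bullet> (mm c (snd c x) *v w)" for w
      using metric_coords[OF Y tv_in[OF c] c] metric_coords[OF X tv_in[OF c] c] by (simp add: tv_self[OF c])
    then show "Y c = X c" by (rule mm_cancel[OF cA(1,3)])
  qed
  ultimately have "P (THE X. P X)" by (rule theI)
  then have "P (grad A g f x)" unfolding P_def grad_def .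
  then show "grad A g f x \<in> TS x" "\<And>c. c \<in> charts_at A x \<Longrightarrow>
      (loc c f has_derivative (\<lambda>w. g x (grad A g f x) (tv c x w))) (at (snd c x))"
    by (auto simp: P_def)
qed

lemma g_grad:
  assumes "mdiff f x" "c \<in> charts_at A x" "q \<in> TS x"
  shows "g x (grad A g f x) q = q c \<bullet> pvec c f (snd c x)"
proof -
  note D = grad_has_derivative[OF assms(1,2)]
  then have d: "loc c f differentiable (at (snd c x))" by (auto simp: differentiable_def)
  have "g x (grad A g f x) (tv c x (q c)) = frechet_derivative (loc c f) (at (snd c x)) (q c)"
    using frechet_derivative_at[OF D] by metis
  then show ?thesis
    by (simp add: tv_eq assms frechet_derivative_eq_sum_partial[OF d] inner_vec_def pvec_def)
qed

lemma grad_coords: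
  assumes "mdiff f x" "c \<in> charts_at A x"
  shows "grad A g f x c = matrix_inv (mm c (snd c x)) *v pvec c f (snd c x)"
proof (rule mm_cancel[OF charts_atD(1,3)[OF assms(2)]])
  note cA = charts_atD[OF assms(2)]
  fix w
  have "grad A g f x c \<bullet> (mm c (snd c x) *v w) = g x (grad A g f x) (tv c x w)"
    using metric_coords[OF grad_in[OF assms(1)] tv_in[OF assms(2)] assms(2)] tv_self[OF assms(2)] by simp
  also have "\<dots> = w \<bullet> pvec c f (snd c x)"
    using g_grad[OF assms tv_in[OF assms(2)]] tv_self[OF assms(2)] by simp
  also have "\<dots> = (matrix_inv (mm c (snd c x)) *v pvec c f (snd c x)) \<bullet> (mm c (snd c x) *v w)"
    using mm_sym(3)[OF cA(1,3)] mm_inv(3)[OF cA(1,3)] by simp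
  finally show "grad A g f x c \<bullet> (mm c (snd c x) *v w) =
    (matrix_inv (mm c (snd c x)) *v pvec c f (snd c x)) \<bullet> (mm c (snd c x) *v w)" .
qed

section \<open>Christoffel symbols under a change of chart\<close>

definition dmm :: "('m, 'n) chart \<Rightarrow> real^'n \<Rightarrow> real^'n \<Rightarrow> real^'n \<Rightarrow> real^'n \<Rightarrow> real" where
  "dmm c y u a b = (\<Sum>k\<in>UNIV. \<Sum>i\<in>UNIV. \<Sum>j\<in>UNIV. u $ k * a $ i * b $ j * partial k (\<lambda>z. mm c z $ i $ j) y)"

text \<open>The Christoffel symbols as a bilinear map: the correction term of the covariant
  derivative.\<close>

definition gam :: "('m, 'n) chart \<Rightarrow> real^'n \<Rightarrow> real^'n \<Rightarrow> real^'n \<Rightarrow> real^'n" where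
  "gam c y u w = (\<chi> k. \<Sum>i\<in>UNIV. \<Sum>j\<in>UNIV. christoffel A g c y k i j * u $ i * w $ j)"

lemma mm_differentiable:
  "c \<in> A \<Longrightarrow> y \<in> chart_image c \<Longrightarrow> (\<lambda>z. mm c z $ i $ j) differentiable (at y)"
  using mm_Ctk[of c "Suc 0" UNIV i j] by simp

lemma dmm_eq:
  assumes "c \<in> A" "y \<in> chart_image c"
  shows "dmm c y u a b =
    (\<Sum>i\<in>UNIV. \<Sum>j\<in>UNIV. a $ i * b $ j * frechet_derivative (\<lambda>z. mm c z $ i $ j) (at y) u)"
proof -
  have "dmm c y u a b = (\<Sum>i\<in>UNIV. \<Sum>k\<in>UNIV. \<Sum>j\<in>UNIV. u $ k * a $ i * b $ j * partial k (\<lambda>z. mm c z $ i $ j) y)"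
    unfolding dmm_def by (rule sum.swap)
  also have "\<dots> = (\<Sum>i\<in>UNIV. \<Sum>j\<in>UNIV. \<Sum>k\<in>UNIV. u $ k * a $ i * b $ j * partial k (\<lambda>z. mm c z $ i $ j) y)"
    by (rule sum.cong[OF refl], rule sum.swap)
  finally show ?thesis
    by (simp add: frechet_derivative_eq_sum_partial mm_differentiable assms sum_distrib_left mult_ac)
qed

text \<open>Koszul's formula for coordinate fields, whose brackets vanish;
  \<open>dmm c y u a b\<close> is the derivative of the metric along \<open>u\<close> with
  \<open>a\<close> and \<open>b\<close> held constant. Pairing with the metric cancels the inverse
  matrix in the Christoffel symbols and leaves terms whose transformation law follows by
  differentiation.\<close>

lemma koszul:
  assumes "c \<in> A" "y \<in> chart_image c"
  shows "gam c y u w \<bullet> (mm c y *v z) = (dmm c y u w z + dmm c y w u z - dmm c y z u w) / 2"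
proof -
  define p where "p = (\<lambda>k i j. partial k (\<lambda>z. mm c z $ i $ j) y)"
  have psym: "p k i j = p k j i" for k i j
    unfolding p_def partial_def
    using frechet_derivative_cong_open(1)[OF open_chart_image[OF assms(1)] assms(2),
        of "\<lambda>z. mm c z $ i $ j" "\<lambda>z. mm c z $ j $ i"] mm_sym(1)[OF assms(1)] by metis
  \<comment> \<open>The Christoffel symbols of the first kind, contracted with \<open>u\<close> and
    \<open>w\<close>; the inverse metric then raises the index.\<close>
  define s where "s = (\<chi> l. \<Sum>i\<in>UNIV. \<Sum>j\<in>UNIV. (1/2) * (p i j l + p j i l - p l i j) * u $ i * w $ j)"
  have "gam c y u w = matrix_inv (mm c y) *v s"
  proof (rule vec_eqI)
    fix k
    have "gam c y u w $ k = (\<Sum>i\<in>UNIV. \<Sum>j\<in>UNIV. \<Sum>l\<in>UNIV.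
        matrix_inv (mm c y) $ k $ l * ((1/2) * (p i j l + p j i l - p l i j) * u $ i * w $ j))"
      by (simp add: gam_def christoffel_def p_def sum_distrib_left sum_distrib_right mult_ac)
    also have "\<dots> = (\<Sum>i\<in>UNIV. \<Sum>l\<in>UNIV. \<Sum>j\<in>UNIV.
        matrix_inv (mm c y) $ k $ l * ((1/2) * (p i j l + p j i l - p l i j) * u $ i * w $ j))"
      by (rule sum.cong[OF refl], rule sum.swap)
    also have "\<dots> = (\<Sum>l\<in>UNIV. \<Sum>i\<in>UNIV. \<Sum>j\<in>UNIV.
        matrix_inv (mm c y) $ k $ l * ((1/2) * (p i j l + p j i l - p l i j) * u $ i * w $ j))"
      by (rule sum.swap)
    also have "\<dots> = (matrix_inv (mm c y) *v s) $ k"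
      by (simp add: matrix_vector_mult_def s_def sum_distrib_left)
    finally show "gam c y u w $ k = (matrix_inv (mm c y) *v s) $ k" .
  qed
  then have "gam c y u w \<bullet> (mm c y *v z) = z \<bullet> s"
    using mm_sym(3)[OF assms] mm_inv(3)[OF assms] by simp
  also have "\<dots> = (\<Sum>l\<in>UNIV. \<Sum>i\<in>UNIV. \<Sum>j\<in>UNIV. z $ l * ((1/2) * (p i j l + p j i l - p l i j) * u $ i * w $ j))"
    by (simp add: inner_vec_def s_def sum_distrib_left)
  also have "\<dots> = (1/2) * ((\<Sum>l\<in>UNIV. \<Sum>i\<in>UNIV. \<Sum>j\<in>UNIV. u $ i * w $ j * z $ l * p i j l)
      + (\<Sum>l\<in>UNIV. \<Sum>i\<in>UNIV. \<Sum>j\<in>UNIV. w $ j * u $ i * z $ l * p j i l)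
      - (\<Sum>l\<in>UNIV. \<Sum>i\<in>UNIV. \<Sum>j\<in>UNIV. z $ l * u $ i * w $ j * p l i j))"
    by (simp add: sum_distrib_left sum.distrib[symmetric] sum_subtractf[symmetric] algebra_simps)
  also have "(\<Sum>l\<in>UNIV. \<Sum>i\<in>UNIV. \<Sum>j\<in>UNIV. z $ l * u $ i * w $ j * p l i j) = dmm c y z u w"
    by (simp add: dmm_def p_def)
  also have "(\<Sum>l\<in>UNIV. \<Sum>i\<in>UNIV. \<Sum>j\<in>UNIV. u $ i * w $ j * z $ l * p i j l) = dmm c y u w z"
  proof -
    have "(\<Sum>l\<in>UNIV. \<Sum>i\<in>UNIV. \<Sum>j\<in>UNIV. u $ i * w $ j * z $ l * p i j l) =
        (\<Sum>i\<in>UNIV. \<Sum>l\<in>UNIV. \<Sum>j\<in>UNIV. u $ i * w $ j * z $ l * p i j l)"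
      by (rule sum.swap)
    also have "\<dots> = (\<Sum>i\<in>UNIV. \<Sum>j\<in>UNIV. \<Sum>l\<in>UNIV. u $ i * w $ j * z $ l * p i j l)"
      by (rule sum.cong[OF refl], rule sum.swap)
    finally show ?thesis by (simp add: dmm_def p_def)
  qed
  also have "(\<Sum>l\<in>UNIV. \<Sum>i\<in>UNIV. \<Sum>j\<in>UNIV. w $ j * u $ i * z $ l * p j i l) = dmm c y w u z"
  proof -
    have "(\<Sum>l\<in>UNIV. \<Sum>i\<in>UNIV. \<Sum>j\<in>UNIV. w $ j * u $ i * z $ l * p j i l) =
        (\<Sum>l\<in>UNIV. \<Sum>j\<in>UNIV. \<Sum>i\<in>UNIV. w $ j * u $ i * z $ l * p j i l)"
      by (rule sum.cong[OF refl], rule sum.swap)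
    also have "\<dots> = (\<Sum>j\<in>UNIV. \<Sum>l\<in>UNIV. \<Sum>i\<in>UNIV. w $ j * u $ i * z $ l * p j i l)"
      by (rule sum.swap)
    also have "\<dots> = (\<Sum>j\<in>UNIV. \<Sum>i\<in>UNIV. \<Sum>l\<in>UNIV. w $ j * u $ i * z $ l * p j i l)"
      by (rule sum.cong[OF refl], rule sum.swap)
    finally show ?thesis by (simp add: dmm_def p_def)
  qed
  finally show ?thesis by simp
qed

lemma linear_gam: "linear (\<lambda>u. gam c y u w)" "linear (gam c y u)"
  by (auto intro!: linearI simp: gam_def vec_eq_iff algebra_simps sum.distrib sum_distrib_left)

definition tr2 :: "('m, 'n) chart \<Rightarrow> ('m, 'n) chart \<Rightarrow> real^'n \<Rightarrow> real^'n \<Rightarrow> real^'n \<Rightarrow> real^'n" where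
  "tr2 c d y u a = frechet_derivative (\<lambda>z. frechet_derivative (tr c d) (at z) a) (at y) u"

lemma tr2_derivative:
  assumes "c \<in> A" "d \<in> A" "y \<in> overlap c d"
  shows "((\<lambda>z. frechet_derivative (tr c d) (at z) a) has_derivative (\<lambda>u. tr2 c d y u a)) (at y)"
proof -
  have "(\<lambda>z. frechet_derivative (tr c d) (at z) a) differentiable (at y)"
    using transition_Ck[OF assms(1,2), of 2] assms(3) by (simp add: numeral_2_eq_2)
  then show ?thesis unfolding tr2_def by (simp add: frechet_derivative_works eta_contract_eq)
qed

text \<open>Schwarz's theorem for each component of the change of coordinates. It lets
  second-derivative terms cancel in \<open>gam_transition\<close>.\<close>

lemma tr2_sym:
  assumes "c \<in> A" "d \<in> A" "y \<in> overlap c d"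
  shows "tr2 c d y u a = tr2 c d y a u"
proof (rule vec_eqI)
  fix i
  let ?S = "overlap c d"
  have comp: "tr2 c d y u a $ i =
      frechet_derivative (\<lambda>z. frechet_derivative (\<lambda>z. tr c d z $ i) (at z) a) (at y) u" for u a
  proof -
    have "tr2 c d y u a $ i = frechet_derivative (\<lambda>z. frechet_derivative (tr c d) (at z) a $ i) (at y) u"
      unfolding tr2_def using tr2_derivative[OF assms, of a]
      by (subst frechet_derivative_component) (auto simp: differentiable_def)
    also have "\<dots> = frechet_derivative (\<lambda>z. frechet_derivative (\<lambda>z. tr c d z $ i) (at z) a) (at y) u"
      by (subst frechet_derivative_cong_open(1)[OF open_overlap[OF assms(1,2)] assms(3)])
        (auto simp: frechet_derivative_component transition_differentiable assms)
    finally show ?thesis .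
  qed
  have "Ck_on 2 ?S (\<lambda>z. tr c d z $ i)"
    using Ck_on_of_Ctk_on[OF transition_Ctk[OF assms(1,2), of 2 UNIV]] by simp
  from frechet_derivative_symmetric[OF open_overlap[OF assms(1,2)] assms(3) this]
  show "tr2 c d y u a $ i = tr2 c d y a u $ i"
    unfolding comp by metis
qed

lemma mm_transition:
  assumes "c \<in> A" "d \<in> A" "y \<in> overlap c d"
  shows "a \<bullet> (mm c y *v b) =
    frechet_derivative (tr c d) (at y) a \<bullet> (mm d (tr c d y) *v frechet_derivative (tr c d) (at y) b)"
proof -
  let ?x = "chart_inv c y"
  note o = overlap_trans[OF assms]
  have c: "c \<in> charts_at A ?x" and d: "d \<in> charts_at A ?x"
    using assms o by (auto simp: charts_at_def)
  have "tv c ?x a d = frechet_derivative (tr c d) (at y) a" for a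
    using tv_apply[OF d] chart_inv_right[OF assms(1) o(6)] by (simp add: transition_deriv_def)
  then show ?thesis
    using metric_tv[OF assms(1) o(6), of a b] metric_coords[OF tv_in tv_in d, OF c c, of a b] by simp
qed

text \<open>The identity \<open>mm_transition\<close> differentiated along \<open>u\<close>: each of
  the two transition derivatives contributes a second derivative, and the metric in the chart
  \<open>d\<close> contributes through the chain rule.\<close>

lemma dmm_transition:
  assumes "c \<in> A" "d \<in> A" "y \<in> overlap c d"
  defines "J \<equiv> frechet_derivative (tr c d) (at y)"
  shows "dmm c y u a b = tr2 c d y u a \<bullet> (mm d (tr c d y) *v J b)
    + J a \<bullet> (mm d (tr c d y) *v tr2 c d y u b) + dmm d (tr c d y) (J u) (J a) (J b)"
proof -
  note o = overlap_trans[OF assms(1-3)]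
  let ?D = "\<lambda>z. frechet_derivative (tr c d) (at z)"
  have Dc: "((\<lambda>z. a \<bullet> (mm c z *v b)) has_derivative (\<lambda>u. dmm c y u a b)) (at y)"
  proof -
    have "((\<lambda>z. \<Sum>i\<in>UNIV. \<Sum>j\<in>UNIV. a $ i * b $ j * mm c z $ i $ j) has_derivative
        (\<lambda>u. \<Sum>i\<in>UNIV. \<Sum>j\<in>UNIV. a $ i * b $ j * frechet_derivative (\<lambda>z. mm c z $ i $ j) (at y) u)) (at y)"
      by (intro has_derivative_sum has_derivative_mult_right)
        (use mm_differentiable[OF assms(1) o(6)] frechet_derivative_works in blast)
    then show ?thesis unfolding inner_matrix_vector_sum dmm_eq[OF assms(1) o(6)] .
  qed
  have K: "((\<lambda>z. mm d (tr c d z) $ i $ j) has_derivative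
      (\<lambda>u. frechet_derivative (\<lambda>z. mm d z $ i $ j) (at (tr c d y)) (J u))) (at y)" for i j
    using has_derivative_compose[of "tr c d" J y UNIV "\<lambda>z. mm d z $ i $ j"]
      transition_differentiable[OF assms(1-3)] mm_differentiable[OF assms(2) o(3), of i j]
    unfolding J_def frechet_derivative_works by blast
  have C: "((\<lambda>z. ?D z a $ i) has_derivative (\<lambda>u. tr2 c d y u a $ i)) (at y)" for a i
    using bounded_linear.has_derivative[OF bounded_linear_vec_nth tr2_derivative[OF assms(1-3)]] .
  have Dd: "((\<lambda>z. ?D z a \<bullet> (mm d (tr c d z) *v ?D z b)) has_derivative
      (\<lambda>u. \<Sum>i\<in>UNIV. \<Sum>j\<in>UNIV. (J a $ i * J b $ j) * frechet_derivative (\<lambda>z. mm d z $ i $ j) (at (tr c d y)) (J u)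
        + (J a $ i * tr2 c d y u b $ j + tr2 c d y u a $ i * J b $ j) * mm d (tr c d y) $ i $ j)) (at y)"
    unfolding inner_matrix_vector_sum J_def
    by (intro has_derivative_sum) (rule has_derivative_mult[OF has_derivative_mult[OF C C] K[unfolded J_def]])
  have "((\<lambda>z. a \<bullet> (mm c z *v b)) has_derivative
      (\<lambda>u. \<Sum>i\<in>UNIV. \<Sum>j\<in>UNIV. (J a $ i * J b $ j) * frechet_derivative (\<lambda>z. mm d z $ i $ j) (at (tr c d y)) (J u)
        + (J a $ i * tr2 c d y u b $ j + tr2 c d y u a $ i * J b $ j) * mm d (tr c d y) $ i $ j)) (at y)"
    by (rule has_derivative_transform_within_open[OF Dd open_overlap[OF assms(1,2)] assms(3)])
      (use mm_transition[OF assms(1,2)] in simp)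
  from fun_cong[OF has_derivative_unique[OF Dc this], of u]
  show ?thesis
    unfolding dmm_eq[OF assms(2) o(3)] inner_matrix_vector_sum
    by (simp add: sum.distrib algebra_simps)
qed

text \<open>The Christoffel symbols are not a tensor: the second derivative of the change of
  coordinates appears. The Koszul combination contains six such terms; by symmetry four cancel and
  the other two are equal, which absorbs the factor 1/2.\<close>

lemma gam_transition:
  assumes "c \<in> A" "d \<in> A" "y \<in> overlap c d"
  defines "J \<equiv> frechet_derivative (tr c d) (at y)"
  shows "J (gam c y u w) = tr2 c d y u w + gam d (tr c d y) (J u) (J w)"
proof (rule mm_cancel[OF assms(2)])
  note o = overlap_trans[OF assms(1-3)]
  show "tr c d y \<in> chart_image d" by (rule o)
  let ?x = "chart_inv c y"
  have c: "c \<in> charts_at A ?x" and d: "d \<in> charts_at A ?x"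
    using assms o by (auto simp: charts_at_def)
  have J: "J = transition_deriv c d ?x"
    using chart_inv_right[OF assms(1) o(6)] by (simp add: J_def transition_deriv_def)
  define B where "B = (\<lambda>a b. a \<bullet> (mm d (tr c d y) *v b))"
  have Bs: "B a b = B b a" for a b
    unfolding B_def by (rule mm_sym(3)[OF assms(2) o(3)])
  note q = tr2_sym[OF assms(1-3)]
  fix z'
  \<comment> \<open>\<open>J\<close> is onto, so it is enough to pair with vectors of the form
    \<open>J z\<close>.\<close>
  obtain z where z: "z' = J z"
    using transition_deriv_compose[OF d c d] transition_deriv_self[OF d] J by metis
  have "B (J (gam c y u w)) (J z) = gam c y u w \<bullet> (mm c y *v z)"
    unfolding B_def J_def by (rule mm_transition[OF assms(1-3), symmetric])
  also have "\<dots> = (dmm c y u w z + dmm c y w u z - dmm c y z u w) / 2"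
    by (rule koszul[OF assms(1) o(6)])
  also have "\<dots> = B (tr2 c d y u w) (J z) + B (gam d (tr c d y) (J u) (J w)) (J z)"
    using dmm_transition[OF assms(1-3), folded J_def, of u w z]
      dmm_transition[OF assms(1-3), folded J_def, of w u z]
      dmm_transition[OF assms(1-3), folded J_def, of z u w]
      koszul[OF assms(2) o(3), of "J u" "J w" "J z"]
      q[of w u] q[of z u] q[of z w] Bs[of "J w" "tr2 c d y u z"] Bs[of "J u" "tr2 c d y w z"]
    unfolding B_def by (simp add: field_simps)
  finally show "J (gam c y u w) \<bullet> (mm d (tr c d y) *v z') =
      (tr2 c d y u w + gam d (tr c d y) (J u) (J w)) \<bullet> (mm d (tr c d y) *v z')"
    unfolding B_def z by (simp add: inner_add_left)
qed

section \<open>Covariant derivatives as tangent vectors\<close>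

definition diff_field :: "('m \<Rightarrow> ('m, 'n) tvec) \<Rightarrow> bool" where
  "diff_field X \<longleftrightarrow> (\<forall>x. X x \<in> TS x) \<and>
     (\<forall>c\<in>A. \<forall>y\<in>chart_image c. \<forall>k. (\<lambda>y. X (chart_inv c y) c $ k) differentiable (at y))"

lemma diff_field_derivative:
  assumes "diff_field X" "c \<in> charts_at A x"
  shows "((\<lambda>y. X (chart_inv c y) c) has_derivative
    frechet_derivative (\<lambda>y. X (chart_inv c y) c) (at (snd c x))) (at (snd c x))"
  unfolding frechet_derivative_works[symmetric]
  by (rule differentiable_vec) (use assms charts_atD[OF assms(2)] in \<open>auto simp: diff_field_def\<close>)

lemma cov_deriv_coords:
  assumes "diff_field X" "c \<in> charts_at A x"
  shows "cov_deriv A g X x p c =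
    frechet_derivative (\<lambda>y. X (chart_inv c y) c) (at (snd c x)) (p c) + gam c (snd c x) (p c) (X x c)"
proof (rule vec_eqI)
  fix k
  have d: "(\<lambda>y. X (chart_inv c y) c) differentiable (at (snd c x))"
    using diff_field_derivative[OF assms] by (auto simp: differentiable_def)
  show "cov_deriv A g X x p c $ k =
    (frechet_derivative (\<lambda>y. X (chart_inv c y) c) (at (snd c x)) (p c) + gam c (snd c x) (p c) (X x c)) $ k"
    using assms(2) frechet_derivative_eq_sum_partial[OF frechet_derivative_component(2)[OF d, of k], of "p c"]
      frechet_derivative_component(1)[OF d, of k "p c"]
    by (simp add: cov_deriv_def gam_def)
qed

lemma TS_transition:
  assumes "p \<in> TS x" "c \<in> charts_at A x" "d \<in> charts_at A x"
  shows "p d = transition_deriv c d x (p c)"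
  using tv_apply[OF assms(3), of c "p c"] tv_eq[OF assms(1,2)] by simp

text \<open>Differentiating the transformation law of the components of \<open>X\<close> produces a
  second derivative of the change of coordinates. Together with the Christoffel term of the chart
  \<open>d\<close> it is, by \<open>gam_transition\<close>, the image of the Christoffel term of the
  chart \<open>c\<close>.\<close>

lemma cov_deriv_in:
  assumes X: "diff_field X" and p: "p \<in> TS x"
  shows "cov_deriv A g X x p \<in> TS x"
proof -
  have T: "cov_deriv A g X x p d = transition_deriv c d x (cov_deriv A g X x p c)"
    if c: "c \<in> charts_at A x" and d: "d \<in> charts_at A x" for c d
  proof -
    note cA = charts_atD[OF c] and dA = charts_atD[OF d]
    define y where "y = snd c x"
    have y: "y \<in> overlap c d" and x: "chart_inv c y = x" and ty: "tr c d y = snd d x"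
      using overlap_at[OF c d] cA by (auto simp: y_def)
    define J where "J = frechet_derivative (tr c d) (at y)"
    have J: "J = transition_deriv c d x" by (simp add: J_def transition_deriv_def y_def)
    have linJ: "linear J" unfolding J by (rule linear_transition[OF c d])
    have pd: "p d = J (p c)" and Xd: "X x d = J (X x c)"
      unfolding J by (rule TS_transition[OF _ c d], use p X in \<open>simp add: diff_field_def\<close>)+
    let ?Dc = "frechet_derivative (\<lambda>y. X (chart_inv c y) c) (at y)"
    let ?Dd = "frechet_derivative (\<lambda>y. X (chart_inv d y) d) (at (snd d x))"
    have Dc: "((\<lambda>y. X (chart_inv c y) c) has_derivative ?Dc) (at y)"
      using diff_field_derivative[OF X c] by (simp add: y_def)
    have D1: "((\<lambda>z. X (chart_inv d (tr c d z)) d) has_derivative (\<lambda>u. ?Dd (J u))) (at y)"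
      using has_derivative_compose[OF transition_deriv[OF c d], of "\<lambda>y. X (chart_inv d y) d"]
        diff_field_derivative[OF X d] ty by (simp add: y_def J)
    \<comment> \<open>The transition derivative varies with the base point. Its action on
      \<open>X\<close> is expanded over the unit vectors, so that the product rule for a scalar
      times a moving vector applies.\<close>
    have D2: "((\<lambda>z. \<Sum>i\<in>UNIV. X (chart_inv c z) c $ i *\<^sub>R frechet_derivative (tr c d) (at z) (axis i 1))
        has_derivative (\<lambda>u. \<Sum>i\<in>UNIV. X (chart_inv c y) c $ i *\<^sub>R tr2 c d y u (axis i 1)
          + ?Dc u $ i *\<^sub>R J (axis i 1))) (at y)"
      unfolding J_def
      by (intro has_derivative_sum has_derivative_scaleR tr2_derivative cA(1) dA(1) y
          bounded_linear.has_derivative[OF bounded_linear_vec_nth Dc])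
    have eq: "X (chart_inv d (tr c d z)) d =
        (\<Sum>i\<in>UNIV. X (chart_inv c z) c $ i *\<^sub>R frechet_derivative (tr c d) (at z) (axis i 1))"
      if z: "z \<in> overlap c d" for z
    proof -
      note o = overlap_trans[OF cA(1) dA(1) z]
      let ?x = "chart_inv c z"
      have cz: "c \<in> charts_at A ?x" and dz: "d \<in> charts_at A ?x"
        using o cA dA by (auto simp: charts_at_def)
      have "X ?x d = transition_deriv c d ?x (X ?x c)"
        by (rule TS_transition[OF _ cz dz]) (use X in \<open>simp add: diff_field_def\<close>)
      then show ?thesis
        using linear_vec_expand[OF linear_transition[OF cz dz], of "X ?x c"] o
        by (simp add: transition_deriv_def chart_inv_right cA)
    qed
    have "((\<lambda>z. X (chart_inv d (tr c d z)) d) has_derivative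
        (\<lambda>u. \<Sum>i\<in>UNIV. X (chart_inv c y) c $ i *\<^sub>R tr2 c d y u (axis i 1) + ?Dc u $ i *\<^sub>R J (axis i 1))) (at y)"
      by (rule has_derivative_transform_within_open[OF D2 open_overlap[OF cA(1) dA(1)] y]) (simp add: eq)
    from fun_cong[OF has_derivative_unique[OF D1 this], of "p c"]
    have "?Dd (J (p c)) = (\<Sum>i\<in>UNIV. X x c $ i *\<^sub>R tr2 c d y (p c) (axis i 1)) + (\<Sum>i\<in>UNIV. ?Dc (p c) $ i *\<^sub>R J (axis i 1))"
      by (simp add: sum.distrib x)
    also have "(\<Sum>i\<in>UNIV. ?Dc (p c) $ i *\<^sub>R J (axis i 1)) = J (?Dc (p c))"
      by (rule linear_vec_expand[OF linJ, symmetric])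
    also have "(\<Sum>i\<in>UNIV. X x c $ i *\<^sub>R tr2 c d y (p c) (axis i 1)) = tr2 c d y (p c) (X x c)"
    proof -
      have "tr2 c d y (p c) = (\<lambda>u. tr2 c d y u (p c))"
        by (rule ext) (rule tr2_sym[OF cA(1) dA(1) y])
      then have "linear (tr2 c d y (p c))"
        using has_derivative_linear[OF tr2_derivative[OF cA(1) dA(1) y, of "p c"]] by simp
      from linear_vec_expand[OF this, symmetric] show ?thesis .
    qed
    finally have "?Dd (J (p c)) = tr2 c d y (p c) (X x c) + J (?Dc (p c))" .
    then have "cov_deriv A g X x p d = tr2 c d y (p c) (X x c) + J (?Dc (p c)) + gam d (tr c d y) (J (p c)) (J (X x c))"
      using cov_deriv_coords[OF X d, of p] by (simp only: pd Xd ty)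
    also have "\<dots> = J (?Dc (p c)) + J (gam c y (p c) (X x c))"
      using gam_transition[OF cA(1) dA(1) y, of "p c" "X x c"] by (simp add: J_def)
    also have "\<dots> = J (cov_deriv A g X x p c)"
      using cov_deriv_coords[OF X c, of p] by (simp add: linear_add[OF linJ] y_def)
    finally show ?thesis by (simp add: J)
  qed
  show ?thesis
    unfolding tangent_space_def mem_Collect_eq
    by (intro conjI ballI allI impI T) (simp_all add: cov_deriv_def)
qed

end

section \<open>Divergence and Laplacian in coordinates\<close>

text \<open>The traces of \<open>K L' J\<close> and \<open>L' J K\<close> agree, so a one-sided
  inverse is enough. For transition derivatives this makes the trace of a covariant derivative
  independent of the chart.\<close>

lemma trace_conjugate:
  fixes L L' J K :: "real^'n::finite \<Rightarrow> real^'n"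
  assumes "linear L'" "linear J" "linear K" "\<And>w. J (K w) = w" "\<And>w. L w = K (L' (J w))"
  shows "(\<Sum>k\<in>UNIV. L (axis k 1) $ k) = (\<Sum>k\<in>UNIV. L' (axis k 1) $ k)"
proof -
  have tr: "(\<Sum>k\<in>UNIV. F (axis k 1) $ k) = trace (matrix F)" for F :: "real^'n \<Rightarrow> real^'n"
    by (simp add: trace_def matrix_def)
  have "L = K \<circ> (L' \<circ> J)" using assms(5) by auto
  then have "matrix L = matrix K ** (matrix L' ** matrix J)"
    using assms(1-3) by (simp add: matrix_compose linear_compose)
  then have "trace (matrix L) = trace (matrix L' ** (matrix J ** matrix K))"
    by (simp add: trace_mul_sym[of "matrix K" "matrix L' ** matrix J"] flip: matrix_mul_assoc)
  also have "matrix J ** matrix K = matrix (J \<circ> K)"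
    using assms(2,3) by (simp add: matrix_compose)
  also have "J \<circ> K = (\<lambda>w. w)" using assms(4) by auto
  also have "matrix (\<lambda>w::real^'n. w) = mat 1" by (simp add: matrix_def mat_def axis_def)
  finally show ?thesis by (simp add: tr)
qed

text \<open>Reconciles the conditions in \<open>C12b\<close>, which are listed by partial
  derivatives, with the recursion of \<open>Ctk_on\<close> over all directions.\<close>

lemma Ctk_on_Suc_partialI:
  fixes f :: "real \<Rightarrow> real^'n::finite \<Rightarrow> real"
  assumes "open S" "continuous_on (I \<times> S) (\<lambda>(t, y). f t y)"
    and "\<And>t y. t \<in> I \<Longrightarrow> y \<in> S \<Longrightarrow> f t differentiable (at y)"
    and "\<And>i. Ctk_on k I S (\<lambda>t. partial i (f t))"
  shows "Ctk_on (Suc k) I S f"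
proof (rule Ctk_on_SucI[OF assms(1,2)])
  show "(f t has_derivative (\<lambda>w. \<Sum>i\<in>UNIV. w $ i * partial i (f t) y)) (at y)" if "t \<in> I" "y \<in> S" for t y
    using assms(3)[OF that] frechet_derivative_eq_sum_partial[OF assms(3)[OF that]]
    by (simp add: frechet_derivative_works[of "f t"] has_derivative_eq_rhs fun_eq_iff)
  show "Ctk_on k I S (\<lambda>t y. \<Sum>i\<in>UNIV. w $ i * partial i (f t) y)" for w
    by (intro Ctk_on_sum Ctk_on_mult Ctk_on_const assms)
qed

lemma Ctk_on_partial: "Ctk_on (Suc k) I S f \<Longrightarrow> Ctk_on k I S (\<lambda>t. partial i (f t))"
  unfolding partial_def by (rule Ctk_on_SucE(2))

lemma partial_mult:
  assumes "f differentiable (at y)" "h differentiable (at y)"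
  shows "partial i (\<lambda>y. f y * h y) y = f y * partial i h y + partial i f y * h y"
proof -
  have "((\<lambda>y. f y * h y) has_derivative
      (\<lambda>w. f y * frechet_derivative h (at y) w + frechet_derivative f (at y) w * h y)) (at y)"
    using assms by (intro has_derivative_mult) (simp_all add: frechet_derivative_works)
  from frechet_derivative_at[OF this] show ?thesis
    unfolding partial_def by metis
qed

lemma partial_diff:
  assumes "f differentiable (at y)" "h differentiable (at y)"
  shows "partial i (\<lambda>y. f y - h y) y = partial i f y - partial i h y"
proof -
  have "((\<lambda>y. f y - h y) has_derivative
      (\<lambda>w. frechet_derivative f (at y) w - frechet_derivative h (at y) w)) (at y)"
    using assms by (intro has_derivative_diff) (simp_all add: frechet_derivative_works)
  from frechet_derivative_at[OF this] show ?thesis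
    unfolding partial_def by metis
qed

lemma partial_sum:
  assumes "\<And>j. j \<in> J \<Longrightarrow> f j differentiable (at y)"
  shows "partial i (\<lambda>y. \<Sum>j\<in>J. f j y) y = (\<Sum>j\<in>J. partial i (f j) y)"
proof -
  have "((\<lambda>y. \<Sum>j\<in>J. f j y) has_derivative
      (\<lambda>w. \<Sum>j\<in>J. frechet_derivative (f j) (at y) w)) (at y)"
    using assms by (intro has_derivative_sum) (simp_all add: frechet_derivative_works)
  from frechet_derivative_at[OF this] show ?thesis
    unfolding partial_def by metis
qed

lemma partial_cong_open:
  assumes "open S" "y \<in> S" "\<And>z. z \<in> S \<Longrightarrow> f z = h z"
  shows "partial i f y = partial i h y"
  unfolding partial_def using frechet_derivative_cong_open(1)[OF assms] by simp

context riemannian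
begin

lemma cov_deriv_linear:
  assumes "diff_field X" "c \<in> charts_at A x"
  shows "linear (\<lambda>w. cov_deriv A g X x (tv c x w) c)"
proof -
  have "linear (\<lambda>w. frechet_derivative (\<lambda>y. X (chart_inv c y) c) (at (snd c x)) w + gam c (snd c x) w (X x c))"
    using has_derivative_linear[OF diff_field_derivative[OF assms]] linear_gam(1)
    by (rule linear_compose_add)
  then show ?thesis by (simp add: cov_deriv_coords[OF assms] tv_self[OF assms(2)])
qed

text \<open>In two charts the covariant derivative is given by endomorphisms conjugate under the
  transition derivative, so their traces agree. This settles the \<open>THE\<close> and allows
  computing in any one chart.\<close>

lemma divergence_eq:
  assumes X: "diff_field X" and c: "c \<in> charts_at A x"
  shows "divergence A g X x = (\<Sum>k\<in>UNIV. cov_deriv A g X x (tv c x (axis k 1)) c $ k)"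
proof -
  define S where "S = (\<lambda>c. \<Sum>k\<in>UNIV. cov_deriv A g X x (tv c x (axis k 1)) c $ k)"
  have T: "S c = S d" if d: "d \<in> charts_at A x" for d
    unfolding S_def
  proof (rule trace_conjugate[OF cov_deriv_linear[OF X d] linear_transition[OF c d] linear_transition[OF d c]])
    show "transition_deriv c d x (transition_deriv d c x w) = w" for w
      using transition_deriv_compose[OF d c d] transition_deriv_self[OF d] by simp
    show "cov_deriv A g X x (tv c x w) c =
        transition_deriv d c x (cov_deriv A g X x (tv d x (transition_deriv c d x w)) d)" for w
    proof -
      have "tv d x (transition_deriv c d x w) = tv c x w"
        using tv_eq[OF tv_in[OF c] d] tv_apply[OF d] by simp
      then show ?thesis
        using TS_transition[OF cov_deriv_in[OF X tv_in[OF c]] d c] by simp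
    qed
  qed
  have "(\<forall>d\<in>charts_at A x. r = S d) \<longleftrightarrow> r = S c" for r
    using T c by blast
  then have "divergence A g X x = (THE r. r = S c)"
    unfolding divergence_def S_def by simp
  then show ?thesis by (simp add: S_def)
qed

text \<open>The class \<open>Ctk_on\<close> carried over to the manifold: space derivatives up to
  order \<open>k\<close>, jointly continuous in time and space, and no derivative in time.\<close>

definition Ctm :: "nat \<Rightarrow> real set \<Rightarrow> (real \<Rightarrow> 'm \<Rightarrow> real) \<Rightarrow> bool" where
  "Ctm k I f \<longleftrightarrow> (\<forall>c\<in>A. Ctk_on k I (chart_image c) (\<lambda>t. loc c (f t)))"

lemma Ctm_loc_differentiable:
  assumes "Ctm (Suc k) I f" "t \<in> I" "c \<in> A" "y \<in> chart_image c"
  shows "loc c (f t) differentiable (at y)"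
  using assms by (auto simp: Ctm_def)

lemma Ctm_mdiff: "Ctm (Suc k) I f \<Longrightarrow> t \<in> I \<Longrightarrow> mdiff (f t) x"
  using Ctm_loc_differentiable charts_atD by (auto simp: mdiff_def)

lemma Ctm_Suc_SucD: "Ctm 2 I f \<Longrightarrow> Ctm (Suc 0) I f"
  unfolding Ctm_def numeral_2_eq_2 using Ctk_on_SucD by blast

lemma Ctm2_mdiff: "Ctm 2 I f \<Longrightarrow> t \<in> I \<Longrightarrow> mdiff (f t) x"
  using Ctm_mdiff Ctm_Suc_SucD by blast

lemma Ctm2_partial:
  assumes "Ctm 2 I f" "c \<in> A"
  shows "Ctk_on (Suc 0) I (chart_image c) (\<lambda>t. partial i (loc c (f t)))"
  using assms Ctk_on_partial[of "Suc 0" I "chart_image c" "\<lambda>t. loc c (f t)" i]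
  unfolding Ctm_def numeral_2_eq_2 by blast

lemma grad_loc:
  assumes "Ctm 2 I f" "t \<in> I" "c \<in> A" "y \<in> chart_image c"
  shows "grad A g (f t) (chart_inv c y) c $ k =
    (\<Sum>j\<in>UNIV. matrix_inv (mm c y) $ k $ j * partial j (loc c (f t)) y)"
  using grad_coords[OF Ctm2_mdiff[OF assms(1,2)] charts_atI[OF assms(3,4)]]
  by (simp add: chart_inv_right assms matrix_vector_mult_def pvec_def)

lemma grad_Ctk:
  assumes "Ctm 2 I f" "c \<in> A"
  shows "Ctk_on (Suc 0) I (chart_image c) (\<lambda>t y. grad A g (f t) (chart_inv c y) c $ k)"
proof -
  have "Ctk_on (Suc 0) I (chart_image c)
      (\<lambda>t y. \<Sum>j\<in>UNIV. matrix_inv (mm c y) $ k $ j * partial j (loc c (f t)) y)"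
    by (intro Ctk_on_sum Ctk_on_mult open_chart_image mm_inv_Ctk Ctm2_partial assms)
  then show ?thesis
    using Ctk_on_cong[OF open_chart_image[OF assms(2)], of I
        "\<lambda>t y. grad A g (f t) (chart_inv c y) c $ k"
        "\<lambda>t y. \<Sum>j\<in>UNIV. matrix_inv (mm c y) $ k $ j * partial j (loc c (f t)) y" "Suc 0"]
      grad_loc[OF assms(1) _ assms(2)] by simp
qed

lemma grad_diff_field:
  assumes "Ctm 2 I f" "t \<in> I"
  shows "diff_field (grad A g (f t))"
  using grad_in[OF Ctm2_mdiff[OF assms]] grad_Ctk[OF assms(1)] assms(2) by (auto simp: diff_field_def)

lemma cov_deriv_loc:
  assumes "diff_field X" "c \<in> A" "y \<in> chart_image c"
  shows "cov_deriv A g X (chart_inv c y) (tv c (chart_inv c y) w) c $ k =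
    (\<Sum>i\<in>UNIV. w $ i * partial i (\<lambda>z. X (chart_inv c z) c $ k) y) +
    (\<Sum>i\<in>UNIV. \<Sum>j\<in>UNIV. christoffel A g c y k i j * w $ i * X (chart_inv c y) c $ j)"
  using charts_atI[OF assms(2,3)]
  by (simp add: cov_deriv_def tv_self chart_inv_right assms)

text \<open>The coefficients of the first derivatives when the Laplacian is written as a
  second-order operator in the chart.\<close>

definition lapb :: "('m, 'n) chart \<Rightarrow> real^'n \<Rightarrow> 'n \<Rightarrow> real" where
  "lapb c y j = (\<Sum>k\<in>UNIV. partial k (\<lambda>z. matrix_inv (mm c z) $ k $ j) y)
     + (\<Sum>k\<in>UNIV. \<Sum>i\<in>UNIV. christoffel A g c y k k i * matrix_inv (mm c y) $ i $ j)"

text \<open>Leibniz's rule for the inverse metric times the differential separates the principal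
  part from the first-order part. The barrier is estimated through these coefficients.\<close>

lemma laplace_loc:
  assumes f: "Ctm 2 I f" and t: "t \<in> I" and c: "c \<in> A" and y: "y \<in> chart_image c"
  shows "laplace_beltrami A g (f t) (chart_inv c y) =
    (\<Sum>k\<in>UNIV. \<Sum>j\<in>UNIV. matrix_inv (mm c y) $ k $ j * partial k (partial j (loc c (f t))) y)
    + (\<Sum>j\<in>UNIV. lapb c y j * partial j (loc c (f t)) y)"
proof -
  let ?G = "\<lambda>y. matrix_inv (mm c y)" and ?p = "\<lambda>j. partial j (loc c (f t))"
  let ?X = "grad A g (f t)"
  note op = open_chart_image[OF c]
  have d1: "(\<lambda>z. ?G z $ k $ j) differentiable (at y)" for k j
    using mm_inv_Ctk[OF c, of "Suc 0" UNIV k j] y by auto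
  have d2: "?p j differentiable (at y)" for j
    using Ctm2_partial[OF f c, of j] t y by auto
  have pX: "partial k (\<lambda>z. ?X (chart_inv c z) c $ k) y =
      (\<Sum>j\<in>UNIV. ?G y $ k $ j * partial k (?p j) y + partial k (\<lambda>z. ?G z $ k $ j) y * ?p j y)" for k
  proof -
    have "partial k (\<lambda>z. ?X (chart_inv c z) c $ k) y = partial k (\<lambda>z. \<Sum>j\<in>UNIV. ?G z $ k $ j * ?p j z) y"
      by (rule partial_cong_open[OF op y]) (rule grad_loc[OF f t c])
    also have "\<dots> = (\<Sum>j\<in>UNIV. ?G y $ k $ j * partial k (?p j) y + partial k (\<lambda>z. ?G z $ k $ j) y * ?p j y)"
      using d1 d2 by (subst partial_sum) (auto intro!: differentiable_mult simp: partial_mult)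
    finally show ?thesis .
  qed
  have ax: "(\<Sum>i\<in>UNIV. axis k 1 $ i * a i) = a k" for a :: "'n \<Rightarrow> real" and k
    by (simp add: axis_def if_distrib[of "\<lambda>b. b * _"] cong: if_cong)
  have ax2: "(\<Sum>i\<in>UNIV. \<Sum>j\<in>UNIV. a i j * axis k 1 $ i * b j) = (\<Sum>j\<in>UNIV. a k j * b j)"
    for a :: "'n \<Rightarrow> 'n \<Rightarrow> real" and b k
    using ax[of k "\<lambda>i. \<Sum>j\<in>UNIV. a i j * b j"] by (simp add: sum_distrib_left mult_ac)
  have "laplace_beltrami A g (f t) (chart_inv c y) =
      (\<Sum>k\<in>UNIV. partial k (\<lambda>z. ?X (chart_inv c z) c $ k) y +
        (\<Sum>i\<in>UNIV. christoffel A g c y k k i * ?X (chart_inv c y) c $ i))"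
    unfolding laplace_beltrami_def divergence_eq[OF grad_diff_field[OF f t] charts_atI[OF c y]]
      cov_deriv_loc[OF grad_diff_field[OF f t] c y] ax ax2 ..
  also have "\<dots> = (\<Sum>k\<in>UNIV. \<Sum>j\<in>UNIV. ?G y $ k $ j * partial k (?p j) y)
      + ((\<Sum>k\<in>UNIV. \<Sum>j\<in>UNIV. partial k (\<lambda>z. ?G z $ k $ j) y * ?p j y)
      + (\<Sum>k\<in>UNIV. \<Sum>i\<in>UNIV. \<Sum>j\<in>UNIV. christoffel A g c y k k i * ?G y $ i $ j * ?p j y))"
    by (simp add: pX grad_loc[OF f t c y] sum.distrib sum_distrib_left mult.assoc)
  also have "(\<Sum>k\<in>UNIV. \<Sum>j\<in>UNIV. partial k (\<lambda>z. ?G z $ k $ j) y * ?p j y) =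
      (\<Sum>j\<in>UNIV. \<Sum>k\<in>UNIV. partial k (\<lambda>z. ?G z $ k $ j) y * ?p j y)"
    by (rule sum.swap)
  also have "(\<Sum>k\<in>UNIV. \<Sum>i\<in>UNIV. \<Sum>j\<in>UNIV. christoffel A g c y k k i * ?G y $ i $ j * ?p j y) =
      (\<Sum>j\<in>UNIV. \<Sum>k\<in>UNIV. \<Sum>i\<in>UNIV. christoffel A g c y k k i * ?G y $ i $ j * ?p j y)"
  proof -
    have "(\<Sum>k\<in>UNIV. \<Sum>i\<in>UNIV. \<Sum>j\<in>UNIV. christoffel A g c y k k i * ?G y $ i $ j * ?p j y) =
      (\<Sum>k\<in>UNIV. \<Sum>j\<in>UNIV. \<Sum>i\<in>UNIV. christoffel A g c y k k i * ?G y $ i $ j * ?p j y)"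
      by (rule sum.cong[OF refl], rule sum.swap)
    also have "\<dots> = (\<Sum>j\<in>UNIV. \<Sum>k\<in>UNIV. \<Sum>i\<in>UNIV. christoffel A g c y k k i * ?G y $ i $ j * ?p j y)"
      by (rule sum.swap)
    finally show ?thesis .
  qed
  finally show ?thesis
    by (simp add: lapb_def sum.distrib sum_distrib_right distrib_right)
qed

lemma lapb_Ctk:
  assumes "c \<in> A"
  shows "Ctk_on 0 I (chart_image c) (\<lambda>t y. lapb c y j)"
  unfolding lapb_def
  by (intro Ctk_on_sum Ctk_on_add Ctk_on_mult open_chart_image christoffel_Ctk Ctk_on_partial mm_inv_Ctk assms)

lemma laplace_continuous:
  assumes "Ctm 2 I f" "c \<in> A"
  shows "Ctk_on 0 I (chart_image c) (\<lambda>t y. laplace_beltrami A g (f t) (chart_inv c y))"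
proof -
  have "Ctk_on 0 I (chart_image c) (\<lambda>t y.
    (\<Sum>k\<in>UNIV. \<Sum>j\<in>UNIV. matrix_inv (mm c y) $ k $ j * partial k (partial j (loc c (f t))) y)
    + (\<Sum>j\<in>UNIV. lapb c y j * partial j (loc c (f t)) y))"
    by (intro Ctk_on_sum Ctk_on_add Ctk_on_mult open_chart_image mm_inv_Ctk lapb_Ctk assms
        Ctk_on_partial Ctm2_partial Ctk_on_SucD[OF Ctm2_partial])
  then show ?thesis
    by (subst Ctk_on_cong[OF open_chart_image[OF assms(2)] laplace_loc[OF assms(1) _ assms(2)]])
qed

section \<open>Rules of calculus for differences and squares\<close>

lemma pvec_diff:
  assumes "mdiff f x" "mdiff h x" "c \<in> charts_at A x"
  shows "pvec c (\<lambda>x. f x - h x) (snd c x) = pvec c f (snd c x) - pvec c h (snd c x)"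
  using assms by (auto simp: pvec_def vec_eq_iff partial_diff mdiff_def)

lemma mdiff_diff: "mdiff f x \<Longrightarrow> mdiff h x \<Longrightarrow> mdiff (\<lambda>x. f x - h x) x"
  by (auto simp: mdiff_def)

lemma mdiff_mult: "mdiff f x \<Longrightarrow> mdiff h x \<Longrightarrow> mdiff (\<lambda>x. f x * h x) x"
  by (auto simp: mdiff_def)

lemma grad_diff:
  assumes "mdiff f x" "mdiff h x"
  shows "grad A g (\<lambda>x. f x - h x) x = (\<lambda>c. grad A g f x c - grad A g h x c)"
proof -
  obtain c where c: "c \<in> charts_at A x" by (rule ex_chart)
  show ?thesis
  proof (rule TS_eqI[OF grad_in[OF mdiff_diff[OF assms]] TS_diff[OF grad_in[OF assms(1)] grad_in[OF assms(2)]] c])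
    show "grad A g (\<lambda>x. f x - h x) x c = grad A g f x c - grad A g h x c"
      using grad_coords[OF mdiff_diff[OF assms] c] grad_coords[OF assms(1) c] grad_coords[OF assms(2) c]
        pvec_diff[OF assms c] by (simp add: matrix_vector_mult_diff_distrib)
  qed
qed

lemma grad_square:
  assumes "mdiff f x"
  shows "grad A g (\<lambda>x. f x * f x) x = (\<lambda>c. (2 * f x) *\<^sub>R grad A g f x c)"
proof -
  obtain c where c: "c \<in> charts_at A x" by (rule ex_chart)
  have 1: "(\<lambda>c. (2 * f x) *\<^sub>R grad A g f x c) \<in> TS x"
    using TS_lincomb[OF grad_in[OF assms] grad_in[OF assms], of "2 * f x" 0] by simp
  have "pvec c (\<lambda>x. f x * f x) (snd c x) = (2 * f x) *\<^sub>R pvec c f (snd c x)"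
    using assms c charts_atD(4)[OF c] by (auto simp: pvec_def vec_eq_iff partial_mult mdiff_def)
  then show ?thesis
    by (intro TS_eqI[OF grad_in[OF mdiff_mult[OF assms assms]] 1 c])
      (simp add: grad_coords[OF mdiff_mult[OF assms assms] c] grad_coords[OF assms c]
        matrix_vector_mult_scaleR)
qed

lemma Ctm_diff:
  assumes "Ctm k I f" "Ctm k I h"
  shows "Ctm k I (\<lambda>t x. f t x - h t x)"
  using assms by (auto simp: Ctm_def intro!: Ctk_on_diff open_chart_image)

lemma Ctm_mult:
  assumes "Ctm k I f" "Ctm k I h"
  shows "Ctm k I (\<lambda>t x. f t x * h t x)"
  using assms by (auto simp: Ctm_def intro!: Ctk_on_mult open_chart_image)

lemma diff_field_scale:
  assumes "diff_field X" "\<And>x. mdiff a x"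
  shows "diff_field (\<lambda>x c. a x *\<^sub>R X x c)"
proof -
  have "(\<lambda>c. a x *\<^sub>R X x c) \<in> TS x" for x
    using assms(1) TS_lincomb[of "X x" x "X x" "a x" 0] by (simp add: diff_field_def)
  moreover have "loc c a differentiable (at y)" if "c \<in> A" "y \<in> chart_image c" for c y
    using assms(2)[of "chart_inv c y"] charts_atI[OF that] chart_inv_right[OF that]
    by (auto simp: mdiff_def)
  ultimately show ?thesis
    using assms(1) by (auto simp: diff_field_def intro!: differentiable_mult)
qed

lemma cov_deriv_diff:
  assumes "diff_field X" "diff_field Y" "p \<in> TS x"
  shows "cov_deriv A g (\<lambda>x c. X x c - Y x c) x p = (\<lambda>c. cov_deriv A g X x p c - cov_deriv A g Y x p c)"
    and "diff_field (\<lambda>x c. X x c - Y x c)"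
proof -
  show XY: "diff_field (\<lambda>x c. X x c - Y x c)"
    using assms by (auto simp: diff_field_def intro!: TS_diff differentiable_diff)
  obtain c where c: "c \<in> charts_at A x" by (rule ex_chart)
  let ?y = "snd c x"
  have "((\<lambda>y. X (chart_inv c y) c - Y (chart_inv c y) c) has_derivative
     (\<lambda>w. frechet_derivative (\<lambda>y. X (chart_inv c y) c) (at ?y) w - frechet_derivative (\<lambda>y. Y (chart_inv c y) c) (at ?y) w)) (at ?y)"
    by (intro has_derivative_diff diff_field_derivative assms c)
  from fun_cong[OF frechet_derivative_at[OF this], of "p c"]
  have "cov_deriv A g (\<lambda>x c. X x c - Y x c) x p c = cov_deriv A g X x p c - cov_deriv A g Y x p c"
    by (simp add: cov_deriv_coords[OF XY c] cov_deriv_coords[OF assms(1) c] cov_deriv_coords[OF assms(2) c]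
        linear_diff[OF linear_gam(2)])
  then show "cov_deriv A g (\<lambda>x c. X x c - Y x c) x p = (\<lambda>c. cov_deriv A g X x p c - cov_deriv A g Y x p c)"
    by (intro TS_eqI[OF _ _ c] TS_diff cov_deriv_in assms XY)
qed

text \<open>Leibniz's rule: the Christoffel term is linear in the field at the point, so only the
  coordinate derivative sees the variation of \<open>a\<close>.\<close>

lemma cov_deriv_scale:
  assumes "diff_field X" "\<And>x. mdiff a x" "p \<in> TS x"
  shows "cov_deriv A g (\<lambda>x c. a x *\<^sub>R X x c) x p =
    (\<lambda>c. a x *\<^sub>R cov_deriv A g X x p c + g x (grad A g a x) p *\<^sub>R X x c)"
proof -
  note aX = diff_field_scale[OF assms(1,2)]
  obtain c where c: "c \<in> charts_at A x" by (rule ex_chart)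
  let ?y = "snd c x"
  have "((\<lambda>y. a (chart_inv c y) *\<^sub>R X (chart_inv c y) c) has_derivative
     (\<lambda>w. a (chart_inv c ?y) *\<^sub>R frechet_derivative (\<lambda>y. X (chart_inv c y) c) (at ?y) w
       + g x (grad A g a x) (tv c x w) *\<^sub>R X (chart_inv c ?y) c)) (at ?y)"
    by (intro has_derivative_scaleR grad_has_derivative[OF assms(2) c] diff_field_derivative[OF assms(1) c])
  from fun_cong[OF frechet_derivative_at[OF this], of "p c"]
  have "cov_deriv A g (\<lambda>x c. a x *\<^sub>R X x c) x p c =
      a x *\<^sub>R cov_deriv A g X x p c + g x (grad A g a x) p *\<^sub>R X x c"
    by (simp add: cov_deriv_coords[OF aX c] cov_deriv_coords[OF assms(1) c] charts_atD[OF c] tv_eq[OF assms(3) c]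
        linear_cmul[OF linear_gam(2)] algebra_simps)
  moreover have "X x \<in> TS x" using assms(1) by (simp add: diff_field_def)
  ultimately show ?thesis
    by (intro TS_eqI[OF _ _ c] TS_lincomb cov_deriv_in assms aX)
qed

lemma laplace_diff:
  assumes "Ctm 2 I f" "Ctm 2 I h" "t \<in> I"
  shows "laplace_beltrami A g (\<lambda>x. f t x - h t x) x = laplace_beltrami A g (f t) x - laplace_beltrami A g (h t) x"
proof -
  obtain c where c: "c \<in> charts_at A x" by (rule ex_chart)
  have e: "grad A g (\<lambda>x. f t x - h t x) = (\<lambda>x c. grad A g (f t) x c - grad A g (h t) x c)"
    using grad_diff[OF Ctm2_mdiff[OF assms(1,3)] Ctm2_mdiff[OF assms(2,3)]] by auto
  note F = grad_diff_field[OF assms(1,3)] and H = grad_diff_field[OF assms(2,3)]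
  show ?thesis
    unfolding laplace_beltrami_def e divergence_eq[OF cov_deriv_diff(2)[OF F H tv_in[OF c]] c]
      divergence_eq[OF F c] divergence_eq[OF H c] cov_deriv_diff(1)[OF F H tv_in[OF c]]
    by (simp add: sum_subtractf)
qed

lemma g_grad_grad:
  assumes "mdiff f x" "c \<in> charts_at A x"
  shows "g x (grad A g f x) (tv c x w) = w \<bullet> pvec c f (snd c x)"
  using g_grad[OF assms tv_in[OF assms(2)]] tv_self[OF assms(2)] by simp

lemma mdiff_double: "mdiff f x \<Longrightarrow> mdiff (\<lambda>x. 2 * f x) x"
  by (auto simp: mdiff_def)

lemma metric_grad_double:
  assumes "mdiff f x" "p \<in> TS x"
  shows "g x (grad A g (\<lambda>x. 2 * f x) x) p = 2 * g x (grad A g f x) p"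
proof -
  obtain c where c: "c \<in> charts_at A x" by (rule ex_chart)
  have d: "loc c f differentiable (at (snd c x))"
    using assms(1) c by (auto simp: mdiff_def)
  have "pvec c (\<lambda>x. 2 * f x) (snd c x) = 2 *\<^sub>R pvec c f (snd c x)"
    using partial_mult[of "\<lambda>_. 2" "snd c x" "loc c f"] d
    by (simp add: pvec_def vec_eq_iff) (simp add: partial_def)
  then show ?thesis
    using g_grad[OF mdiff_double[OF assms(1)] c assms(2)] g_grad[OF assms(1) c assms(2)] by simp
qed

text \<open>The trace of the Leibniz rule for the gradient \<open>2 f grad f\<close> of the square.
  From here the energy estimate gets its squared gradient.\<close>

lemma laplace_square:
  assumes "Ctm 2 I f" "t \<in> I"
  shows "laplace_beltrami A g (\<lambda>x. f t x * f t x) x =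
    2 * f t x * laplace_beltrami A g (f t) x + 2 * g x (grad A g (f t) x) (grad A g (f t) x)"
proof -
  obtain c where c: "c \<in> charts_at A x" by (rule ex_chart)
  note cA = charts_atD[OF c]
  note F = grad_diff_field[OF assms]
  have md: "mdiff (\<lambda>x. 2 * f t x) x" for x
    by (rule mdiff_double[OF Ctm2_mdiff[OF assms]])
  have e: "grad A g (\<lambda>x. f t x * f t x) = (\<lambda>x c. (2 * f t x) *\<^sub>R grad A g (f t) x c)"
    using grad_square[OF Ctm2_mdiff[OF assms]] by auto
  note g2 = metric_grad_double[OF Ctm2_mdiff[OF assms]]
  \<comment> \<open>The trace of the rank-one map sending \<open>p\<close> to
    \<open>g x (grad A g (f t) x) p\<close> times the gradient.\<close>
  have "(\<Sum>k\<in>UNIV. g x (grad A g (f t) x) (tv c x (axis k 1)) * grad A g (f t) x c $ k) =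
      g x (grad A g (f t) x) (grad A g (f t) x)" (is "?S = _")
    using g_grad[OF Ctm2_mdiff[OF assms] c grad_in[OF Ctm2_mdiff[OF assms]]]
    by (simp add: g_grad_grad[OF Ctm2_mdiff[OF assms] c] inner_axis') (simp add: inner_vec_def mult.commute)
  then have "2 * g x (grad A g (f t) x) (grad A g (f t) x) = 2 * ?S" by simp
  then show ?thesis
    unfolding laplace_beltrami_def e divergence_eq[OF diff_field_scale[OF F md] c]
      divergence_eq[OF F c] cov_deriv_scale[OF F md tv_in[OF c]] g2[OF tv_in[OF c]]
    by (simp add: sum.distrib sum_distrib_left mult.assoc)
qed

end

section \<open>Norms of tangent vectors and bounds for the Laplacian\<close>

text \<open>Gram-Schmidt for an arbitrary positive definite form, since the metric at a point, read
  in a chart, differs from the Euclidean inner product. A vector already in the span adds nothing,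
  whence the inequality for the cardinality.\<close>

lemma ex_orthonormal:
  fixes b :: "'a::real_vector \<Rightarrow> 'a \<Rightarrow> real"
  assumes lin: "\<And>w. linear (\<lambda>u. b u w)" and sym: "\<And>u w. b u w = b w u"
    and pos: "\<And>u. u \<noteq> 0 \<Longrightarrow> b u u > 0" and "finite B"
  shows "\<exists>E. finite E \<and> card E \<le> card B \<and> (\<forall>e\<in>E. \<forall>e'\<in>E. b e e' = (if e = e' then 1 else 0)) \<and>
    span E = span B"
  using \<open>finite B\<close>
proof (induction B rule: finite_induct)
  case empty
  show ?case by (rule exI[of _ "{}"]) simp
next
  case (insert v B)
  then obtain E where E: "finite E" "card E \<le> card B" "span E = span B"
    "\<And>e e'. e \<in> E \<Longrightarrow> e' \<in> E \<Longrightarrow> b e e' = (if e = e' then 1 else 0)"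
    by blast
  \<comment> \<open>The \<open>b\<close>-orthogonal projection of \<open>v\<close> to the span of
    \<open>E\<close>; the remainder \<open>w\<close>, unless zero, is normalised and added.\<close>
  define s where "s = (\<Sum>e\<in>E. b v e *\<^sub>R e)"
  define w where "w = v - s"
  have s: "s \<in> span E" unfolding s_def by (intro span_sum span_scale span_base)
  have bw: "b w e = 0" if "e \<in> E" for e
  proof -
    have "b s e = (\<Sum>e'\<in>E. b v e' * b e' e)"
      unfolding s_def by (simp add: linear_sum[OF lin] linear_cmul[OF lin])
    also have "\<dots> = (\<Sum>e'\<in>E. if e' = e then b v e' else 0)"
      using E(4) that by (intro sum.cong) auto
    also have "\<dots> = b v e" using that E(1) by simp
    finally show ?thesis unfolding w_def by (simp add: linear_diff[OF lin])
  qed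
  show ?case
  proof (cases "w = 0")
    case True
    then have "v \<in> span B" using s E(3) by (simp add: w_def)
    then have "span (insert v B) = span B" by (simp add: span_redundant)
    then show ?thesis using E insert.hyps by (intro exI[of _ E]) auto
  next
    case False
    define r where "r = 1 / sqrt (b w w)"
    define e0 where "e0 = r *\<^sub>R w"
    have r: "r > 0" "r * r * b w w = 1"
      using pos[OF False] by (auto simp: r_def)
    have lin2: "b e (a *\<^sub>R u) = a * b e u" for e a u
      using linear_cmul[OF lin[of e], of a u] sym by simp
    have e0: "b e0 e0 = 1" "\<And>e. e \<in> E \<Longrightarrow> b e0 e = 0" "\<And>e. e \<in> E \<Longrightarrow> b e e0 = 0"
      using r bw sym by (auto simp: e0_def linear_cmul[OF lin] lin2)
    have v: "v = inverse r *\<^sub>R e0 + s" using r by (simp add: e0_def w_def)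
    have "span (insert e0 E) = span (insert v B)"
    proof (rule span_eq[THEN iffD2], intro conjI subsetI)
      have EB: "e \<in> span (insert v B)" if "e \<in> span E" for e
        using that E(3) span_mono[of B "insert v B"] by auto
      fix e assume "e \<in> insert e0 E"
      moreover have "e0 \<in> span (insert v B)"
        unfolding e0_def w_def by (intro span_scale span_diff span_base EB s) simp
      ultimately show "e \<in> span (insert v B)" using EB span_base by auto
    next
      have BE: "e \<in> span (insert e0 E)" if "e \<in> span B" for e
        using that E(3) span_mono[of E "insert e0 E"] by auto
      fix e assume "e \<in> insert v B"
      moreover have "v \<in> span (insert e0 E)"
      proof -
        have "inverse r *\<^sub>R e0 \<in> span (insert e0 E)" by (intro span_scale span_base) simp
        moreover have "s \<in> span (insert e0 E)" by (rule BE) (use s E(3) in simp)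
        ultimately show ?thesis by (subst v) (rule span_add)
      qed
      ultimately show "e \<in> span (insert e0 E)" using BE span_base by auto
    qed
    moreover have "card (insert e0 E) \<le> card (insert v B)"
      using E(1,2) insert.hyps by (simp add: card_insert_if)
    moreover have "e0 \<notin> E" using e0(1) e0(2)[of e0] by auto
    ultimately show ?thesis
      using E e0 by (intro exI[of _ "insert e0 E"]) auto
  qed
qed

text \<open>In a \<open>b\<close>-orthonormal basis the trace is the sum of the entries
  \<open>b (L e) e\<close>, each at most \<open>K\<close> in absolute value by Cauchy-Schwarz.
  Euclidean coordinates would bring in the distortion of the chart, which is not controlled
  uniformly over the manifold.\<close>

lemma trace_bound:
  fixes L :: "real^'n::finite \<Rightarrow> real^'n" and b :: "real^'n \<Rightarrow> real^'n \<Rightarrow> real" and K :: real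
  assumes lin: "\<And>w. linear (\<lambda>u. b u w)" and sym: "\<And>u w. b u w = b w u"
    and pos: "\<And>u. u \<noteq> 0 \<Longrightarrow> b u u > 0" and L: "linear L" "\<And>u. b (L u) (L u) \<le> K\<^sup>2 * b u u" and "K \<ge> 0"
  shows "\<bar>\<Sum>k\<in>UNIV. L (axis k 1) $ k\<bar> \<le> CARD('n) * K"
proof -
  obtain E where E: "finite E" "card E \<le> card (Basis :: (real^'n) set)" "span E = span (Basis :: (real^'n) set)"
    "\<And>e e'. e \<in> E \<Longrightarrow> e' \<in> E \<Longrightarrow> b e e' = (if e = e' then 1 else 0)"
    using ex_orthonormal[of b "Basis :: (real^'n) set", OF lin sym pos finite_Basis] by blast
  have exp: "x = (\<Sum>e\<in>E. b x e *\<^sub>R e)" for x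
  proof -
    have "x \<in> span E" by (simp add: E(3))
    then show ?thesis
    proof (induction rule: span_induct_alt)
      case base
      then show ?case by (simp add: linear_0[OF lin])
    next
      case (step a e y)
      have "(\<Sum>e'\<in>E. b (a *\<^sub>R e + y) e' *\<^sub>R e') = a *\<^sub>R (\<Sum>e'\<in>E. b e e' *\<^sub>R e') + (\<Sum>e'\<in>E. b y e' *\<^sub>R e')"
        by (simp add: linear_add[OF lin] linear_cmul[OF lin] scaleR_add_left sum.distrib scaleR_sum_right)
      also have "(\<Sum>e'\<in>E. b e e' *\<^sub>R e') = (\<Sum>e'\<in>E. if e' = e then e' else 0)"
        using E(4) step(1) by (intro sum.cong) auto
      also have "\<dots> = e" using step(1) E(1) by simp
      finally show ?case using step(2) by simp
    qed
  qed
  have "(\<Sum>k\<in>UNIV. L (axis k 1) $ k) = (\<Sum>k\<in>UNIV. \<Sum>e\<in>E. b (L (axis k 1)) e * e $ k)"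
    by (subst exp[of "L _"]) simp
  also have "\<dots> = (\<Sum>e\<in>E. \<Sum>k\<in>UNIV. b (e $ k *\<^sub>R L (axis k 1)) e)"
    by (subst sum.swap) (simp add: linear_cmul[OF lin] mult.commute)
  also have "\<dots> = (\<Sum>e\<in>E. b (L e) e)"
    by (simp only: linear_sum[OF lin, symmetric] linear_vec_expand[OF L(1), symmetric])
  finally have tr: "(\<Sum>k\<in>UNIV. L (axis k 1) $ k) = (\<Sum>e\<in>E. b (L e) e)" .
  have "\<bar>b (L e) e\<bar> \<le> K" if "e \<in> E" for e
  proof -
    have e: "b e e = 1" using E(4) that by simp
    \<comment> \<open>The part of \<open>L e\<close> orthogonal to \<open>e\<close>; that
      \<open>b z z\<close> is nonnegative is Bessel's inequality for a single vector.\<close>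
    define z where "z = L e - b (L e) e *\<^sub>R e"
    have "(\<lambda>w. b w u) = b u" for u by (rule ext) (rule sym)
    then have lin2: "linear (b u)" for u using lin[of u] by simp
    have "0 \<le> b z z"
      using pos[of z] linear_0[OF lin, of 0] by (cases "z = 0") auto
    also have "b z z = b (L e) (L e) - (b (L e) e)\<^sup>2"
      unfolding z_def
      by (simp add: linear_diff[OF lin] linear_diff[OF lin2] linear_cmul[OF lin] linear_cmul[OF lin2] e
          sym[of e "L e"] power2_eq_square)
    finally have "(b (L e) e)\<^sup>2 \<le> K\<^sup>2" using L(2)[of e] e by simp
    then show ?thesis using \<open>K \<ge> 0\<close> by (simp add: abs_le_square_iff[symmetric])
  qed
  then have "\<bar>\<Sum>e\<in>E. b (L e) e\<bar> \<le> (\<Sum>e\<in>E. K)"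
    by (intro order.trans[OF sum_abs] sum_mono)
  also have "\<dots> \<le> CARD('n) * K"
    using E(2) \<open>K \<ge> 0\<close> by (simp add: mult_right_mono)
  finally show ?thesis by (simp add: tr)
qed

lemma continuous_on_slice:
  fixes I :: "real set" and u :: "real \<Rightarrow> 'a::topological_space \<Rightarrow> real"
  assumes "continuous_on (I \<times> UNIV) (\<lambda>(t, x). u t x)" "t \<in> I"
  shows "continuous_on UNIV (u t)"
proof -
  have "continuous_on UNIV (\<lambda>x::'a. (t, x))" by (intro continuous_intros)
  from continuous_on_compose2[OF assms(1) this] show ?thesis using assms(2) by auto
qed

context riemannian
begin

section \<open>The norm of tangent vectors\<close>

lemma metric_lincomb_right:
  assumes "p \<in> TS x" "q \<in> TS x" "r \<in> TS x"
  shows "g x r (\<lambda>c. a *\<^sub>R p c + b *\<^sub>R q c) = a * g x r p + b * g x r q"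
  using metric_lincomb[OF assms, of a b] metric_sym[OF TS_lincomb[OF assms(1,2)] assms(3), of a b]
    metric_sym[OF assms(1,3)] metric_sym[OF assms(2,3)] by simp

lemma metric_nonneg: "p \<in> TS x \<Longrightarrow> g x p p \<ge> 0"
  using metric_pos[of p x] metric_lincomb[of p x p p 0 0] by (cases "p = (\<lambda>c. 0)") auto

lemma metric_diff_right:
  "p \<in> TS x \<Longrightarrow> q \<in> TS x \<Longrightarrow> r \<in> TS x \<Longrightarrow> g x r (\<lambda>c. p c - q c) = g x r p - g x r q"
  using metric_lincomb_right[of p x q r 1 "-1"] by simp

lemma metric_minus_left:
  "p \<in> TS x \<Longrightarrow> r \<in> TS x \<Longrightarrow> g x (\<lambda>c. - p c) r = - g x p r"
  using metric_lincomb[of p x p r "-1" 0] by simp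

lemma metric_lincomb_square:
  assumes p: "p \<in> TS x" and q: "q \<in> TS x"
  shows "g x (\<lambda>c. a *\<^sub>R p c + b *\<^sub>R q c) (\<lambda>c. a *\<^sub>R p c + b *\<^sub>R q c) =
    a\<^sup>2 * g x p p + 2 * a * b * g x p q + b\<^sup>2 * g x q q"
  using metric_sym[OF p q]
  by (simp add: metric_lincomb[OF p q TS_lincomb[OF p q]] metric_lincomb_right[OF p q p]
      metric_lincomb_right[OF p q q] power2_eq_square algebra_simps)

lemma metric_Cauchy_Schwarz:
  assumes p: "p \<in> TS x" and q: "q \<in> TS x"
  shows "\<bar>g x p q\<bar> \<le> tnorm g x p * tnorm g x q"
proof -
  have *: "0 \<le> a\<^sup>2 * g x p p + 2 * a * b * g x p q + b\<^sup>2 * g x q q" for a b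
    using metric_nonneg[OF TS_lincomb[OF p q, of a b]] metric_lincomb_square[OF p q] by simp
  have "(g x p q)\<^sup>2 \<le> g x p p * g x q q"
  proof (cases "g x q q = 0")
    case True
    \<comment> \<open>If \<open>g x p q\<close> were nonzero, this coefficient of \<open>q\<close>
      would give the quadratic form the value -1.\<close>
    have "0 \<le> 1 * g x p p + 2 * (- (g x p p + 1) / (2 * g x p q)) * g x p q" if "g x p q \<noteq> 0"
      using *[of 1 "- (g x p p + 1) / (2 * g x p q)"] True by simp
    then have "g x p q = 0" by (cases "g x p q = 0") (auto simp: field_simps)
    with True show ?thesis by simp
  next
    case False
    then have q0: "g x q q > 0" using metric_nonneg[OF q] by simp
    have "0 \<le> g x q q * (g x p p * g x q q - (g x p q)\<^sup>2)"
      using *[of "g x q q" "- g x p q"] by (simp add: power2_eq_square algebra_simps)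
    with q0 show ?thesis by (simp add: zero_le_mult_iff)
  qed
  then have "sqrt ((g x p q)\<^sup>2) \<le> sqrt (g x p p * g x q q)" by (rule real_sqrt_le_mono)
  then show ?thesis by (simp add: tnorm_def real_sqrt_mult)
qed

lemma tnorm_nonneg: "p \<in> TS x \<Longrightarrow> tnorm g x p \<ge> 0"
  by (simp add: tnorm_def metric_nonneg)

lemma tnorm_square: "p \<in> TS x \<Longrightarrow> (tnorm g x p)\<^sup>2 = g x p p"
  by (simp add: tnorm_def metric_nonneg)

lemma tnorm_lincomb:
  assumes p: "p \<in> TS x" and q: "q \<in> TS x"
  shows "tnorm g x (\<lambda>c. a *\<^sub>R p c + b *\<^sub>R q c) \<le> \<bar>a\<bar> * tnorm g x p + \<bar>b\<bar> * tnorm g x q"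
proof (rule power2_le_imp_le)
  note n = tnorm_nonneg[OF p] tnorm_nonneg[OF q]
  have "2 * a * b * g x p q \<le> 2 * (\<bar>a\<bar> * \<bar>b\<bar>) * (tnorm g x p * tnorm g x q)"
  proof -
    have "a * b * g x p q \<le> \<bar>a * b\<bar> * \<bar>g x p q\<bar>" by (metis abs_ge_self abs_mult)
    also have "\<dots> \<le> \<bar>a * b\<bar> * (tnorm g x p * tnorm g x q)"
      by (intro mult_left_mono metric_Cauchy_Schwarz p q) simp
    finally show ?thesis by (simp add: abs_mult)
  qed
  then show "(tnorm g x (\<lambda>c. a *\<^sub>R p c + b *\<^sub>R q c))\<^sup>2 \<le> (\<bar>a\<bar> * tnorm g x p + \<bar>b\<bar> * tnorm g x q)\<^sup>2"
    unfolding tnorm_square[OF TS_lincomb[OF p q]] metric_lincomb_square[OF p q]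
    by (simp add: tnorm_square[OF p, symmetric] tnorm_square[OF q, symmetric] power2_eq_square algebra_simps)
  show "0 \<le> \<bar>a\<bar> * tnorm g x p + \<bar>b\<bar> * tnorm g x q" using n by simp
qed

text \<open>With the metric at \<open>x\<close> as the form, \<open>trace_bound\<close> sees the
  operator norm of the covariant derivative itself, so the constant is the same at all
  points.\<close>

lemma divergence_bound:
  fixes K :: real
  assumes X: "diff_field X" and "K \<ge> 0"
    and bd: "\<And>p. p \<in> TS x \<Longrightarrow> tnorm g x (cov_deriv A g X x p) \<le> K * tnorm g x p"
  shows "\<bar>divergence A g X x\<bar> \<le> CARD('n) * K"
proof -
  obtain c where c: "c \<in> charts_at A x" by (rule ex_chart)
  note cA = charts_atD[OF c]
  define b where "b = (\<lambda>u w. u \<bullet> (mm c (snd c x) *v w))"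
  have b: "b u w = g x (tv c x u) (tv c x w)" for u w
    using metric_tv[OF cA(1,3)] cA(4) by (simp add: b_def)
  show ?thesis
    unfolding divergence_eq[OF X c]
  proof (rule trace_bound[where b = b])
    show "linear (\<lambda>u. b u w)" for w
      by (auto intro!: linearI simp: b_def inner_add_left)
    show "b u w = b w u" for u w unfolding b_def by (rule mm_sym(3)[OF cA(1,3)])
    show "b u u > 0" if "u \<noteq> 0" for u unfolding b_def by (rule mm_pos[OF cA(1,3) that])
    show "linear (\<lambda>w. cov_deriv A g X x (tv c x w) c)" by (rule cov_deriv_linear[OF X c])
    show "b (cov_deriv A g X x (tv c x u) c) (cov_deriv A g X x (tv c x u) c) \<le> K\<^sup>2 * b u u" for u
    proof -
      note q = cov_deriv_in[OF X tv_in[OF c, of u]]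
      have "(tnorm g x (cov_deriv A g X x (tv c x u)))\<^sup>2 \<le> (K * tnorm g x (tv c x u))\<^sup>2"
        by (intro power_mono bd tv_in c tnorm_nonneg q)
      then show ?thesis
        by (simp add: b tv_eq[OF q c] tnorm_square[OF q] tnorm_square[OF tv_in[OF c]] power_mult_distrib)
    qed
  qed fact
qed

section \<open>The test function space\<close>

lemma continuous_on_charts:
  fixes I :: "real set" and u :: "real \<Rightarrow> 'm \<Rightarrow> real"
  assumes "\<And>c. c \<in> A \<Longrightarrow> continuous_on (I \<times> chart_image c) (\<lambda>(t, y). u t (chart_inv c y))"
  shows "continuous_on (I \<times> UNIV) (\<lambda>(t, x). u t x)"
proof (rule continuous_on_Times_local)
  fix x
  obtain c where c: "c \<in> charts_at A x" by (rule ex_chart)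
  note cA = charts_atD[OF c]
  have "continuous_on (I \<times> fst c) (\<lambda>p. (fst p, snd c (snd p)))"
    by (intro continuous_intros continuous_on_compose2[OF continuous_chart[OF cA(1)]]) auto
  from continuous_on_compose2[OF assms[OF cA(1)] this]
  have "continuous_on (I \<times> fst c) (\<lambda>p. u (fst p) (chart_inv c (snd c (snd p))))"
    using chart_in[OF cA(1)] by (force simp: case_prod_beta)
  then have "continuous_on (I \<times> fst c) (\<lambda>(t, x). u t x)"
    by (rule continuous_on_eq) (auto simp: chart_inv_left[OF cA(1)])
  then show "\<exists>U. open U \<and> x \<in> U \<and> continuous_on (I \<times> (U \<inter> UNIV)) (\<lambda>(t, x). u t x)"
    using cA(2) open_dom[OF cA(1)] by auto
qed

lemma continuous_on_loc:
  fixes I :: "real set" and u :: "real \<Rightarrow> 'm \<Rightarrow> real"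
  assumes "continuous_on (I \<times> UNIV) (\<lambda>(t, x). u t x)" "c \<in> A"
  shows "continuous_on (I \<times> chart_image c) (\<lambda>(t, y). u t (chart_inv c y))"
proof -
  have "continuous_on (I \<times> chart_image c) (\<lambda>p. (fst p, chart_inv c (snd p)))"
    by (intro continuous_intros continuous_on_compose2[OF continuous_chart_inv[OF assms(2)]]) auto
  from continuous_on_compose2[OF assms(1) this] show ?thesis
    by (force simp: case_prod_beta)
qed

definition C12_bound :: "real \<Rightarrow> (real \<Rightarrow> 'm \<Rightarrow> real) \<Rightarrow> real \<Rightarrow> bool" where
  "C12_bound T v K \<longleftrightarrow> (\<forall>t\<in>{0..T}. \<forall>x.
        \<bar>v t x\<bar> \<le> K \<and> \<bar>time_deriv T v t x\<bar> \<le> K \<and> tnorm g x (grad A g (v t) x) \<le> K \<and>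
        (\<forall>p\<in>tangent_space A x. tnorm g x (cov_deriv A g (grad A g (v t)) x p) \<le> K * tnorm g x p))"

text \<open>Continuity of the function and of its space derivatives is packed into
  \<open>Ctm 2\<close>, which is stable under differences and products; what remains concerns time
  and the bounds.\<close>

lemma C12b_iff:
  "v \<in> C12b A g T \<longleftrightarrow> Ctm 2 {0..T} v \<and>
     (\<forall>t\<in>{0..T}. \<forall>x. (\<lambda>s. v s x) differentiable (at t within {0..T})) \<and>
     continuous_on ({0..T} \<times> UNIV) (\<lambda>(t, x). time_deriv T v t x) \<and> (\<exists>K. C12_bound T v K)"
proof
  assume v: "v \<in> C12b A g T"
  have "Ctk_on 2 {0..T} (chart_image c) (\<lambda>t. loc c (v t))" if c: "c \<in> A" for c
  proof -
    note op = open_chart_image[OF c]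
    have C2: "Ck_on 2 (chart_image c) (loc c (v t))" if "t \<in> {0..T}" for t
      using v that c by (auto simp: C12b_def)
    have 0: "continuous_on ({0..T} \<times> chart_image c) (\<lambda>(t, y). loc c (v t) y)"
      by (rule continuous_on_loc[OF _ c]) (use v in \<open>simp add: C12b_def\<close>)
    have 1: "continuous_on ({0..T} \<times> chart_image c) (\<lambda>(t, y). partial i (loc c (v t)) y)" for i
      using v c by (simp add: C12b_def)
    have 2: "continuous_on ({0..T} \<times> chart_image c) (\<lambda>(t, y). partial j (partial i (loc c (v t))) y)" for i j
      using v c by (simp add: C12b_def)
    show ?thesis
      unfolding numeral_2_eq_2
    proof (intro Ctk_on_Suc_partialI[OF op])
      fix t y assume t: "t \<in> {0..T}" and y: "y \<in> chart_image c"
      show "loc c (v t) differentiable (at y)" "partial i (loc c (v t)) differentiable (at y)" for i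
        using C2[OF t] y by (auto simp: numeral_2_eq_2 partial_def[abs_def])
    qed (use 0 1 2 in simp_all)
  qed
  then show "Ctm 2 {0..T} v \<and>
     (\<forall>t\<in>{0..T}. \<forall>x. (\<lambda>s. v s x) differentiable (at t within {0..T})) \<and>
     continuous_on ({0..T} \<times> UNIV) (\<lambda>(t, x). time_deriv T v t x) \<and> (\<exists>K. C12_bound T v K)"
    using v by (simp add: C12b_def Ctm_def C12_bound_def)
next
  assume v: "Ctm 2 {0..T} v \<and>
     (\<forall>t\<in>{0..T}. \<forall>x. (\<lambda>s. v s x) differentiable (at t within {0..T})) \<and>
     continuous_on ({0..T} \<times> UNIV) (\<lambda>(t, x). time_deriv T v t x) \<and> (\<exists>K. C12_bound T v K)"
  then have C: "\<And>c. c \<in> A \<Longrightarrow> Ctk_on 2 {0..T} (chart_image c) (\<lambda>t. loc c (v t))" by (simp add: Ctm_def)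
  have "continuous_on ({0..T} \<times> UNIV) (\<lambda>(t, x). v t x)"
    by (rule continuous_on_charts) (rule Ctk_on_continuous[OF C])
  moreover have "Ck_on 2 (chart_image c) (loc c (v t))" if "c \<in> A" "t \<in> {0..T}" for c t
    using Ck_on_of_Ctk_on[OF C[OF that(1)] that(2)] .
  moreover have "continuous_on ({0..T} \<times> chart_image c) (\<lambda>(t, y). partial i (loc c (v t)) y)" if "c \<in> A" for c i
    using Ctk_on_continuous[OF Ctm2_partial] v that by blast
  moreover have "continuous_on ({0..T} \<times> chart_image c) (\<lambda>(t, y). partial j (partial i (loc c (v t))) y)"
    if "c \<in> A" for c i j
    using Ctk_on_partial[OF Ctm2_partial, of "{0..T}" v c j i] v that by simp
  ultimately show "v \<in> C12b A g T"
    using v by (simp add: C12b_def C12_bound_def)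
qed

lemma C12bD:
  assumes "v \<in> C12b A g T"
  shows C12b_Ctm: "Ctm 2 {0..T} v"
    and C12b_time_cont: "continuous_on ({0..T} \<times> UNIV) (\<lambda>(t, x). time_deriv T v t x)"
    and C12b_cont: "continuous_on ({0..T} \<times> UNIV) (\<lambda>(t, x). v t x)"
    and C12b_mdiff: "\<And>t x. t \<in> {0..T} \<Longrightarrow> mdiff (v t) x"
    and C12b_time_diff: "\<And>t x. t \<in> {0..T} \<Longrightarrow>
      ((\<lambda>s. v s x) has_vector_derivative time_deriv T v t x) (at t within {0..T})"
proof -
  show C: "Ctm 2 {0..T} v" and "continuous_on ({0..T} \<times> UNIV) (\<lambda>(t, x). time_deriv T v t x)"
    using assms by (simp_all add: C12b_iff)
  show "continuous_on ({0..T} \<times> UNIV) (\<lambda>(t, x). v t x)" using assms by (simp add: C12b_def)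
  show "\<And>t x. t \<in> {0..T} \<Longrightarrow> mdiff (v t) x" by (rule Ctm2_mdiff[OF C])
  show "\<And>t x. t \<in> {0..T} \<Longrightarrow>
      ((\<lambda>s. v s x) has_vector_derivative time_deriv T v t x) (at t within {0..T})"
    using assms unfolding C12b_iff time_deriv_def vector_derivative_works[symmetric] by blast
qed

lemma C12b_bound:
  assumes "v \<in> C12b A g T"
  obtains K where "K \<ge> 0" "C12_bound T v K"
proof -
  obtain K where K: "C12_bound T v K" using assms C12b_iff by blast
  have b: "C12_bound T v \<bar>K\<bar>"
    unfolding C12_bound_def
  proof (intro ballI allI)
    fix t x assume t: "t \<in> {0..T}"
    have "tnorm g x (cov_deriv A g (grad A g (v t)) x p) \<le> \<bar>K\<bar> * tnorm g x p" if p: "p \<in> TS x" for p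
    proof -
      have "K * tnorm g x p \<le> \<bar>K\<bar> * tnorm g x p" by (intro mult_right_mono tnorm_nonneg p) simp
      then show ?thesis using K t p unfolding C12_bound_def by fastforce
    qed
    then show "\<bar>v t x\<bar> \<le> \<bar>K\<bar> \<and> \<bar>time_deriv T v t x\<bar> \<le> \<bar>K\<bar> \<and> tnorm g x (grad A g (v t) x) \<le> \<bar>K\<bar> \<and>
        (\<forall>p\<in>TS x. tnorm g x (cov_deriv A g (grad A g (v t)) x p) \<le> \<bar>K\<bar> * tnorm g x p)"
      using K t unfolding C12_bound_def by (meson abs_ge_self order_trans)
  qed
  show ?thesis by (rule that[OF abs_ge_zero b])
qed

lemma C12_bound_laplace:
  fixes K :: real
  assumes "v \<in> C12b A g T" "C12_bound T v K" "K \<ge> 0" "t \<in> {0..T}"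
  shows "\<bar>laplace_beltrami A g (v t) x\<bar> \<le> CARD('n) * K"
  unfolding laplace_beltrami_def
  using assms divergence_bound[OF grad_diff_field[OF C12b_Ctm[OF assms(1)] assms(4)] assms(3), of x]
  by (auto simp: C12_bound_def)

text \<open>As \<open>T > 0\<close>, no point of the interval is isolated, so the one-sided
  derivatives at the end points are unique as well.\<close>

lemma time_derivI:
  assumes "T > 0" "t \<in> {0..T}" "((\<lambda>s. v s x) has_vector_derivative d) (at t within {0..T})"
  shows "time_deriv T v t x = d"
  unfolding time_deriv_def using vector_derivative_within_closed_interval[OF assms] .

lemma C12b_diff:
  assumes "v \<in> C12b A g T" "u \<in> C12b A g T" "T > 0"
  shows "(\<lambda>t x. v t x - u t x) \<in> C12b A g T"
    and "\<And>t x. t \<in> {0..T} \<Longrightarrow> time_deriv T (\<lambda>t x. v t x - u t x) t x = time_deriv T v t x - time_deriv T u t x"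
proof -
  have D: "((\<lambda>s. v s x - u s x) has_vector_derivative time_deriv T v t x - time_deriv T u t x) (at t within {0..T})"
    if "t \<in> {0..T}" for t x
    by (intro has_vector_derivative_diff C12b_time_diff assms that)
  show td: "time_deriv T (\<lambda>t x. v t x - u t x) t x = time_deriv T v t x - time_deriv T u t x"
    if "t \<in> {0..T}" for t x
    by (rule time_derivI[OF assms(3) that D[OF that]])
  obtain K where K: "K \<ge> 0" "C12_bound T v K" using C12b_bound[OF assms(1)] .
  obtain L where L: "L \<ge> 0" "C12_bound T u L" using C12b_bound[OF assms(2)] .
  have "C12_bound T (\<lambda>t x. v t x - u t x) (K + L)"
    unfolding C12_bound_def
  proof (intro ballI allI)
    fix t x assume t: "t \<in> {0..T}"
    have k: "\<bar>v t x\<bar> \<le> K" "\<bar>time_deriv T v t x\<bar> \<le> K" "tnorm g x (grad A g (v t) x) \<le> K"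
      "\<And>p. p \<in> TS x \<Longrightarrow> tnorm g x (cov_deriv A g (grad A g (v t)) x p) \<le> K * tnorm g x p"
      using K t by (auto simp: C12_bound_def)
    have l: "\<bar>u t x\<bar> \<le> L" "\<bar>time_deriv T u t x\<bar> \<le> L" "tnorm g x (grad A g (u t) x) \<le> L"
      "\<And>p. p \<in> TS x \<Longrightarrow> tnorm g x (cov_deriv A g (grad A g (u t)) x p) \<le> L * tnorm g x p"
      using L t by (auto simp: C12_bound_def)
    have gr: "grad A g (\<lambda>x. v t x - u t x) = (\<lambda>x c. grad A g (v t) x c - grad A g (u t) x c)"
      using grad_diff[OF C12b_mdiff[OF assms(1) t] C12b_mdiff[OF assms(2) t]] by auto
    have tri: "tnorm g x (\<lambda>c. p c - q c) \<le> tnorm g x p + tnorm g x q" if "p \<in> TS x" "q \<in> TS x" for p q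
      using tnorm_lincomb[OF that, of 1 "-1"] by simp
    note dv = grad_diff_field[OF C12b_Ctm[OF assms(1)] t] and du = grad_diff_field[OF C12b_Ctm[OF assms(2)] t]
    have "tnorm g x (cov_deriv A g (grad A g (\<lambda>x. v t x - u t x)) x p) \<le> (K + L) * tnorm g x p"
      if p: "p \<in> TS x" for p
      unfolding gr cov_deriv_diff(1)[OF dv du p]
      using tri[OF cov_deriv_in[OF dv p] cov_deriv_in[OF du p]] k(4)[OF p] l(4)[OF p]
      by (simp add: algebra_simps)
    moreover have "tnorm g x (grad A g (\<lambda>x. v t x - u t x) x) \<le> K + L"
      using tri[OF grad_in[OF C12b_mdiff[OF assms(1) t]] grad_in[OF C12b_mdiff[OF assms(2) t]]] k(3) l(3)
      by (simp add: gr)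
    ultimately show "\<bar>v t x - u t x\<bar> \<le> K + L \<and> \<bar>time_deriv T (\<lambda>t x. v t x - u t x) t x\<bar> \<le> K + L \<and>
        tnorm g x (grad A g (\<lambda>x. v t x - u t x) x) \<le> K + L \<and>
        (\<forall>p\<in>TS x. tnorm g x (cov_deriv A g (grad A g (\<lambda>x. v t x - u t x)) x p) \<le> (K + L) * tnorm g x p)"
      unfolding td[OF t] using k(1,2) l(1,2) by auto
  qed
  moreover have "continuous_on ({0..T} \<times> UNIV) (\<lambda>(t, x). time_deriv T (\<lambda>t x. v t x - u t x) t x)"
  proof (rule continuous_on_eq)
    show "continuous_on ({0..T} \<times> UNIV) (\<lambda>p. (\<lambda>(t, x). time_deriv T v t x) p - (\<lambda>(t, x). time_deriv T u t x) p)"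
      by (intro continuous_on_diff C12b_time_cont assms)
  qed (auto simp: td)
  ultimately show "(\<lambda>t x. v t x - u t x) \<in> C12b A g T"
    unfolding C12b_iff using D differentiableI_vector
    by (blast intro: Ctm_diff C12b_Ctm assms)
qed

text \<open>Admits the square of \<open>w\<close> as a test function. The bound on the function
  itself matters here: it multiplies the derivatives.\<close>

lemma C12b_square:
  assumes "v \<in> C12b A g T" "T > 0"
  shows "(\<lambda>t x. v t x * v t x) \<in> C12b A g T"
    and "\<And>t x. t \<in> {0..T} \<Longrightarrow> time_deriv T (\<lambda>t x. v t x * v t x) t x = 2 * v t x * time_deriv T v t x"
proof -
  have D: "((\<lambda>s. v s x * v s x) has_vector_derivative 2 * v t x * time_deriv T v t x) (at t within {0..T})"
    if "t \<in> {0..T}" for t x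
    using has_vector_derivative_mult[OF C12b_time_diff[OF assms(1) that] C12b_time_diff[OF assms(1) that], of x x]
    by (simp add: algebra_simps)
  show td: "time_deriv T (\<lambda>t x. v t x * v t x) t x = 2 * v t x * time_deriv T v t x"
    if "t \<in> {0..T}" for t x
    by (rule time_derivI[OF assms(2) that D[OF that]])
  obtain K where K: "K \<ge> 0" "C12_bound T v K" using C12b_bound[OF assms(1)] .
  \<comment> \<open>The covariant Hessian of the square has two terms, the function times its
    Hessian and a product of two gradients, each with a factor 2 and at most
    \<open>K\<^sup>2\<close>. The other bounds are smaller.\<close>
  have "C12_bound T (\<lambda>t x. v t x * v t x) (4 * K\<^sup>2)"
    unfolding C12_bound_def
  proof (intro ballI allI)
    fix t x assume t: "t \<in> {0..T}"
    have k: "\<bar>v t x\<bar> \<le> K" "\<bar>time_deriv T v t x\<bar> \<le> K" "tnorm g x (grad A g (v t) x) \<le> K"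
      "\<And>p. p \<in> TS x \<Longrightarrow> tnorm g x (cov_deriv A g (grad A g (v t)) x p) \<le> K * tnorm g x p"
      using K t by (auto simp: C12_bound_def)
    note md = C12b_mdiff[OF assms(1) t]
    note G = grad_in[OF md, of x]
    have gr: "grad A g (\<lambda>x. v t x * v t x) = (\<lambda>x c. (2 * v t x) *\<^sub>R grad A g (v t) x c)"
      using grad_square[OF md] by auto
    note dv = grad_diff_field[OF C12b_Ctm[OF assms(1)] t]
    have kk: "a * b \<le> K\<^sup>2" if "a \<le> K" "b \<le> K" "0 \<le> a" "0 \<le> b" for a b
      using mult_mono[OF that(1,2)] that K(1) by (simp add: power2_eq_square)
    note md2 = mdiff_double[OF md]
    have "tnorm g x (cov_deriv A g (grad A g (\<lambda>x. v t x * v t x)) x p) \<le> 4 * K\<^sup>2 * tnorm g x p"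
      if p: "p \<in> TS x" for p
    proof -
      note n = tnorm_nonneg[OF p]
      have "\<bar>g x (grad A g (\<lambda>x. 2 * v t x) x) p\<bar> = 2 * \<bar>g x (grad A g (v t) x) p\<bar>"
        by (simp add: metric_grad_double[OF md p] abs_mult)
      also have "\<dots> \<le> 2 * (K * tnorm g x p)"
        using metric_Cauchy_Schwarz[OF G p] mult_right_mono[OF k(3) n] by simp
      finally have 1: "\<bar>g x (grad A g (\<lambda>x. 2 * v t x) x) p\<bar> * tnorm g x (grad A g (v t) x) \<le>
          2 * (K * tnorm g x p) * K"
        using k(3) K(1) n by (intro mult_mono tnorm_nonneg G) auto
      have 2: "\<bar>2 * v t x\<bar> * tnorm g x (cov_deriv A g (grad A g (v t)) x p) \<le> (2 * K) * (K * tnorm g x p)"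
        using k(1) k(4)[OF p] K(1) by (intro mult_mono tnorm_nonneg cov_deriv_in dv p) auto
      show ?thesis
        unfolding gr cov_deriv_scale[OF dv md2 p]
        using tnorm_lincomb[OF cov_deriv_in[OF dv p] G, of "2 * v t x" "g x (grad A g (\<lambda>x. 2 * v t x) x) p"] 1 2
        by (simp add: power2_eq_square algebra_simps)
    qed
    moreover have "tnorm g x (grad A g (\<lambda>x. v t x * v t x) x) \<le> 2 * K\<^sup>2"
      using tnorm_lincomb[OF G G, of "2 * v t x" 0] kk[OF k(1) k(3)] tnorm_nonneg[OF G]
      by (simp add: gr abs_mult)
    then have "tnorm g x (grad A g (\<lambda>x. v t x * v t x) x) \<le> 4 * K\<^sup>2"
      by (rule order_trans) simp
    moreover have "\<bar>v t x * v t x\<bar> \<le> 4 * K\<^sup>2"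
      using kk[OF k(1) k(1)] zero_le_power2[of K] unfolding abs_mult by linarith
    moreover have "\<bar>2 * v t x * time_deriv T v t x\<bar> \<le> 4 * K\<^sup>2"
    proof -
      have "\<bar>2 * v t x * time_deriv T v t x\<bar> = 2 * (\<bar>v t x\<bar> * \<bar>time_deriv T v t x\<bar>)"
        by (simp add: abs_mult)
      then show ?thesis using kk[OF k(1) k(2)] zero_le_power2[of K] by linarith
    qed
    ultimately show "\<bar>v t x * v t x\<bar> \<le> 4 * K\<^sup>2 \<and> \<bar>time_deriv T (\<lambda>t x. v t x * v t x) t x\<bar> \<le> 4 * K\<^sup>2 \<and>
        tnorm g x (grad A g (\<lambda>x. v t x * v t x) x) \<le> 4 * K\<^sup>2 \<and>
        (\<forall>p\<in>TS x. tnorm g x (cov_deriv A g (grad A g (\<lambda>x. v t x * v t x)) x p) \<le> 4 * K\<^sup>2 * tnorm g x p)"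
      unfolding td[OF t] by auto
  qed
  moreover have "continuous_on ({0..T} \<times> UNIV) (\<lambda>(t, x). time_deriv T (\<lambda>t x. v t x * v t x) t x)"
  proof (rule continuous_on_eq)
    show "continuous_on ({0..T} \<times> UNIV)
        (\<lambda>p. 2 * (\<lambda>(t, x). v t x) p * (\<lambda>(t, x). time_deriv T v t x) p)"
      by (intro continuous_on_mult continuous_on_const C12b_time_cont C12b_cont assms)
  qed (auto simp: td)
  ultimately show "(\<lambda>t x. v t x * v t x) \<in> C12b A g T"
    unfolding C12b_iff using D differentiableI_vector
    by (blast intro: Ctm_mult C12b_Ctm assms)
qed

end

section \<open>Extension of functions from a chart by zero\<close>

context riemannian
begin

definition ext :: "('m, 'n) chart \<Rightarrow> (real \<Rightarrow> real^'n \<Rightarrow> real) \<Rightarrow> real \<Rightarrow> 'm \<Rightarrow> real" where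
  "ext c F t x = (if x \<in> fst c then F t (snd c x) else 0)"

text \<open>Compact sets are closed in a Hausdorff space, so a function extended from the ball by
  zero vanishes on an open set.\<close>

lemma closed_chart_ball:
  assumes "c \<in> A" "cball z R \<subseteq> chart_image c"
  shows "closed (chart_inv c ` cball z R)"
  by (intro compact_imp_closed compact_continuous_image compact_cball
      continuous_on_subset[OF continuous_chart_inv[OF assms(1)] assms(2)])

text \<open>Regularity is local. Over the chart domain the extension is \<open>F\<close> after a
  change of coordinates; any other point has a neighbourhood where it vanishes, since the image of
  the ball is closed in the whole manifold and not merely in the chart domain.\<close>

lemma ext_Ctm:
  assumes c: "c \<in> A" "cball z R \<subseteq> chart_image c"
    and F: "Ctk_on k I UNIV F" "\<And>t y. t \<in> I \<Longrightarrow> y \<notin> cball z R \<Longrightarrow> F t y = 0"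
  shows "Ctm k I (ext c F)"
  unfolding Ctm_def
proof
  fix d assume d: "d \<in> A"
  let ?K = "chart_inv c ` cball z R"
  show "Ctk_on k I (chart_image d) (\<lambda>t. loc d (ext c F t))"
  proof (rule Ctk_on_local)
    fix y assume y: "y \<in> chart_image d"
    show "\<exists>U. open U \<and> y \<in> U \<and> Ctk_on k I (U \<inter> chart_image d) (\<lambda>t. loc d (ext c F t))"
    proof (cases "chart_inv d y \<in> fst c")
      case True
      have sub: "overlap d c \<inter> chart_image d = overlap d c" using overlap_eq[OF d] by auto
      note op = open_overlap[OF d c(1)]
      have "Ctk_on k I (overlap d c) (\<lambda>t y. F t (tr d c y))"
      proof (rule Ctk_on_compose[OF op open_UNIV _ F(1)])
        show "Ctk_on k I (overlap d c) (\<lambda>t y. tr d c y $ i)" for i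
          by (rule transition_Ctk[OF d c(1)])
        show "continuous_on (overlap d c) (tr d c)"
          using transition_Ck[OF d c(1), of 0] by simp
      qed simp
      then have "Ctk_on k I (overlap d c) (\<lambda>t. loc d (ext c F t))"
        by (subst Ctk_on_cong[OF op]) (auto simp: ext_def overlap_trans[OF d c(1)])
      then show ?thesis
        using True y op by (intro exI[of _ "overlap d c"]) (simp add: sub, simp add: overlap_eq[OF d])
    next
      case False
      let ?U = "chart_image d \<inter> chart_inv d -` (- ?K)"
      have "open ?U"
        by (rule continuous_open_preimage[OF continuous_chart_inv open_chart_image])
          (use d closed_chart_ball[OF c] in auto)
      moreover have "y \<in> ?U" using False y chart_inv_in[OF c(1)] c(2) by auto
      moreover have "Ctk_on k I (?U \<inter> chart_image d) (\<lambda>t. loc d (ext c F t))"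
      proof (subst Ctk_on_cong[where g = "\<lambda>t y. 0"])
        show op: "open (?U \<inter> chart_image d)" using \<open>open ?U\<close> open_chart_image[OF d] by blast
        show "Ctk_on k I (?U \<inter> chart_image d) (\<lambda>t y. 0)" by (rule Ctk_on_const[OF op])
        fix t y assume t: "t \<in> I" and y: "y \<in> ?U \<inter> chart_image d"
        have "snd c (chart_inv d y) \<notin> cball z R" if "chart_inv d y \<in> fst c"
          using y chart_inv_left[OF c(1) that] by force
        then show "ext c F t (chart_inv d y) = 0" using F(2)[OF t] by (auto simp: ext_def)
      qed
      ultimately show ?thesis by blast
    qed
  qed
qed

lemma ext_loc: "c \<in> A \<Longrightarrow> y \<in> chart_image c \<Longrightarrow> ext c F t (chart_inv c y) = F t y"
  by (simp add: ext_def chart_inv_in chart_inv_right)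

lemma ext_continuous:
  assumes "c \<in> A" "cball z R \<subseteq> chart_image c"
    and "continuous_on (I \<times> UNIV) (\<lambda>(t, y). F t y)" "\<And>t y. t \<in> I \<Longrightarrow> y \<notin> cball z R \<Longrightarrow> F t y = 0"
  shows "continuous_on (I \<times> UNIV) (\<lambda>(t, x). ext c F t x)"
proof (rule continuous_on_charts)
  have "Ctm 0 I (ext c F)" by (rule ext_Ctm[OF assms(1,2)]) (use assms(3,4) in auto)
  then show "continuous_on (I \<times> chart_image d) (\<lambda>(t, y). ext c F t (chart_inv d y))" if "d \<in> A" for d
    using that by (simp add: Ctm_def)
qed

section \<open>Probability measures on the manifold\<close>

text \<open>A cone over a small coordinate ball; it serves in place of a distance function on the
  manifold.\<close>

lemma ex_bump:
  assumes "open U" "x \<in> U"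
  obtains f :: "'m \<Rightarrow> real" where "continuous_on UNIV f" "\<And>y. f y \<ge> 0" "f x > 0" "\<And>y. y \<notin> U \<Longrightarrow> f y = 0"
proof -
  obtain c where c: "c \<in> charts_at A x" by (rule ex_chart)
  note cA = charts_atD[OF c]
  let ?V = "chart_image c \<inter> chart_inv c -` U"
  have "open ?V"
    by (rule continuous_open_preimage[OF continuous_chart_inv open_chart_image]) (use cA assms in auto)
  moreover have "snd c x \<in> ?V" using cA assms by auto
  ultimately obtain r where r: "r > 0" "cball (snd c x) r \<subseteq> ?V"
    using open_contains_cball by blast
  \<comment> \<open>Time is a dummy: \<open>ext\<close> expects a time argument, which is frozen at
    0.\<close>
  define F where "F = (\<lambda>(t::real) y. max 0 (r - dist y (snd c x)))"
  have "continuous_on ({0} \<times> UNIV) (\<lambda>(t, x). ext c F t x)"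
  proof (rule ext_continuous)
    show "cball (snd c x) r \<subseteq> chart_image c" using r by auto
    show "continuous_on ({0} \<times> UNIV) (\<lambda>(t, y). F t y)"
      unfolding F_def case_prod_beta by (intro continuous_intros)
  qed (auto simp: F_def cA dist_commute)
  then have "continuous_on UNIV (ext c F 0)" by (rule continuous_on_slice) simp
  moreover have "ext c F 0 y \<ge> 0" for y by (simp add: ext_def F_def)
  moreover have "ext c F 0 x > 0" using cA r by (simp add: ext_def F_def)
  moreover have "ext c F 0 y = 0" if "y \<notin> U" for y
  proof (cases "y \<in> fst c")
    case True
    then have "snd c y \<notin> cball (snd c x) r" using r(2) that chart_inv_left[OF cA(1) True] by auto
    then show ?thesis by (simp add: ext_def F_def dist_commute)
  qed (simp add: ext_def)
  ultimately show ?thesis by (rule that)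
qed

text \<open>Second countability reduces the bumps at the points of \<open>U\<close> to countably
  many whose positivity sets still cover \<open>U\<close>; their partial sums are amplified and cut
  off at 1.\<close>

lemma open_approx:
  assumes "open U"
  obtains h :: "nat \<Rightarrow> 'm \<Rightarrow> real" where "\<And>n. continuous_on UNIV (h n)" "\<And>n y. 0 \<le> h n y \<and> h n y \<le> 1"
    "\<And>y. (\<lambda>n. h n y) \<longlonglongrightarrow> indicator U y"
proof (cases "U = {}")
  case True
  show ?thesis by (rule that[of "\<lambda>_ _. 0"]) (auto simp: True)
next
  case False
  have "\<forall>x\<in>U. \<exists>f :: 'm \<Rightarrow> real. continuous_on UNIV f \<and> (\<forall>y. f y \<ge> 0) \<and> f x > 0 \<and> (\<forall>y. y \<notin> U \<longrightarrow> f y = 0)"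
    by (meson ex_bump[OF assms])
  then obtain f :: "'m \<Rightarrow> 'm \<Rightarrow> real" where f: "\<And>x. x \<in> U \<Longrightarrow> continuous_on UNIV (f x)"
    "\<And>x y. x \<in> U \<Longrightarrow> f x y \<ge> 0" "\<And>x. x \<in> U \<Longrightarrow> f x x > 0" "\<And>x y. x \<in> U \<Longrightarrow> y \<notin> U \<Longrightarrow> f x y = 0"
    by metis
  let ?P = "\<lambda>x. {y. f x y > 0}"
  have "open S" if "S \<in> ?P ` U" for S
    using that f(1) by (auto intro!: open_Collect_less continuous_intros)
  from Lindelof[OF this] obtain \<F> where \<F>: "\<F> \<subseteq> ?P ` U" "countable \<F>" "\<Union>\<F> = \<Union>(?P ` U)" by metis
  obtain X where X: "X \<subseteq> U" "countable X" "\<F> = ?P ` X"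
    using \<F>(1,2) countable_subset_image[of \<F> ?P U] by auto
  have "X \<noteq> {}" using False f(3) \<F>(3) X(3) by auto
  define e where "e = from_nat_into X"
  have e: "e n \<in> U" for n using X(1) from_nat_into[OF \<open>X \<noteq> {}\<close>] by (auto simp: e_def)
  \<comment> \<open>The factor \<open>n\<close> forces the value 1 eventually wherever one bump is
    positive; outside \<open>U\<close> all summands vanish.\<close>
  define h where "h = (\<lambda>n y. min 1 (real n * (\<Sum>i<n. f (e i) y)))"
  show ?thesis
  proof (rule that[of h])
    show "continuous_on UNIV (h n)" for n
      unfolding h_def by (intro continuous_intros f(1) e)
    show "0 \<le> h n y \<and> h n y \<le> 1" for n y
      by (auto simp: h_def intro!: mult_nonneg_nonneg sum_nonneg f(2) e)
    show "(\<lambda>n. h n y) \<longlonglongrightarrow> indicator U y" for y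
    proof (cases "y \<in> U")
      case True
      then have "y \<in> \<Union>\<F>" using \<F>(3) f(3)[OF True] by blast
      then obtain x where x: "x \<in> X" "f x y > 0" using X(3) by auto
      then obtain k where k: "e k = x" using from_nat_into_surj[OF X(2)] e_def by blast
      obtain N :: nat where N: "1 / f x y < real N" using reals_Archimedean2 by blast
      have "h n y = 1" if n: "n \<ge> max N (Suc k)" for n
      proof -
        have "f x y \<le> (\<Sum>i<n. f (e i) y)"
          using n member_le_sum[of k "{..<n}" "\<lambda>i. f (e i) y"] f(2)[OF e] by (simp add: k)
        moreover have "1 \<le> real n * f x y"
        proof -
          have "1 / f x y \<le> real n" using N n by simp
          then show ?thesis using x(2) by (simp add: pos_divide_le_eq)
        qed
        ultimately have "1 \<le> real n * (\<Sum>i<n. f (e i) y)"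
          by (meson mult_left_mono of_nat_0_le_iff order_trans)
        then show ?thesis by (simp add: h_def)
      qed
      then have "eventually (\<lambda>n. h n y = indicator U y) sequentially"
        using True unfolding eventually_sequentially by (intro exI[of _ "max N (Suc k)"]) simp
      then show ?thesis by (rule tendsto_eventually)
    next
      case False
      then show ?thesis using f(4)[OF e] by (simp add: h_def)
    qed
  qed
qed

text \<open>Open sets are stable under intersection and generate the Borel sets, and the measure of
  an open set is a limit of integrals of bounded continuous functions.\<close>

lemma borel_probs_eqI:
  fixes \<mu> \<nu> :: "'m measure"
  assumes \<mu>: "\<mu> \<in> borel_probs" and \<nu>: "\<nu> \<in> borel_probs"
    and eq: "\<And>f :: 'm \<Rightarrow> real. continuous_on UNIV f \<Longrightarrow> bounded (range f) \<Longrightarrow> (\<integral>x. f x \<partial>\<mu>) = (\<integral>x. f x \<partial>\<nu>)"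
  shows "\<mu> = \<nu>"
proof (rule measure_eqI_generator_eq[where E = "{S. open S}" and \<Omega> = UNIV and A = "\<lambda>_. UNIV"])
  interpret \<mu>: prob_space \<mu> using \<mu> by (simp add: borel_probs_def)
  interpret \<nu>: prob_space \<nu> using \<nu> by (simp add: borel_probs_def)
  have s: "sets \<mu> = sets borel" "sets \<nu> = sets borel" using \<mu> \<nu> by (auto simp: borel_probs_def)
  have sp: "space \<mu> = UNIV" "space \<nu> = UNIV" using s[THEN sets_eq_imp_space_eq] by auto
  show "sets \<mu> = sigma_sets UNIV {S. open S}" "sets \<nu> = sigma_sets UNIV {S. open S}"
    by (simp_all add: s borel_def)
  fix U :: "'m set" assume "U \<in> {S. open S}"
  then have U: "open U" by simp
  obtain h :: "nat \<Rightarrow> 'm \<Rightarrow> real" where h: "\<And>n. continuous_on UNIV (h n)" "\<And>n y. 0 \<le> h n y \<and> h n y \<le> 1"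
    "\<And>y. (\<lambda>n. h n y) \<longlonglongrightarrow> indicator U y"
    using open_approx[OF U] by blast
  have lim: "(\<lambda>n. \<integral>x. h n x \<partial>\<kappa>) \<longlonglongrightarrow> measure \<kappa> U" if \<kappa>: "prob_space \<kappa>" "sets \<kappa> = sets borel" for \<kappa>
  proof -
    interpret prob_space \<kappa> by (rule \<kappa>)
    have m: "U \<in> sets \<kappa>" "borel_measurable \<kappa> = (borel_measurable borel :: ('m \<Rightarrow> real) set)"
      using U \<kappa>(2) by (auto intro: measurable_cong_sets)
    have "(\<lambda>n. \<integral>x. h n x \<partial>\<kappa>) \<longlonglongrightarrow> (\<integral>x. indicator U x \<partial>\<kappa>)"
    proof (rule integral_dominated_convergence[where w = "\<lambda>_. 1"])
      show "(indicator U :: 'm \<Rightarrow> real) \<in> borel_measurable \<kappa>" using m(1) by simp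
      show "h n \<in> borel_measurable \<kappa>" for n
        unfolding m(2) by (rule borel_measurable_continuous_onI[OF h(1)])
    qed (use h in auto)
    then show ?thesis using m(1) sets.sets_into_space[OF m(1)] by (simp add: Int_absorb2)
  qed
  have "(\<integral>x. h n x \<partial>\<mu>) = (\<integral>x. h n x \<partial>\<nu>)" for n
    by (rule eq[OF h(1)]) (use h(2) in \<open>auto intro!: boundedI[of _ 1]\<close>)
  then have "measure \<mu> U = measure \<nu> U"
    using LIMSEQ_unique lim[OF \<mu>.prob_space_axioms s(1)] lim[OF \<nu>.prob_space_axioms s(2)] by simp
  then show "emeasure \<mu> U = emeasure \<nu> U"
    by (simp add: \<mu>.emeasure_eq_measure \<nu>.emeasure_eq_measure)
next
  show "emeasure \<mu> UNIV \<noteq> \<infinity>"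
  proof -
    interpret \<mu>: prob_space \<mu> using \<mu> by (simp add: borel_probs_def)
    show ?thesis using \<mu>.emeasure_finite[of UNIV] by simp
  qed
qed (auto simp: Int_stable_def)

end

section \<open>Weakly continuous flows of probability measures\<close>

locale weak_flow =
  fixes \<mu> :: "real \<Rightarrow> 'm::{second_countable_topology, t2_space} measure" and T :: real
  assumes weak: "continuous_map (top_of_set {0..T}) weak_topology \<mu>" and T: "T > 0"
begin

text \<open>The carrier of \<open>weak_topology\<close> is the union of its generating sets, all of
  which lie in \<open>borel_probs\<close>.\<close>

lemma in_borel_probs:
  assumes "t \<in> {0..T}"
  shows "\<mu> t \<in> borel_probs"
proof -
  have "\<mu> t \<in> topspace weak_topology"
    using weak assms by (auto simp: continuous_map_def)
  then show ?thesis unfolding weak_topology_def topology_generated_by_topspace by auto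
qed

lemma
  assumes "t \<in> {0..T}"
  shows prob: "prob_space (\<mu> t)" and sets_eq: "sets (\<mu> t) = sets borel"
  using in_borel_probs[OF assms] by (auto simp: borel_probs_def)

lemma integral_continuous:
  fixes f :: "'m \<Rightarrow> real"
  assumes "continuous_on UNIV f" "bounded (range f)"
  shows "continuous_on {0..T} (\<lambda>t. \<integral>x. f x \<partial>\<mu> t)"
proof -
  have "openin (top_of_set {0..T}) ({0..T} \<inter> (\<lambda>t. \<integral>x. f x \<partial>\<mu> t) -` U)" if "open U" for U :: "real set"
  proof -
    let ?S = "{\<mu> \<in> borel_probs. (\<integral>x. f x \<partial>\<mu>) \<in> U}"
    have "openin weak_topology ?S"
      unfolding weak_topology_def by (rule topology_generated_by_Basis) (use assms that in blast)
    then have "openin (top_of_set {0..T}) {t \<in> topspace (top_of_set {0..T}). \<mu> t \<in> ?S}"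
      using weak unfolding continuous_map_def by blast
    moreover have "{t \<in> topspace (top_of_set {0..T}). \<mu> t \<in> ?S} = {0..T} \<inter> (\<lambda>t. \<integral>x. f x \<partial>\<mu> t) -` U"
      using in_borel_probs by auto
    ultimately show ?thesis by simp
  qed
  then show ?thesis by (simp add: continuous_on_open_gen[of _ _ UNIV] continuous_openin_preimage_eq)
qed

lemma integrable_slice:
  fixes f :: "'m \<Rightarrow> real"
  assumes "continuous_on UNIV f" "\<And>x. \<bar>f x\<bar> \<le> K" "t \<in> {0..T}"
  shows "integrable (\<mu> t) f"
proof -
  interpret prob_space "\<mu> t" by (rule prob[OF assms(3)])
  have "f \<in> borel_measurable (\<mu> t)"
    using borel_measurable_continuous_onI[OF assms(1)] measurable_cong_sets[OF sets_eq[OF assms(3)] refl] by blast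
  then show ?thesis using assms(2) by (intro integrable_const_bound[of _ K]) auto
qed

text \<open>
  Measurability in time: freezing the time argument of \<open>u\<close> on short intervals makes the integral weakly
  continuous on each of them.
\<close>

lemma flow_integrable:
  fixes u :: "real \<Rightarrow> 'm \<Rightarrow> real"
  assumes u: "continuous_on ({0..T} \<times> UNIV) (\<lambda>(t, x). u t x)" and K: "\<And>t x. t \<in> {0..T} \<Longrightarrow> \<bar>u t x\<bar> \<le> K"
  shows "set_integrable lborel {0..T} (\<lambda>t. \<integral>x. u t x \<partial>\<mu> t)"
proof -
  note slice = continuous_on_slice[OF u]
  \<comment> \<open>Rounding down to the grid of mesh \<open>1 / Suc n\<close>; rounding downwards
    keeps nonnegative times nonnegative, hence inside the interval.\<close>
  define r where "r = (\<lambda>(n::nat) t. real_of_int \<lfloor>t * real (Suc n)\<rfloor> / real (Suc n))"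
  have r_le: "r n t \<le> t" "t - 1 / real (Suc n) \<le> r n t" for n t
  proof -
    have "real_of_int \<lfloor>t * real (Suc n)\<rfloor> \<le> t * real (Suc n)" by simp
    then show "r n t \<le> t" by (simp add: r_def divide_le_eq)
    have "t * real (Suc n) - 1 \<le> real_of_int \<lfloor>t * real (Suc n)\<rfloor>" by linarith
    then have "(t * real (Suc n) - 1) / real (Suc n) \<le> r n t"
      unfolding r_def by (intro divide_right_mono) auto
    then show "t - 1 / real (Suc n) \<le> r n t" by (simp add: diff_divide_distrib)
  qed
  have r_in: "r n t \<in> {0..T}" if "t \<in> {0..T}" for n t
    using that r_le(1)[of n t] by (auto simp: r_def)
  have r_lim: "(\<lambda>n. r n t) \<longlonglongrightarrow> t" for t
  proof (rule tendsto_sandwich[of "\<lambda>n. t - 1 / real (Suc n)"])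
    have "(\<lambda>n. 1 / real (Suc n)) \<longlonglongrightarrow> 0"
      using LIMSEQ_inverse_real_of_nat by (simp add: inverse_eq_divide)
    from tendsto_diff[OF tendsto_const this] show "(\<lambda>n. t - 1 / real (Suc n)) \<longlonglongrightarrow> t" by simp
  qed (use r_le in auto)
  define S where "S = (\<lambda>n t. indicator {0..T} t *\<^sub>R (\<integral>x. u (r n t) x \<partial>\<mu> t))"
  have meas: "S n \<in> borel_measurable borel" for n
  proof -
    \<comment> \<open>Grid points clamped to the interval, so that weak continuity applies for every
      integer index. For \<open>t\<close> in the interval the clamp leaves the grid point below
      \<open>t\<close> unchanged.\<close>
    define p where "p = (\<lambda>i::int. max 0 (min T (real_of_int i / real (Suc n))))"
    define f where "f = (\<lambda>i t. indicator {0..T} t *\<^sub>R (\<integral>x. u (p i) x \<partial>\<mu> t))"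
    have pT: "p i \<in> {0..T}" for i using T by (auto simp: p_def)
    have fm: "f i \<in> borel_measurable borel" for i
      unfolding f_def
    proof (intro borel_measurable_continuous_on_indicator integral_continuous slice pT)
      show "bounded (range (u (p i)))" using K[OF pT] by (intro boundedI[of _ K]) auto
    qed simp
    have "(\<lambda>t. f \<lfloor>t * real (Suc n)\<rfloor> t) \<in> borel_measurable borel"
      by (rule measurable_compose_countable[OF fm]) measurable
    moreover have "(\<lambda>t. f \<lfloor>t * real (Suc n)\<rfloor> t) = S n"
    proof
      show "f \<lfloor>t * real (Suc n)\<rfloor> t = S n t" for t
      proof (cases "t \<in> {0..T}")
        case True
        then have "p \<lfloor>t * real (Suc n)\<rfloor> = r n t" using r_in[OF True, of n] by (simp add: p_def r_def)
        then show ?thesis by (simp add: f_def S_def)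
      qed (simp add: f_def S_def)
    qed
    ultimately show ?thesis by simp
  qed
  have lim: "(\<lambda>n. S n t) \<longlonglongrightarrow> indicator {0..T} t *\<^sub>R (\<integral>x. u t x \<partial>\<mu> t)" for t
  proof (cases "t \<in> {0..T}")
    case True
    interpret prob_space "\<mu> t" by (rule prob[OF True])
    have m: "u s \<in> borel_measurable (\<mu> t)" if "s \<in> {0..T}" for s
      using borel_measurable_continuous_onI[OF slice[OF that]] measurable_cong_sets[OF sets_eq[OF True] refl] by blast
    have "(\<lambda>n. \<integral>x. u (r n t) x \<partial>\<mu> t) \<longlonglongrightarrow> (\<integral>x. u t x \<partial>\<mu> t)"
    proof (rule integral_dominated_convergence[where w = "\<lambda>_. K"])
      show "AE x in \<mu> t. (\<lambda>n. u (r n t) x) \<longlonglongrightarrow> u t x"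
      proof (rule AE_I2)
        fix x :: 'm
        have "continuous_on {0..T} (\<lambda>s. (s, x))" by (intro continuous_intros)
        from continuous_on_compose2[OF u this] have "continuous_on {0..T} (\<lambda>s. u s x)" by auto
        from continuous_on_tendsto_compose[OF this r_lim True]
        show "(\<lambda>n. u (r n t) x) \<longlonglongrightarrow> u t x" using r_in[OF True] by auto
      qed
      show "AE x in \<mu> t. norm (u (r n t) x) \<le> K" for n using K[OF r_in[OF True]] by simp
    qed (use m True r_in in auto)
    then show ?thesis using True by (simp add: S_def)
  qed (simp add: S_def)
  have "(\<lambda>t. indicator {0..T} t *\<^sub>R (\<integral>x. u t x \<partial>\<mu> t)) \<in> borel_measurable lborel"
    using borel_measurable_LIMSEQ_real[of borel S, OF lim meas] by simp
  moreover have "norm (\<integral>x. u t x \<partial>\<mu> t) \<le> K" if "t \<in> {0..T}" for t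
  proof -
    interpret prob_space "\<mu> t" by (rule prob[OF that])
    have "norm (\<integral>x. u t x \<partial>\<mu> t) \<le> (\<integral>x. norm (u t x) \<partial>\<mu> t)" by (rule integral_norm_bound)
    also have "\<dots> \<le> (\<integral>x. K \<partial>\<mu> t)"
      using integrable_slice[OF slice[OF that] K[OF that] that] K[OF that] by (intro integral_mono) auto
    finally have "norm (\<integral>x. u t x \<partial>\<mu> t) \<le> (\<integral>x. K \<partial>\<mu> t)" .
    then show ?thesis by (simp add: prob_space)
  qed
  moreover have "integrable lborel (\<lambda>t. indicator {0..T} t *\<^sub>R K)"
    using T by (intro integrable_scaleR_left) (auto intro!: integrable_real_indicator)
  ultimately show ?thesis
    unfolding set_integrable_def
    by (elim Bochner_Integration.integrable_bound) (auto intro!: AE_I2 simp: indicator_def intro: order_trans[OF _ abs_ge_self])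
qed

end

text \<open>The sublevel set is closed and contains almost every point of the open interval, hence
  all of it and its closure. Bounds for almost every time become bounds for every time, end points
  included.\<close>

lemma AE_Icc_le:
  fixes h :: "real \<Rightarrow> real"
  assumes "T > 0" "continuous_on {0..T} h" "AE t in lborel. t \<in> {0<..<T} \<longrightarrow> h t \<le> K" "t \<in> {0..T}"
  shows "h t \<le> K"
proof -
  let ?C = "{0..T} \<inter> h -` {..K}"
  have C: "closed ?C" by (rule continuous_closed_preimage[OF assms(2)]) auto
  have ae: "AE t\<in>{0<..<T} in lebesgue. t \<in> ?C"
    using AE_completion[OF assms(3)] by (rule AE_mp) (auto intro!: AE_I2)
  have "{0<..<T} \<subseteq> ?C"
    using mem_closed_if_AE_lebesgue_open[OF open_greaterThanLessThan C ae] by blast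
  then have "closure {0<..<T} \<subseteq> ?C" using C by (rule closure_minimal)
  then show ?thesis using assms(1,4) by auto
qed

section \<open>Bounds on compact sets\<close>

lemma continuous_on_compact_bound:
  fixes f :: "'a::topological_space \<Rightarrow> real"
  assumes "compact S" "continuous_on S f"
  obtains K where "K \<ge> 0" "\<And>x. x \<in> S \<Longrightarrow> \<bar>f x\<bar> \<le> K"
proof -
  have "bounded (f ` S)" by (intro compact_imp_bounded compact_continuous_image assms)
  then obtain K where "\<And>x. x \<in> S \<Longrightarrow> norm (f x) \<le> K" unfolding bounded_iff by auto
  then show ?thesis using that[of "max 0 K"] by (force simp: le_max_iff_disj)
qed

lemma compact_matrix_bound:
  fixes P :: "'a::topological_space \<Rightarrow> real^'n^'n::finite"
  assumes "compact S" "\<And>i j. continuous_on S (\<lambda>y. P y $ i $ j)"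
  obtains K where "K \<ge> 0" "\<And>y w. y \<in> S \<Longrightarrow> norm (P y *v w) \<le> K * norm w"
proof -
  have "continuous_on S (\<lambda>y. \<Sum>i\<in>UNIV. \<Sum>j\<in>UNIV. \<bar>P y $ i $ j\<bar>)"
    by (intro continuous_intros assms)
  then obtain K where K: "K \<ge> 0" "\<And>y. y \<in> S \<Longrightarrow> \<bar>\<Sum>i\<in>UNIV. \<Sum>j\<in>UNIV. \<bar>P y $ i $ j\<bar>\<bar> \<le> K"
    using continuous_on_compact_bound[OF assms(1)] by blast
  have "norm (P y *v w) \<le> K * norm w" if "y \<in> S" for y w
  proof -
    have "norm (P y *v w) \<le> (\<Sum>i\<in>UNIV. \<bar>(P y *v w) $ i\<bar>)" by (rule norm_le_l1_cart)
    also have "\<dots> \<le> (\<Sum>i\<in>UNIV. \<Sum>j\<in>UNIV. \<bar>P y $ i $ j\<bar> * norm w)"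
    proof (rule sum_mono)
      fix i
      have "\<bar>(P y *v w) $ i\<bar> \<le> (\<Sum>j\<in>UNIV. \<bar>P y $ i $ j * w $ j\<bar>)"
        by (simp add: matrix_vector_mult_def sum_abs)
      also have "\<dots> \<le> (\<Sum>j\<in>UNIV. \<bar>P y $ i $ j\<bar> * norm w)"
        by (intro sum_mono) (simp add: abs_mult mult_left_mono component_le_norm_cart)
      finally show "\<bar>(P y *v w) $ i\<bar> \<le> (\<Sum>j\<in>UNIV. \<bar>P y $ i $ j\<bar> * norm w)" .
    qed
    also have "\<dots> = (\<Sum>i\<in>UNIV. \<Sum>j\<in>UNIV. \<bar>P y $ i $ j\<bar>) * norm w"
      by (simp add: sum_distrib_right)
    also have "\<dots> \<le> K * norm w" using K(2)[OF that] by (intro mult_right_mono) auto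
    finally show ?thesis .
  qed
  with K(1) show ?thesis by (rule that)
qed

text \<open>Uniform ellipticity: the quadratic form attains a positive minimum over \<open>S\<close>
  times the unit sphere, and homogeneity extends the bound to all vectors.\<close>

lemma compact_matrix_pos:
  fixes P :: "'a::t2_space \<Rightarrow> real^'n^'n::finite"
  assumes "compact S" "\<And>i j. continuous_on S (\<lambda>y. P y $ i $ j)"
    and pos: "\<And>y w. y \<in> S \<Longrightarrow> w \<noteq> 0 \<Longrightarrow> w \<bullet> (P y *v w) > 0"
  obtains l where "l > 0" "\<And>y w. y \<in> S \<Longrightarrow> l * (norm w)\<^sup>2 \<le> w \<bullet> (P y *v w)"
proof (cases "S = {}")
  case True
  then show ?thesis using that[of 1] by auto
next
  case False
  define f where "f = (\<lambda>(y, w). w \<bullet> (P y *v w))"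
  let ?C = "S \<times> sphere (0 :: real^'n) 1"
  have "compact ?C" by (intro compact_Times assms(1)) simp
  moreover have "?C \<noteq> {}"
  proof -
    have "axis undefined 1 \<in> sphere (0 :: real^'n) 1" by simp
    then show ?thesis using False by blast
  qed
  moreover have "continuous_on ?C f"
  proof -
    have P: "continuous_on ?C (\<lambda>p. P (fst p) $ i $ j)" for i j
      by (rule continuous_on_compose2[OF assms(2)]) (auto intro!: continuous_intros)
    have "continuous_on ?C (\<lambda>p. snd p $ i)" for i
      by (intro continuous_intros)
    then show ?thesis
      unfolding f_def case_prod_beta inner_matrix_vector_sum
      by (intro continuous_on_sum continuous_on_mult P)
  qed
  ultimately have "\<exists>p\<in>?C. \<forall>q\<in>?C. f p \<le> f q"
    by (rule continuous_attains_inf)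
  then obtain p where p: "p \<in> ?C" "\<And>q. q \<in> ?C \<Longrightarrow> f p \<le> f q"
    by blast
  have "snd p \<noteq> 0" using p(1) by auto
  then have fp: "f p > 0" using pos[of "fst p" "snd p"] p(1) by (auto simp: f_def case_prod_beta)
  have "f p * (norm w)\<^sup>2 \<le> w \<bullet> (P y *v w)" if y: "y \<in> S" for y w
  proof (cases "w = 0")
    case False
    then have "f p \<le> f (y, (1 / norm w) *\<^sub>R w)" by (intro p(2)) (use y in auto)
    also have "\<dots> = (w \<bullet> (P y *v w)) / (norm w)\<^sup>2"
      by (simp add: f_def matrix_vector_mult_scaleR power2_eq_square)
    finally show ?thesis using False by (simp add: pos_le_divide_eq)
  qed simp
  with fp show ?thesis by (rule that)
qed

text \<open>The exponent is at least two, whence \<open>Suc (Suc n)\<close>: at 0 the difference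
  quotient is the next lower power of the positive part and still tends to 0.\<close>

lemma DERIV_max_0_power:
  "((\<lambda>u::real. max 0 u ^ Suc (Suc n)) has_real_derivative real (Suc (Suc n)) * max 0 u ^ Suc n) (at u)"
proof -
  consider "u > 0" | "u < 0" | "u = 0" by linarith
  then show ?thesis
  proof cases
    case 1
    have "((\<lambda>u::real. u ^ Suc (Suc n)) has_real_derivative real (Suc (Suc n)) * u ^ Suc n) (at u)"
      using DERIV_pow[of "Suc (Suc n)" u UNIV] by simp
    then have "((\<lambda>u::real. u ^ Suc (Suc n)) has_real_derivative real (Suc (Suc n)) * max 0 u ^ Suc n) (at u)"
      using 1 by simp
    then show ?thesis
      by (rule has_field_derivative_transform_within_open[of _ _ _ "{0<..}"]) (use 1 in auto)
  next
    case 2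
    have "((\<lambda>u::real. 0) has_real_derivative real (Suc (Suc n)) * max 0 u ^ Suc n) (at u)"
      using 2 by simp
    then show ?thesis
      by (rule has_field_derivative_transform_within_open[of _ _ _ "{..<0}"]) (use 2 in auto)
  next
    case 3
    have "((\<lambda>h::real. max 0 h ^ Suc n) \<longlongrightarrow> max 0 0 ^ Suc n) (at 0)"
      by (intro tendsto_intros)
    then have "((\<lambda>h::real. max 0 h ^ Suc n) \<longlongrightarrow> 0) (at 0)" by simp
    then have "((\<lambda>h::real. (max 0 h ^ Suc (Suc n)) / h) \<longlongrightarrow> 0) (at 0)"
    proof (rule Lim_transform_eventually)
      show "\<forall>\<^sub>F h in at 0. max 0 h ^ Suc n = (max 0 h ^ Suc (Suc n)) / (h::real)"
        by (auto simp: eventually_at_filter max_def)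
    qed
    then show ?thesis using 3 by (simp add: DERIV_def)
  qed
qed

context riemannian
begin

section \<open>Compactly supported test functions\<close>

lemma grad_zero:
  assumes f: "Ctm 2 I f" "t \<in> I" and V: "open V" "x \<in> V" "\<And>x. x \<in> V \<Longrightarrow> f t x = 0"
  shows "grad A g (f t) x = (\<lambda>c. 0)"
proof -
  obtain c where c: "c \<in> charts_at A x" by (rule ex_chart)
  note cA = charts_atD[OF c] and md = Ctm2_mdiff[OF f, of x]
  let ?W = "chart_image c \<inter> chart_inv c -` V"
  have W: "open ?W" "snd c x \<in> ?W"
    using continuous_open_preimage[OF continuous_chart_inv open_chart_image, of c V] cA V by auto
  have "partial j (loc c (f t)) (snd c x) = partial j (\<lambda>y. 0) (snd c x)" for j
    by (rule partial_cong_open[OF W]) (use V in auto)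
  then have "pvec c (f t) (snd c x) = 0"
    by (simp add: pvec_def vec_eq_iff partial_def)
  then have "grad A g (f t) x c = 0" using grad_coords[OF md c] by simp
  then show ?thesis
    using TS_eqI[OF grad_in[OF md] TS_lincomb[OF grad_in[OF md] grad_in[OF md], of 0 0] c] by simp
qed

lemma cov_deriv_zero:
  assumes X: "diff_field X" and V: "open V" "x \<in> V" "\<And>x. x \<in> V \<Longrightarrow> X x = (\<lambda>c. 0)" and p: "p \<in> TS x"
  shows "cov_deriv A g X x p = (\<lambda>c. 0)"
proof -
  obtain c where c: "c \<in> charts_at A x" by (rule ex_chart)
  note cA = charts_atD[OF c] and cin = cov_deriv_in[OF X p]
  let ?W = "chart_image c \<inter> chart_inv c -` V"
  have W: "open ?W" "snd c x \<in> ?W"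
    using continuous_open_preimage[OF continuous_chart_inv open_chart_image, of c V] cA V by auto
  have "frechet_derivative (\<lambda>y. X (chart_inv c y) c) (at (snd c x)) = frechet_derivative (\<lambda>y. 0) (at (snd c x))"
    by (rule frechet_derivative_cong_open(1)[OF W]) (use V in auto)
  then have "cov_deriv A g X x p c = 0"
    using cov_deriv_coords[OF X c, of p] V(3)[OF V(2)] linear_0[OF linear_gam(2)] by simp
  then show ?thesis
    using TS_eqI[OF cin TS_lincomb[OF cin cin, of 0 0] c] by simp
qed

lemma tnorm_zero: "tnorm g x (\<lambda>c. 0) = 0"
proof -
  obtain c where c: "c \<in> charts_at A x" by (rule ex_chart)
  have "(\<lambda>c. 0) \<in> TS x" using TS_lincomb[OF tv_in[OF c, of 0] tv_in[OF c, of 0], of 0 0] by simp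
  from metric_lincomb[OF this this this, of 0 0] show ?thesis by (simp add: tnorm_def)
qed

lemma tnorm_coords:
  assumes "p \<in> TS x" "c \<in> charts_at A x"
  shows "tnorm g x p = sqrt (p c \<bullet> (mm c (snd c x) *v p c))"
  using metric_coords[OF assms(1,1,2)] by (simp add: tnorm_def)

text \<open>Over a compact part of one chart the covariant Hessian is a continuous matrix function,
  and the metric norm is comparable with the Euclidean one from both sides.\<close>

lemma cov_deriv_compact_bound:
  assumes f: "Ctm 2 I f" and c: "c \<in> A" and S: "compact S" "S \<subseteq> chart_image c" and I: "compact I"
  obtains K where "K \<ge> 0" "\<And>t y p. t \<in> I \<Longrightarrow> y \<in> S \<Longrightarrow> p \<in> TS (chart_inv c y) \<Longrightarrow>
    tnorm g (chart_inv c y) (cov_deriv A g (grad A g (f t)) (chart_inv c y) p) \<le> K * tnorm g (chart_inv c y) p"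
proof -
  let ?X = "\<lambda>t y. grad A g (f t) (chart_inv c y) c"
  define M where "M = (\<lambda>(t, y). \<chi> k i. partial i (\<lambda>z. ?X t z $ k) y +
    (\<Sum>j\<in>UNIV. christoffel A g c y k i j * ?X t y $ j))"
  have M: "cov_deriv A g (grad A g (f t)) (chart_inv c y) (tv c (chart_inv c y) w) c = M (t, y) *v w"
    if "t \<in> I" "y \<in> S" for t y w
    using cov_deriv_loc[OF grad_diff_field[OF f that(1)] c, of y w] that(2) S(2)
    by (auto simp: M_def vec_eq_iff matrix_vector_mult_def sum.distrib sum_distrib_left algebra_simps)
  have Mc: "continuous_on (I \<times> S) (\<lambda>p. M p $ k $ i)" for k i
  proof -
    have "Ctk_on 0 I (chart_image c) (\<lambda>t y. partial i (\<lambda>z. ?X t z $ k) y +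
        (\<Sum>j\<in>UNIV. christoffel A g c y k i j * ?X t y $ j))"
      by (intro Ctk_on_add Ctk_on_sum Ctk_on_mult open_chart_image[OF c] christoffel_Ctk[OF c]
          Ctk_on_partial grad_Ctk[OF f c] Ctk_on_SucD[OF grad_Ctk[OF f c]])
    then show ?thesis
      unfolding M_def using S(2) by (auto simp: case_prod_beta elim!: continuous_on_subset)
  qed
  obtain K1 where K1: "K1 \<ge> 0" "\<And>p w. p \<in> I \<times> S \<Longrightarrow> norm (M p *v w) \<le> K1 * norm w"
    using compact_matrix_bound[OF compact_Times[OF I S(1)] Mc] by blast
  have mc: "continuous_on S (\<lambda>y. mm c y $ i $ j)" for i j
  proof -
    have "Ck_on 0 (chart_image c) (\<lambda>y. mm c y $ i $ j)"
      by (rule Ck_on_of_Ctk_on[OF mm_Ctk[OF c, of 0 UNIV]]) simp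
    then show ?thesis using continuous_on_subset[OF _ S(2)] by simp
  qed
  obtain K2 where K2: "K2 \<ge> 0" "\<And>y w. y \<in> S \<Longrightarrow> norm (mm c y *v w) \<le> K2 * norm w"
    using compact_matrix_bound[OF S(1) mc] by blast
  have mpos: "w \<bullet> (mm c y *v w) > 0" if "y \<in> S" "w \<noteq> 0" for y w
    using mm_pos[OF c _ that(2)] that(1) S(2) by blast
  obtain l where l: "l > 0" "\<And>y w. y \<in> S \<Longrightarrow> l * (norm w)\<^sup>2 \<le> w \<bullet> (mm c y *v w)"
    using compact_matrix_pos[OF S(1) mc mpos] by blast
  show ?thesis
  \<comment> \<open>\<open>K1\<close> bounds the matrix in the Euclidean norm, \<open>K2\<close>
    bounds the metric from above and \<open>l\<close> from below; the constant results from passing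
    from the metric norm to the Euclidean one and back.\<close>
  proof (rule that[of "sqrt (K2 * K1\<^sup>2 / l)"])
    fix t y p assume t: "t \<in> I" and y: "y \<in> S" and p: "p \<in> TS (chart_inv c y)"
    let ?x = "chart_inv c y"
    have yc: "y \<in> chart_image c" using y S(2) by auto
    have cx: "c \<in> charts_at A ?x" by (rule charts_atI[OF c yc])
    define q where "q = cov_deriv A g (grad A g (f t)) ?x p"
    have q: "q \<in> TS ?x" "q c = M (t, y) *v p c"
      using cov_deriv_in[OF grad_diff_field[OF f t] p] M[OF t y, of "p c"] tv_eq[OF p cx] by (auto simp: q_def)
    have "q c \<bullet> (mm c y *v q c) \<le> norm (q c) * norm (mm c y *v q c)"
      by (rule norm_cauchy_schwarz)
    also have "\<dots> \<le> norm (q c) * (K2 * norm (q c))" by (intro mult_left_mono K2 y) simp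
    also have "\<dots> = K2 * (norm (q c))\<^sup>2" by (simp add: power2_eq_square)
    also have "\<dots> \<le> K2 * (K1 * norm (p c))\<^sup>2"
      using K1(2)[of "(t, y)" "p c"] t y q(2) by (intro mult_left_mono power_mono K2) auto
    also have "\<dots> = K2 * K1\<^sup>2 / l * (l * (norm (p c))\<^sup>2)" using l(1) by (simp add: power_mult_distrib)
    also have "\<dots> \<le> K2 * K1\<^sup>2 / l * (p c \<bullet> (mm c y *v p c))"
      using l(1) K2(1) by (intro mult_left_mono l(2) y) auto
    finally have "sqrt (q c \<bullet> (mm c y *v q c)) \<le> sqrt (K2 * K1\<^sup>2 / l * (p c \<bullet> (mm c y *v p c)))"
      by (rule real_sqrt_le_mono)
    then show "tnorm g ?x (cov_deriv A g (grad A g (f t)) ?x p) \<le> sqrt (K2 * K1\<^sup>2 / l) * tnorm g ?x p"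
      using tnorm_coords[OF q(1) cx] tnorm_coords[OF p cx]
      by (simp only: chart_inv_right[OF c yc] q_def real_sqrt_mult)
  qed (use K2(1) l(1) in auto)
qed

lemma ext_zero_outside:
  assumes "c \<in> A" "\<And>y. y \<notin> cball z R \<Longrightarrow> F t y = 0" "x \<notin> chart_inv c ` cball z R"
  shows "ext c F t x = 0"
proof (cases "x \<in> fst c")
  case True
  then have "snd c x \<notin> cball z R" using assms(3) chart_inv_left[OF assms(1) True] by force
  with assms(2) show ?thesis by (simp add: ext_def)
qed (simp add: ext_def)

text \<open>Over \<open>{0..T}\<close> times the closed ball all bounds follow from compactness; off
  the image of the ball every quantity vanishes by locality.\<close>

lemma ext_C12b:
  assumes T: "T > 0" and c: "c \<in> A" "cball z R \<subseteq> chart_image c"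
    and F: "Ctk_on 2 {0..T} UNIV F" "\<And>t y. t \<in> {0..T} \<Longrightarrow> y \<notin> cball z R \<Longrightarrow> F t y = 0"
    and Ft: "\<And>t y. t \<in> {0..T} \<Longrightarrow> ((\<lambda>s. F s y) has_vector_derivative Ft t y) (at t within {0..T})"
      "continuous_on ({0..T} \<times> UNIV) (\<lambda>(t, y). Ft t y)"
      "\<And>t y. t \<in> {0..T} \<Longrightarrow> y \<notin> cball z R \<Longrightarrow> Ft t y = 0"
  shows "ext c F \<in> C12b A g T"
    and "\<And>t x. t \<in> {0..T} \<Longrightarrow> time_deriv T (ext c F) t x = ext c Ft t x"
proof -
  let ?I = "{0..T}" and ?K = "chart_inv c ` cball z R"
  have C: "Ctm 2 ?I (ext c F)" by (rule ext_Ctm[OF c F])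
  have D: "((\<lambda>s. ext c F s x) has_vector_derivative ext c Ft t x) (at t within ?I)" if "t \<in> ?I" for t x
    using Ft(1)[OF that, of "snd c x"] by (cases "x \<in> fst c") (auto simp: ext_def)
  show td: "time_deriv T (ext c F) t x = ext c Ft t x" if "t \<in> ?I" for t x
    by (rule time_derivI[OF T that]) (rule D[OF that])
  have cont_Ft: "continuous_on (?I \<times> UNIV) (\<lambda>(t, x). ext c Ft t x)"
    by (rule ext_continuous[OF c Ft(2,3)])
  have op: "open (- ?K)" using closed_chart_ball[OF c] by blast
  have K: "compact (?I \<times> cball z R)" by (intro compact_Times) auto
  obtain K1 where K1: "K1 \<ge> 0" "\<And>p. p \<in> ?I \<times> cball z R \<Longrightarrow> \<bar>(\<lambda>(t, y). F t y) p\<bar> \<le> K1"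
    using continuous_on_compact_bound[OF K continuous_on_subset[OF Ctk_on_continuous[OF F(1)]]] by auto
  obtain K2 where K2: "K2 \<ge> 0" "\<And>p. p \<in> ?I \<times> cball z R \<Longrightarrow> \<bar>(\<lambda>(t, y). Ft t y) p\<bar> \<le> K2"
    using continuous_on_compact_bound[OF K continuous_on_subset[OF Ft(2)]] by auto
  let ?G = "\<lambda>(t, y). tnorm g (chart_inv c y) (grad A g (ext c F t) (chart_inv c y))"
  have "continuous_on (?I \<times> cball z R) ?G"
  proof (rule continuous_on_eq)
    let ?X = "\<lambda>t y. grad A g (ext c F t) (chart_inv c y) c"
    let ?H = "\<lambda>t y. \<Sum>i\<in>UNIV. \<Sum>j\<in>UNIV. ?X t y $ i * ?X t y $ j * mm c y $ i $ j"
    have "Ctk_on 0 ?I (chart_image c) ?H"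
      by (intro Ctk_on_sum Ctk_on_mult open_chart_image[OF c(1)] mm_Ctk[OF c(1)]
          Ctk_on_SucD[OF grad_Ctk[OF C c(1)]])
    then have "continuous_on (?I \<times> cball z R) (\<lambda>(t, y). ?H t y)"
      using c(2) by (auto elim!: continuous_on_subset)
    then show "continuous_on (?I \<times> cball z R) (\<lambda>p. sqrt ((\<lambda>(t, y). ?H t y) p))"
      by (rule continuous_on_real_sqrt)
    fix p assume "p \<in> ?I \<times> cball z R"
    then obtain t y where p: "p = (t, y)" "t \<in> ?I" "y \<in> chart_image c" using c(2) by auto
    show "sqrt ((\<lambda>(t, y). ?H t y) p) = ?G p"
      using tnorm_coords[OF grad_in[OF Ctm2_mdiff[OF C p(2)]] charts_atI[OF c(1) p(3)]] chart_inv_right[OF c(1) p(3)]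
      by (simp add: p(1) inner_matrix_vector_sum)
  qed
  then obtain K3 where K3: "K3 \<ge> 0" "\<And>p. p \<in> ?I \<times> cball z R \<Longrightarrow> \<bar>?G p\<bar> \<le> K3"
    using continuous_on_compact_bound[OF K] by blast
  obtain K4 where K4: "K4 \<ge> 0" "\<And>t y p. t \<in> ?I \<Longrightarrow> y \<in> cball z R \<Longrightarrow> p \<in> TS (chart_inv c y) \<Longrightarrow>
      tnorm g (chart_inv c y) (cov_deriv A g (grad A g (ext c F t)) (chart_inv c y) p) \<le> K4 * tnorm g (chart_inv c y) p"
    by (rule cov_deriv_compact_bound[OF C c(1) compact_cball c(2) compact_Icc]) (rule that)
  define L where "L = K1 + K2 + K3 + K4"
  have "C12_bound T (ext c F) L"
    unfolding C12_bound_def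
  proof (intro ballI allI)
    fix t x assume t: "t \<in> ?I"
    show "\<bar>ext c F t x\<bar> \<le> L \<and> \<bar>time_deriv T (ext c F) t x\<bar> \<le> L \<and> tnorm g x (grad A g (ext c F t) x) \<le> L \<and>
        (\<forall>p\<in>TS x. tnorm g x (cov_deriv A g (grad A g (ext c F t)) x p) \<le> L * tnorm g x p)"
    proof (cases "x \<in> ?K")
      case True
      then obtain y where y: "y \<in> cball z R" "x = chart_inv c y" by blast
      have yc: "y \<in> chart_image c" using y c(2) by auto
      have "tnorm g x (cov_deriv A g (grad A g (ext c F t)) x p) \<le> L * tnorm g x p" if p: "p \<in> TS x" for p
      proof -
        have "tnorm g x (cov_deriv A g (grad A g (ext c F t)) x p) \<le> K4 * tnorm g x p"
          using K4(2)[OF t y(1)] p unfolding y(2) by blast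
        also have "K4 * tnorm g x p \<le> L * tnorm g x p"
          using K1(1) K2(1) K3(1) by (intro mult_right_mono tnorm_nonneg p) (simp add: L_def)
        finally show ?thesis .
      qed
      moreover have "\<bar>ext c F t x\<bar> \<le> L"
        using K1(2)[of "(t, y)"] t y(1) K2(1) K3(1) K4(1) by (simp add: y(2) ext_loc[OF c(1) yc] L_def)
      moreover have "\<bar>time_deriv T (ext c F) t x\<bar> \<le> L"
        using K2(2)[of "(t, y)"] t y(1) K1(1) K3(1) K4(1) by (simp add: td[OF t] y(2) ext_loc[OF c(1) yc] L_def)
      moreover have "tnorm g x (grad A g (ext c F t) x) \<le> L"
        using K3(2)[of "(t, y)"] t y(1) K1(1) K2(1) K4(1) by (simp add: y(2) L_def)
      ultimately show ?thesis by blast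
    next
      case False
      have z: "ext c F t x = 0" if "x \<in> - ?K" for x
        by (rule ext_zero_outside[where z = z and R = R]) (use c(1) F(2)[OF t] that in auto)
      have zt: "ext c Ft t x = 0"
        by (rule ext_zero_outside[where z = z and R = R]) (use c(1) Ft(3)[OF t] False in auto)
      have gz: "grad A g (ext c F t) x = (\<lambda>c. 0)" if "x \<in> - ?K" for x
        using grad_zero[OF C t op that z] .
      have cz: "cov_deriv A g (grad A g (ext c F t)) x p = (\<lambda>c. 0)" if "p \<in> TS x" for p
        by (rule cov_deriv_zero[OF grad_diff_field[OF C t] op _ gz that]) (use False in auto)
      have "L \<ge> 0" using K1(1) K2(1) K3(1) K4(1) by (simp add: L_def)
      then show ?thesis
        using False z[of x] gz[of x]
        by (simp add: td[OF t] zt tnorm_zero cz tnorm_nonneg)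
    qed
  qed
  moreover have "continuous_on (?I \<times> UNIV) (\<lambda>(t, x). time_deriv T (ext c F) t x)"
    by (rule continuous_on_eq[OF cont_Ft]) (auto simp: td)
  ultimately show "ext c F \<in> C12b A g T"
    unfolding C12b_iff using C D differentiableI_vector by blast
qed

section \<open>The generator of the flow\<close>

text \<open>What testing uses of a drift: continuity in coordinates and a bound at every time. For
  the fields at hand the bound is given at almost every time only; \<open>drift_mfg_drift\<close>
  closes this gap.\<close>

definition drift :: "real \<Rightarrow> (real \<Rightarrow> 'm \<Rightarrow> ('m, 'n) tvec) \<Rightarrow> bool" where
  "drift T B \<longleftrightarrow> (\<forall>t\<in>{0..T}. \<forall>x. B t x \<in> TS x) \<and>
     (\<forall>c\<in>A. \<forall>k. Ctk_on 0 {0..T} (chart_image c) (\<lambda>t y. B t (chart_inv c y) c $ k)) \<and>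
     (\<exists>K. \<forall>t\<in>{0..T}. \<forall>x. tnorm g x (B t x) \<le> K)"

definition generator ::
    "real \<Rightarrow> (real \<Rightarrow> 'm \<Rightarrow> ('m, 'n) tvec) \<Rightarrow> (real \<Rightarrow> 'm \<Rightarrow> real) \<Rightarrow> real \<Rightarrow> 'm \<Rightarrow> real" where
  "generator T B \<phi> s x = time_deriv T \<phi> s x + g x (B s x) (grad A g (\<phi> s) x) + laplace_beltrami A g (\<phi> s) x"

lemma metric_grad_loc:
  assumes "b \<in> TS (chart_inv c y)" "mdiff f (chart_inv c y)" "c \<in> A" "y \<in> chart_image c"
  shows "g (chart_inv c y) b (grad A g f (chart_inv c y)) = (\<Sum>j\<in>UNIV. b c $ j * partial j (loc c f) y)"
  using g_grad[OF assms(2) charts_atI[OF assms(3,4)] assms(1)] metric_sym[OF assms(1) grad_in[OF assms(2)]]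
  by (simp add: chart_inv_right assms(3,4) inner_vec_def pvec_def)

lemma metric_grad_continuous:
  assumes B: "\<And>t x. t \<in> {0..T} \<Longrightarrow> B t x \<in> TS x"
      "\<And>c k. c \<in> A \<Longrightarrow> Ctk_on 0 {0..T} (chart_image c) (\<lambda>t y. B t (chart_inv c y) c $ k)"
    and \<phi>: "Ctm 2 {0..T} \<phi>"
  shows "continuous_on ({0..T} \<times> UNIV) (\<lambda>(t, x). g x (B t x) (grad A g (\<phi> t) x))"
proof (rule continuous_on_charts)
  fix c assume c: "c \<in> A"
  have "Ctk_on 0 {0..T} (chart_image c) (\<lambda>t y. \<Sum>j\<in>UNIV. B t (chart_inv c y) c $ j * partial j (loc c (\<phi> t)) y)"
    by (intro Ctk_on_sum Ctk_on_mult open_chart_image Ctk_on_SucD[OF Ctm2_partial[OF \<phi> c]] B(2) c)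
  then have "continuous_on ({0..T} \<times> chart_image c)
      (\<lambda>(t, y). \<Sum>j\<in>UNIV. B t (chart_inv c y) c $ j * partial j (loc c (\<phi> t)) y)" by simp
  then show "continuous_on ({0..T} \<times> chart_image c)
      (\<lambda>(t, y). g (chart_inv c y) (B t (chart_inv c y)) (grad A g (\<phi> t) (chart_inv c y)))"
    by (rule continuous_on_eq) (use B(1) c Ctm2_mdiff[OF \<phi>] in \<open>auto simp: metric_grad_loc\<close>)
qed

lemma laplace_continuous_on:
  "Ctm 2 {0..T} \<phi> \<Longrightarrow> continuous_on ({0..T} \<times> UNIV) (\<lambda>(t, x). laplace_beltrami A g (\<phi> t) x)"
  using laplace_continuous by (intro continuous_on_charts) auto

lemma generator_continuous:
  assumes "drift T B" "\<phi> \<in> C12b A g T"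
  shows "continuous_on ({0..T} \<times> UNIV) (\<lambda>(t, x). generator T B \<phi> t x)"
proof -
  have "continuous_on ({0..T} \<times> UNIV) (\<lambda>(t, x). g x (B t x) (grad A g (\<phi> t) x))"
    by (rule metric_grad_continuous[OF _ _ C12b_Ctm[OF assms(2)]]) (use assms(1) in \<open>auto simp: drift_def\<close>)
  then show ?thesis
    using C12b_time_cont[OF assms(2)] laplace_continuous_on[OF C12b_Ctm[OF assms(2)]]
    unfolding generator_def case_prod_beta by (intro continuous_intros)
qed

lemma generator_bound:
  assumes B: "drift T B" and \<phi>: "\<phi> \<in> C12b A g T"
  obtains K where "\<And>t x. t \<in> {0..T} \<Longrightarrow> \<bar>generator T B \<phi> t x\<bar> \<le> K"
proof -
  obtain K where K: "K \<ge> 0" "C12_bound T \<phi> K" using C12b_bound[OF \<phi>] .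
  obtain L where L: "\<And>t x. t \<in> {0..T} \<Longrightarrow> tnorm g x (B t x) \<le> L"
    using B unfolding drift_def by blast
  have "\<bar>generator T B \<phi> t x\<bar> \<le> K + \<bar>L\<bar> * K + CARD('n) * K" if t: "t \<in> {0..T}" for t x
  proof -
    have Bx: "B t x \<in> TS x" using B t by (simp add: drift_def)
    have "\<bar>g x (B t x) (grad A g (\<phi> t) x)\<bar> \<le> tnorm g x (B t x) * tnorm g x (grad A g (\<phi> t) x)"
      by (rule metric_Cauchy_Schwarz[OF Bx grad_in[OF C12b_mdiff[OF \<phi> t]]])
    also have "\<dots> \<le> \<bar>L\<bar> * K"
    proof (rule mult_mono)
      show "tnorm g x (B t x) \<le> \<bar>L\<bar>" using L[OF t, of x] by linarith
      show "tnorm g x (grad A g (\<phi> t) x) \<le> K" using K(2) t by (simp add: C12_bound_def)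
      show "0 \<le> tnorm g x (grad A g (\<phi> t) x)" by (rule tnorm_nonneg[OF grad_in[OF C12b_mdiff[OF \<phi> t]]])
    qed simp
    moreover have "\<bar>time_deriv T \<phi> t x\<bar> \<le> K" using K(2) t by (simp add: C12_bound_def)
    moreover note C12_bound_laplace[OF \<phi> K(2,1) t, of x]
    ultimately show ?thesis unfolding generator_def by linarith
  qed
  then show ?thesis by (rule that)
qed

end

section \<open>Nonnegative integrands and supports of measures\<close>

lemma set_integral_nonneg_mono:
  fixes f :: "real \<Rightarrow> real"
  assumes "set_integrable lborel {0..T} f" "\<And>s. s \<in> {0..T} \<Longrightarrow> f s \<ge> 0" "0 \<le> s" "s \<le> t" "t \<le> T"
  shows "(LINT r:{0..s}|lborel. f r) \<le> (LINT r:{0..t}|lborel. f r)"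
  unfolding set_lebesgue_integral_def
proof (rule integral_mono)
  have "set_integrable lborel {0..r} f" if "r \<le> T" for r
    by (rule set_integrable_subset[OF assms(1)]) (use that in auto)
  then show "integrable lborel (\<lambda>r. indicator {0..s} r *\<^sub>R f r)" "integrable lborel (\<lambda>r. indicator {0..t} r *\<^sub>R f r)"
    using assms(4,5) by (auto simp: set_integrable_def)
qed (use assms(2-5) in \<open>auto simp: indicator_def\<close>)

definition measure_support :: "'a::topological_space measure \<Rightarrow> 'a set" where
  "measure_support \<kappa> = {x. \<forall>U. open U \<longrightarrow> x \<in> U \<longrightarrow> measure \<kappa> U > 0}"

lemma integral_pos_on_open:
  fixes f :: "'a::topological_space \<Rightarrow> real"
  assumes "prob_space \<kappa>" "sets \<kappa> = sets borel" "integrable \<kappa> f" "\<And>x. f x \<ge> 0"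
    and "open V" "measure \<kappa> V > 0" "\<And>x. x \<in> V \<Longrightarrow> f x > 0"
  shows "(\<integral>x. f x \<partial>\<kappa>) > 0"
proof (rule ccontr)
  interpret prob_space \<kappa> by (rule assms(1))
  assume "\<not> (\<integral>x. f x \<partial>\<kappa>) > 0"
  moreover have "(\<integral>x. f x \<partial>\<kappa>) \<ge> 0" using assms(4) by simp
  ultimately have "(\<integral>x. f x \<partial>\<kappa>) = 0" by simp
  then have "AE x in \<kappa>. f x = 0"
    using integral_nonneg_eq_0_iff_AE[OF assms(3)] assms(4) by simp
  then have "AE x in \<kappa>. x \<notin> V" by (rule AE_mp) (use assms(7) in \<open>force intro!: AE_I2\<close>)
  moreover have V: "V \<in> sets \<kappa>" using assms(2,5) by simp
  moreover have "{x \<in> space \<kappa>. \<not> x \<notin> V} = V" using sets.sets_into_space[OF V] by blast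
  ultimately have "measure \<kappa> V = 0" using AE_iff_measurable[of V \<kappa> "\<lambda>x. x \<notin> V"]
    by (simp add: measure_def)
  then show False using assms(6) by simp
qed

text \<open>The set where \<open>f\<close> is positive is open, so it would have positive measure if
  it met the support. With full support this turns vanishing integrals into pointwise
  identities.\<close>

lemma continuous_zero_on_support:
  fixes f :: "'a::topological_space \<Rightarrow> real"
  assumes "prob_space \<kappa>" "sets \<kappa> = sets borel" "continuous_on UNIV f" "integrable \<kappa> f" "\<And>x. f x \<ge> 0"
    and "(\<integral>x. f x \<partial>\<kappa>) \<le> 0" "x \<in> measure_support \<kappa>"
  shows "f x = 0"
proof (rule ccontr)
  assume "f x \<noteq> 0"
  then have fx: "f x > 0" using assms(5)[of x] by simp
  have op: "open {y. f y > 0}" using assms(3) by (intro open_Collect_less continuous_intros)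
  then have "measure \<kappa> {y. f y > 0} > 0" using assms(7) fx by (auto simp: measure_support_def)
  from integral_pos_on_open[OF assms(1,2,4,5) op this] assms(6) show False by auto
qed

context riemannian
begin

section \<open>Full support of the flow\<close>

text \<open>\<open>prob_flow_solution\<close> with the initial measure read off at time 0 and with
  \<open>drift\<close> in place of the essential bound.\<close>

definition flow :: "real \<Rightarrow> (real \<Rightarrow> 'm \<Rightarrow> ('m, 'n) tvec) \<Rightarrow> (real \<Rightarrow> 'm measure) \<Rightarrow> bool" where
  "flow T B \<mu> \<longleftrightarrow> drift T B \<and> continuous_map (top_of_set {0..T}) weak_topology \<mu> \<and>
     (\<forall>\<phi>\<in>C12b A g T. \<forall>t\<in>{0..T}. (\<integral>x. \<phi> t x \<partial>\<mu> t) - (\<integral>x. \<phi> 0 x \<partial>\<mu> 0) =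
        (LINT s:{0..t}|lborel. (\<integral>x. generator T B \<phi> s x \<partial>\<mu> s)))"

lemma flow_identity:
  assumes "flow T B \<mu>" "\<phi> \<in> C12b A g T" "t \<in> {0..T}"
  shows "(\<integral>x. \<phi> t x \<partial>\<mu> t) - (\<integral>x. \<phi> 0 x \<partial>\<mu> 0) =
    (LINT s:{0..t}|lborel. (\<integral>x. generator T B \<phi> s x \<partial>\<mu> s))"
  using assms by (simp add: flow_def)

lemma flow_weak: "flow T B \<mu> \<Longrightarrow> T > 0 \<Longrightarrow> weak_flow \<mu> T"
  by unfold_locales (simp_all add: flow_def)

lemma generator_integrable:
  assumes "flow T B \<mu>" "T > 0" "\<phi> \<in> C12b A g T"
  shows "set_integrable lborel {0..T} (\<lambda>s. \<integral>x. generator T B \<phi> s x \<partial>\<mu> s)"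
proof -
  interpret weak_flow \<mu> T by (rule flow_weak[OF assms(1,2)])
  have B: "drift T B" using assms(1) by (simp add: flow_def)
  obtain K where "\<And>t x. t \<in> {0..T} \<Longrightarrow> \<bar>generator T B \<phi> t x\<bar> \<le> K"
    using generator_bound[OF B assms(3)] by blast
  then show ?thesis by (rule flow_integrable[OF generator_continuous[OF B assms(3)]])
qed

text \<open>Such test functions are subsolutions of the backward equation: the flow identity between
  the two times has a nonnegative integrand.\<close>

lemma flow_mono:
  assumes "flow T B \<mu>" "T > 0" "\<phi> \<in> C12b A g T" "\<And>s x. s \<in> {0..T} \<Longrightarrow> generator T B \<phi> s x \<ge> 0"
    and "0 \<le> s" "s \<le> t" "t \<le> T"
  shows "(\<integral>x. \<phi> s x \<partial>\<mu> s) \<le> (\<integral>x. \<phi> t x \<partial>\<mu> t)"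
proof -
  have "(LINT r:{0..s}|lborel. (\<integral>x. generator T B \<phi> r x \<partial>\<mu> r)) \<le>
      (LINT r:{0..t}|lborel. (\<integral>x. generator T B \<phi> r x \<partial>\<mu> r))"
    by (rule set_integral_nonneg_mono[OF generator_integrable[OF assms(1-3)] _ assms(5-7)])
      (use assms(4) in \<open>auto intro!: integral_nonneg\<close>)
  then show ?thesis
    using flow_identity[OF assms(1,3), of s] flow_identity[OF assms(1,3), of t] assms(5-7) by simp
qed

text \<open>
  The test function is carried by a ball of fixed radius whose centre moves from \<open>a\<close> to \<open>b\<close>. The cube
  makes the term with the squared gradient dominate near the boundary of the ball; inside, the
  exponential factor compensates everything else.
\<close>

lemma ex_barrier:
  assumes T: "T > 0" and B: "drift T B" and c: "c \<in> A" "cball z0 R \<subseteq> chart_image c"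
    and r: "r > 0" "cball a r \<subseteq> cball z0 R" "cball b r \<subseteq> cball z0 R" and st: "s < t"
  obtains F :: "real \<Rightarrow> real^'n \<Rightarrow> real" where
    "ext c F \<in> C12b A g T" "\<And>\<tau> y. F \<tau> y \<ge> 0"
    "\<And>y. F s y > 0 \<longleftrightarrow> y \<in> ball a r" "\<And>y. F t y > 0 \<longleftrightarrow> y \<in> ball b r"
    "\<And>\<tau> x. \<tau> \<in> {0..T} \<Longrightarrow> generator T B (ext c F) \<tau> x \<ge> 0"
proof -
  \<comment> \<open>With this rate the squared sine below runs from 0 at \<open>s\<close> to 1 at
    \<open>t\<close>. Unlike linear interpolation it also stays between 0 and 1 at times outside
    \<open>{s..t}\<close>, so the centre never leaves the segment.\<close>
  define \<omega> where "\<omega> = pi / (2 * (t - s))"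
  define z where "z = (\<lambda>\<tau>. a + (sin (\<omega> * (\<tau> - s)))\<^sup>2 *\<^sub>R (b - a))"
  define z' where "z' = (\<lambda>\<tau>. (2 * \<omega> * sin (\<omega> * (\<tau> - s)) * cos (\<omega> * (\<tau> - s))) *\<^sub>R (b - a))"
  define \<psi> where "\<psi> = (\<lambda>\<tau> y. r\<^sup>2 - (\<Sum>i\<in>UNIV. (y $ i - z \<tau> $ i) * (y $ i - z \<tau> $ i)))"
  define m where "m = (\<lambda>\<tau> y. max 0 (\<psi> \<tau> y))"
  have zs: "z s = a" by (simp add: z_def)
  have zt: "z t = b"
  proof -
    have "pi / (2 * d) * d = pi / 2" if "d \<noteq> 0" for d using that by simp
    from this[of "t - s"] have "\<omega> * (t - s) = pi / 2" using st by (simp add: \<omega>_def)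
    then have "sin (\<omega> * (t - s)) = 1" by (simp only: sin_pi_half)
    then show ?thesis by (simp add: z_def)
  qed
  have \<psi>: "\<psi> \<tau> y = r\<^sup>2 - (norm (y - z \<tau>))\<^sup>2" for \<tau> y
    by (simp add: \<psi>_def power2_norm_eq_inner inner_vec_def)
  have m_pos: "m \<tau> y > 0 \<longleftrightarrow> y \<in> ball (z \<tau>) r" for \<tau> y
    using power_strict_mono[of "norm (y - z \<tau>)" r 2] power2_less_imp_less[of "norm (y - z \<tau>)" r] r(1)
    by (auto simp: m_def \<psi> dist_norm norm_minus_commute less_max_iff_disj)
  have m_nonneg: "m \<tau> y \<ge> 0" for \<tau> y by (simp add: m_def)
  \<comment> \<open>A point of the moving ball is a convex combination of the corresponding points
    of the balls about \<open>a\<close> and \<open>b\<close>, so convexity of the large ball keeps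
    it inside.\<close>
  have ball_sub: "ball (z \<tau>) r \<subseteq> cball z0 R" for \<tau>
  proof
    fix y assume y: "y \<in> ball (z \<tau>) r"
    define u where "u = (sin (\<omega> * (\<tau> - s)))\<^sup>2"
    have u: "0 \<le> u" "u \<le> 1" by (simp_all add: u_def abs_square_le_1)
    define v where "v = y - z \<tau>"
    have v: "norm v < r" using y by (simp add: v_def dist_norm norm_minus_commute)
    have "y = (1 - u) *\<^sub>R (a + v) + u *\<^sub>R (b + v)"
      by (simp add: v_def z_def u_def algebra_simps)
    moreover have "a + v \<in> cball z0 R" "b + v \<in> cball z0 R"
      using r(2,3) v by (auto simp: subset_iff dist_norm)
    ultimately show "y \<in> cball z0 R"
      using convexD[OF convex_cball, of "a + v" z0 R "b + v" "1 - u" u] u by simp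
  qed
  have m_zero: "m \<tau> y = 0" if "y \<notin> cball z0 R" for \<tau> y
    using m_pos[of \<tau> y] m_nonneg[of \<tau> y] ball_sub[of \<tau>] that by fastforce
  let ?I = "{0..T}"
  have z_cont: "continuous_on ?I (\<lambda>\<tau>. z \<tau> $ i)" "continuous_on ?I (\<lambda>\<tau>. z' \<tau> $ i)" for i
    unfolding z_def z'_def by (intro continuous_intros)+
  have yz: "Ctk_on k ?I UNIV (\<lambda>\<tau> y. y $ i - z \<tau> $ i)" for k i
    by (intro Ctk_on_diff Ctk_on_coord Ctk_on_time z_cont) auto
  have \<psi>C: "Ctk_on k ?I UNIV \<psi>" for k
    unfolding \<psi>_def by (intro Ctk_on_diff Ctk_on_const Ctk_on_sum Ctk_on_mult yz) auto
  have mC: "Ctk_on 0 ?I UNIV m"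
    using Ctk_on_continuous[OF \<psi>C[of 0]] unfolding m_def by (auto simp: case_prod_beta intro!: continuous_intros)
  have m2C: "Ctk_on (Suc 0) ?I UNIV (\<lambda>\<tau> y. m \<tau> y ^ 2)"
  proof -
    have "Ctk_on (Suc 0) ?I UNIV (\<lambda>\<tau> y. (\<lambda>u. max 0 u ^ Suc (Suc 0)) (\<psi> \<tau> y))"
      by (rule Ctk_on_real_compose[OF open_UNIV \<psi>C DERIV_max_0_power])
        (use Ctk_on_mult[OF open_UNIV Ctk_on_const[OF open_UNIV, of 0 ?I 2] mC] in \<open>simp add: m_def\<close>)
    then show ?thesis by (simp add: m_def numeral_2_eq_2)
  qed
  \<comment> \<open>Two derivatives of the cube leave the first power of \<open>m\<close>, which is
    just continuous.\<close>
  have m3C: "Ctk_on 2 ?I UNIV (\<lambda>\<tau> y. m \<tau> y ^ 3)"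
  proof -
    have "Ctk_on (Suc (Suc 0)) ?I UNIV (\<lambda>\<tau> y. (\<lambda>u. max 0 u ^ Suc (Suc (Suc 0))) (\<psi> \<tau> y))"
      by (rule Ctk_on_real_compose[OF open_UNIV \<psi>C DERIV_max_0_power])
        (use Ctk_on_mult[OF open_UNIV Ctk_on_const[OF open_UNIV, of "Suc 0" ?I 3] m2C]
          in \<open>simp add: m_def numeral_2_eq_2\<close>)
    then show ?thesis by (simp add: m_def numeral_2_eq_2 numeral_3_eq_3)
  qed
  have yD: "((\<lambda>y. y $ i - a) has_derivative (\<lambda>w. w $ i)) (at y)" for i a and y :: "real^'n"
    using has_derivative_diff[OF bounded_linear_imp_has_derivative[OF bounded_linear_vec_nth] has_derivative_const, of i a]
    by simp
  have \<psi>D: "((\<psi> \<tau>) has_derivative (\<lambda>w. - 2 * (\<Sum>i\<in>UNIV. (y $ i - z \<tau> $ i) * w $ i))) (at y)" for \<tau> y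
  proof -
    have "((\<lambda>y. r\<^sup>2 - (\<Sum>i\<in>UNIV. (y $ i - z \<tau> $ i) * (y $ i - z \<tau> $ i))) has_derivative
        (\<lambda>w. 0 - (\<Sum>i\<in>UNIV. (y $ i - z \<tau> $ i) * w $ i + w $ i * (y $ i - z \<tau> $ i)))) (at y)"
      by (intro has_derivative_diff has_derivative_const has_derivative_sum has_derivative_mult yD)
    then show ?thesis
      unfolding \<psi>_def by (simp add: sum_distrib_left sum_negf[symmetric] mult.commute)
  qed
  have powD: "((\<lambda>y. m \<tau> y ^ Suc (Suc n)) has_derivative (\<lambda>w. (real (Suc (Suc n)) * m \<tau> y ^ Suc n) *
      (- 2 * (\<Sum>i\<in>UNIV. (y $ i - z \<tau> $ i) * w $ i)))) (at y)" for n \<tau> y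
    unfolding m_def
    by (rule has_derivative_compose[OF \<psi>D DERIV_max_0_power[unfolded has_field_derivative_def]])
  have ax: "(\<Sum>i\<in>UNIV. a i * axis j 1 $ i) = a j" for a :: "'n \<Rightarrow> real" and j
    by (simp add: axis_def if_distrib[of "\<lambda>b. _ * b"] cong: if_cong)
  have p1: "partial j (\<lambda>y. e * m \<tau> y ^ 3) y = - 6 * e * m \<tau> y ^ 2 * (y $ j - z \<tau> $ j)" for e \<tau> j y
  proof -
    have "((\<lambda>y. e * m \<tau> y ^ 3) has_derivative
        (\<lambda>w. e * ((3 * m \<tau> y ^ 2) * (- 2 * (\<Sum>i\<in>UNIV. (y $ i - z \<tau> $ i) * w $ i))))) (at y)"
      using has_derivative_mult_right[OF powD[of \<tau> "Suc 0" y], of e] by (simp add: numeral_2_eq_2 numeral_3_eq_3)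
    from fun_cong[OF frechet_derivative_at[OF this], of "axis j 1"]
    show ?thesis unfolding partial_def by (simp add: ax) (simp add: algebra_simps)
  qed
  have p2: "partial k (\<lambda>y. - 6 * e * m \<tau> y ^ 2 * (y $ j - z \<tau> $ j)) y =
      24 * e * m \<tau> y * (y $ k - z \<tau> $ k) * (y $ j - z \<tau> $ j) - 6 * e * m \<tau> y ^ 2 * (if k = j then 1 else 0)" for e \<tau> k j y
  proof -
    have 2: "((\<lambda>y. - 6 * e * m \<tau> y ^ 2) has_derivative
        (\<lambda>w. - 6 * e * ((2 * m \<tau> y) * (- 2 * (\<Sum>i\<in>UNIV. (y $ i - z \<tau> $ i) * w $ i))))) (at y)"
      using has_derivative_mult_right[OF powD[of \<tau> 0 y], of "- 6 * e"] by (simp add: numeral_2_eq_2)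
    from fun_cong[OF frechet_derivative_at[OF has_derivative_mult[OF 2 yD[of j "z \<tau> $ j" y]]], of "axis k 1",
        symmetric, unfolded ax]
    show ?thesis unfolding partial_def by (simp only:) (auto simp: axis_def algebra_simps)
  qed
  have z_deriv: "((\<lambda>\<tau>. z \<tau> $ i) has_real_derivative z' \<tau> $ i) (at \<tau> within ?I)" for \<tau> i
    unfolding z_def z'_def by (auto intro!: derivative_eq_intros)
  have \<psi>t: "((\<lambda>\<tau>. \<psi> \<tau> y) has_real_derivative 2 * (\<Sum>i\<in>UNIV. (y $ i - z \<tau> $ i) * z' \<tau> $ i)) (at \<tau> within ?I)" for \<tau> y
  proof -
    have "((\<lambda>\<tau>. r\<^sup>2 - (\<Sum>i\<in>UNIV. (y $ i - z \<tau> $ i) * (y $ i - z \<tau> $ i))) has_real_derivative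
        0 - (\<Sum>i\<in>UNIV. (0 - z' \<tau> $ i) * (y $ i - z \<tau> $ i) + (0 - z' \<tau> $ i) * (y $ i - z \<tau> $ i))) (at \<tau> within ?I)"
      by (intro DERIV_diff DERIV_const DERIV_sum DERIV_mult z_deriv)
    then show ?thesis
      unfolding \<psi>_def by (simp add: sum_distrib_left sum_negf[symmetric] algebra_simps)
  qed
  have m3t: "((\<lambda>\<tau>. m \<tau> y ^ 3) has_real_derivative 6 * m \<tau> y ^ 2 * (\<Sum>i\<in>UNIV. (y $ i - z \<tau> $ i) * z' \<tau> $ i)) (at \<tau> within ?I)" for \<tau> y
    using DERIV_chain2[OF DERIV_max_0_power[of "Suc 0" "\<psi> \<tau> y"] \<psi>t[of y \<tau>]]
    by (simp add: m_def numeral_2_eq_2 numeral_3_eq_3 mult.assoc)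
  let ?G = "\<lambda>y. matrix_inv (mm c y)"
  \<comment> \<open>Everything that carries the factor \<open>6 * e * M ^ 2\<close> in the
    generator: motion of the centre, drift, first-order part of the Laplacian, and the trace left by
    the second derivatives of \<open>\<psi>\<close>. It has no sign but is bounded on the compact
    set.\<close>
  define \<Theta> where "\<Theta> = (\<lambda>\<tau> y. (\<Sum>i\<in>UNIV. (y $ i - z \<tau> $ i) * z' \<tau> $ i)
      - (\<Sum>j\<in>UNIV. (B \<tau> (chart_inv c y) c $ j + lapb c y j) * (y $ j - z \<tau> $ j)) - (\<Sum>j\<in>UNIV. ?G y $ j $ j))"
  have comp: "compact (?I \<times> cball z0 R)" by (intro compact_Times) auto
  have \<Theta>_cont: "continuous_on (?I \<times> cball z0 R) (\<lambda>(\<tau>, y). \<Theta> \<tau> y)"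
  proof -
    note op = open_chart_image[OF c(1)]
    have yz': "Ctk_on 0 ?I (chart_image c) (\<lambda>\<tau> y. y $ i - z \<tau> $ i)" for i
      by (rule Ctk_on_subset[OF yz]) auto
    have "Ctk_on 0 ?I (chart_image c) \<Theta>"
      unfolding \<Theta>_def
      by (intro Ctk_on_diff Ctk_on_sum Ctk_on_mult Ctk_on_add Ctk_on_time op yz' z_cont lapb_Ctk mm_inv_Ctk c(1))
        (use B c(1) in \<open>auto simp: drift_def\<close>)
    then show ?thesis
      using c(2) by (auto elim!: continuous_on_subset)
  qed
  obtain K where K: "K \<ge> 0" "\<And>p. p \<in> ?I \<times> cball z0 R \<Longrightarrow> \<bar>(\<lambda>(\<tau>, y). \<Theta> \<tau> y) p\<bar> \<le> K"
    using continuous_on_compact_bound[OF comp \<Theta>_cont] by blast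
  have G_cont: "continuous_on (cball z0 R) (\<lambda>y. ?G y $ i $ j)" for i j
  proof -
    have "Ck_on 0 (chart_image c) (\<lambda>y. ?G y $ i $ j)"
      by (rule Ck_on_of_Ctk_on[OF mm_inv_Ctk[OF c(1), of 0 UNIV]]) simp
    then show ?thesis using continuous_on_subset[OF _ c(2)] by simp
  qed
  have G_pos: "w \<bullet> (?G y *v w) > 0" if "y \<in> cball z0 R" "w \<noteq> 0" for y w
    using mm_inv_pos[OF c(1) _ that(2)] that(1) c(2) by blast
  \<comment> \<open>The ellipticity constant on the ball: it makes the squared-gradient term
    positive away from the centre.\<close>
  obtain l where l: "l > 0" "\<And>y w. y \<in> cball z0 R \<Longrightarrow> l * (norm w)\<^sup>2 \<le> w \<bullet> (?G y *v w)"
    using compact_matrix_pos[OF compact_cball G_cont G_pos] by blast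
  \<comment> \<open>the choice that turns \<open>C M\<^sup>2 - (6 K + 24 l) M + 24 l r\<^sup>2\<close> below into a square\<close>
  define C where "C = (6 * K + 24 * l)\<^sup>2 / (96 * l * r\<^sup>2)"
  define F where "F = (\<lambda>\<tau> y. exp (C * \<tau>) * m \<tau> y ^ 3)"
  define Ft where "Ft = (\<lambda>\<tau> y. exp (C * \<tau>) * (C * m \<tau> y ^ 3 + 6 * m \<tau> y ^ 2 * (\<Sum>i\<in>UNIV. (y $ i - z \<tau> $ i) * z' \<tau> $ i)))"
  have e_cont: "continuous_on ?I (\<lambda>\<tau>. exp (C * \<tau>))" by (intro continuous_intros)
  have FC: "Ctk_on 2 ?I UNIV F"
    unfolding F_def by (intro Ctk_on_mult Ctk_on_time m3C e_cont) auto
  have FtC: "Ctk_on 0 ?I UNIV Ft"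
    unfolding Ft_def
    by (intro Ctk_on_mult Ctk_on_add Ctk_on_time Ctk_on_sum Ctk_on_const Ctk_on_SucD[OF m2C] yz z_cont e_cont
        Ctk_on_SucD[OF Ctk_on_SucD[OF m3C[unfolded numeral_2_eq_2]]]) auto
  have FD: "((\<lambda>\<tau>. F \<tau> y) has_vector_derivative Ft \<tau> y) (at \<tau> within ?I)" for \<tau> y
  proof -
    have "((\<lambda>\<tau>. exp (C * \<tau>)) has_real_derivative C * exp (C * \<tau>)) (at \<tau> within ?I)"
      by (auto intro!: derivative_eq_intros)
    from DERIV_mult[OF this m3t[of y \<tau>]] show ?thesis
      unfolding F_def Ft_def has_real_derivative_iff_has_vector_derivative[symmetric]
      by (simp add: algebra_simps)
  qed
  have F0: "F \<tau> y = 0" "Ft \<tau> y = 0" if "y \<notin> cball z0 R" for \<tau> y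
    using m_zero[OF that, of \<tau>] by (auto simp: F_def Ft_def)
  have ext: "ext c F \<in> C12b A g T" "\<And>\<tau> x. \<tau> \<in> ?I \<Longrightarrow> time_deriv T (ext c F) \<tau> x = ext c Ft \<tau> x"
    using ext_C12b[OF T c FC F0(1) FD Ctk_on_continuous[OF FtC] F0(2)] by auto
  note extC = C12b_Ctm[OF ext(1)]
  have gen: "generator T B (ext c F) \<tau> x \<ge> 0" if \<tau>: "\<tau> \<in> ?I" for \<tau> x
  proof (cases "x \<in> chart_inv c ` cball z0 R")
    case True
    then obtain y where y: "y \<in> cball z0 R" "x = chart_inv c y" by blast
    have yc: "y \<in> chart_image c" using y(1) c(2) by auto
    define e where "e = exp (C * \<tau>)"
    define \<xi> where "\<xi> = y - z \<tau>"
    define M where "M = m \<tau> y"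
    have e: "e > 0" by (simp add: e_def)
    have d1: "partial j (loc c (ext c F \<tau>)) u = - 6 * e * m \<tau> u ^ 2 * (u $ j - z \<tau> $ j)" if "u \<in> chart_image c" for j u
      by (subst partial_cong_open[OF open_chart_image[OF c(1)] that, where h = "F \<tau>"])
        (use p1[of j e \<tau> u] in \<open>auto simp: ext_loc[OF c(1)] F_def e_def\<close>)
    have d2: "partial k (partial j (loc c (ext c F \<tau>))) y =
        24 * e * M * \<xi> $ k * \<xi> $ j - 6 * e * M ^ 2 * (if k = j then 1 else 0)" for k j
    proof -
      have "partial k (partial j (loc c (ext c F \<tau>))) y = partial k (\<lambda>u. - 6 * e * m \<tau> u ^ 2 * (u $ j - z \<tau> $ j)) y"
        by (rule partial_cong_open[OF open_chart_image[OF c(1)] yc d1])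
      then show ?thesis by (simp only: p2 M_def \<xi>_def vector_minus_component)
    qed
    have By: "B \<tau> (chart_inv c y) \<in> TS (chart_inv c y)" using B \<tau> by (simp add: drift_def)
    have "generator T B (ext c F) \<tau> x = Ft \<tau> y + (\<Sum>j\<in>UNIV. B \<tau> (chart_inv c y) c $ j * (- 6 * e * M ^ 2 * \<xi> $ j))
        + ((\<Sum>k\<in>UNIV. \<Sum>j\<in>UNIV. ?G y $ k $ j * (24 * e * M * \<xi> $ k * \<xi> $ j - 6 * e * M ^ 2 * (if k = j then 1 else 0)))
        + (\<Sum>j\<in>UNIV. lapb c y j * (- 6 * e * M ^ 2 * \<xi> $ j)))"
      unfolding generator_def y(2) ext(2)[OF \<tau>] ext_loc[OF c(1) yc]
        metric_grad_loc[OF By C12b_mdiff[OF ext(1) \<tau>] c(1) yc] laplace_loc[OF extC \<tau> c(1) yc] d1[OF yc] d2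
      by (simp add: M_def \<xi>_def)
    also have "(\<Sum>k\<in>UNIV. \<Sum>j\<in>UNIV. ?G y $ k $ j * (24 * e * M * \<xi> $ k * \<xi> $ j - 6 * e * M ^ 2 * (if k = j then 1 else 0)))
        = 24 * e * M * (\<xi> \<bullet> (?G y *v \<xi>)) - 6 * e * M ^ 2 * (\<Sum>j\<in>UNIV. ?G y $ j $ j)"
    proof -
      have "(\<Sum>j\<in>UNIV. ?G y $ k $ j * (6 * e * M ^ 2 * (if k = j then 1 else 0))) = 6 * e * M ^ 2 * ?G y $ k $ k" for k
        by (simp add: if_distrib[of "\<lambda>b. _ * b"] cong: if_cong)
      then show ?thesis
        by (simp add: right_diff_distrib sum_subtractf inner_matrix_vector_sum sum_distrib_left mult_ac)
    qed
    also have "Ft \<tau> y + (\<Sum>j\<in>UNIV. B \<tau> (chart_inv c y) c $ j * (- 6 * e * M ^ 2 * \<xi> $ j))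
        + (24 * e * M * (\<xi> \<bullet> (?G y *v \<xi>)) - 6 * e * M ^ 2 * (\<Sum>j\<in>UNIV. ?G y $ j $ j)
        + (\<Sum>j\<in>UNIV. lapb c y j * (- 6 * e * M ^ 2 * \<xi> $ j)))
        = e * (C * M ^ 3 + 6 * M ^ 2 * \<Theta> \<tau> y + 24 * M * (\<xi> \<bullet> (?G y *v \<xi>)))"
    proof -
      have "(\<Sum>j\<in>UNIV. B \<tau> (chart_inv c y) c $ j * (- 6 * e * M ^ 2 * \<xi> $ j)) =
          - 6 * e * M ^ 2 * (\<Sum>j\<in>UNIV. B \<tau> (chart_inv c y) c $ j * \<xi> $ j)"
        "(\<Sum>j\<in>UNIV. lapb c y j * (- 6 * e * M ^ 2 * \<xi> $ j)) = - 6 * e * M ^ 2 * (\<Sum>j\<in>UNIV. lapb c y j * \<xi> $ j)"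
        by (simp_all add: sum_distrib_left mult_ac)
      moreover have "\<Theta> \<tau> y = (\<Sum>i\<in>UNIV. \<xi> $ i * z' \<tau> $ i)
          - ((\<Sum>j\<in>UNIV. B \<tau> (chart_inv c y) c $ j * \<xi> $ j) + (\<Sum>j\<in>UNIV. lapb c y j * \<xi> $ j)) - (\<Sum>j\<in>UNIV. ?G y $ j $ j)"
        by (simp add: \<Theta>_def \<xi>_def distrib_right sum.distrib)
      moreover have "Ft \<tau> y = e * (C * M ^ 3 + 6 * M ^ 2 * (\<Sum>i\<in>UNIV. \<xi> $ i * z' \<tau> $ i))"
        by (simp add: Ft_def e_def M_def \<xi>_def)
      ultimately show ?thesis by (simp only:) (simp add: algebra_simps)
    qed
    finally have g_eq: "generator T B (ext c F) \<tau> x =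
        e * (C * M ^ 3 + 6 * M ^ 2 * \<Theta> \<tau> y + 24 * M * (\<xi> \<bullet> (?G y *v \<xi>)))" .
    have M0: "M \<ge> 0" using m_nonneg by (simp add: M_def)
    show ?thesis
    proof (cases "M = 0")
      case True
      then show ?thesis by (simp add: g_eq)
    next
      case False
      \<comment> \<open>In the moving ball the squared distance to the centre is
        \<open>r\<^sup>2 - M\<close>. Where \<open>M\<close> is small, the elliptic term is thus at
        least nearly \<open>l * r\<^sup>2\<close>; where \<open>M\<close> is large, the term with
        \<open>C\<close> takes over.\<close>
      then have "(norm \<xi>)\<^sup>2 = r\<^sup>2 - M" using M0 by (simp add: M_def m_def \<psi> \<xi>_def max_def split: if_splits)
      then have Q: "l * (r\<^sup>2 - M) \<le> \<xi> \<bullet> (?G y *v \<xi>)" using l(2)[OF y(1), of \<xi>] by simp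
      have "\<bar>\<Theta> \<tau> y\<bar> \<le> K" using K(2)[of "(\<tau>, y)"] \<tau> y(1) by simp
      then have "- K \<le> \<Theta> \<tau> y" by linarith
      then have "6 * M * (- K) \<le> 6 * M * \<Theta> \<tau> y" using M0 by (intro mult_left_mono) auto
      moreover have "C * M\<^sup>2 - (6 * K + 24 * l) * M + 24 * l * r\<^sup>2 \<ge> 0"
      proof -
        let ?q = "6 * K + 24 * l"
        have q: "?q > 0" using K(1) l(1) by simp
        have "0 \<le> 24 * l * r\<^sup>2 * (1 - ?q * M / (48 * l * r\<^sup>2))\<^sup>2" using l(1) by simp
        also have "\<dots> = C * M\<^sup>2 - ?q * M + 24 * l * r\<^sup>2"
          using l(1) r(1) by (simp add: C_def power2_eq_square field_simps)
        finally show ?thesis .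
      qed
      ultimately have "0 \<le> C * M\<^sup>2 + 6 * M * \<Theta> \<tau> y + 24 * (\<xi> \<bullet> (?G y *v \<xi>))"
        using Q by (simp add: algebra_simps)
      then have "0 \<le> e * M * (C * M\<^sup>2 + 6 * M * \<Theta> \<tau> y + 24 * (\<xi> \<bullet> (?G y *v \<xi>)))"
        using e M0 by simp
      then show ?thesis by (simp add: g_eq power2_eq_square power3_eq_cube algebra_simps)
    qed
  next
    case False
    let ?V = "- chart_inv c ` cball z0 R"
    have op: "open ?V" using closed_chart_ball[OF c] by blast
    have z: "ext c F \<tau> x = 0" if "x \<in> ?V" for x
      by (rule ext_zero_outside[where z = z0 and R = R]) (use c(1) F0(1) that in auto)
    have zt: "ext c Ft \<tau> x = 0"
      by (rule ext_zero_outside[where z = z0 and R = R]) (use c(1) F0(2) False in auto)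
    have gz: "grad A g (ext c F \<tau>) x = (\<lambda>c. 0)" if "x \<in> ?V" for x
      using grad_zero[OF extC \<tau> op that z] .
    obtain d where d: "d \<in> charts_at A x" by (rule ex_chart)
    have "laplace_beltrami A g (ext c F \<tau>) x = 0"
      unfolding laplace_beltrami_def divergence_eq[OF grad_diff_field[OF extC \<tau>] d]
      using cov_deriv_zero[OF grad_diff_field[OF extC \<tau>] op _ gz tv_in[OF d]] False by simp
    moreover have "g x (B \<tau> x) (grad A g (ext c F \<tau>) x) = 0"
    proof -
      have "B \<tau> x \<in> TS x" using B \<tau> by (simp add: drift_def)
      from metric_Cauchy_Schwarz[OF this grad_in[OF C12b_mdiff[OF ext(1) \<tau>], of x]] gz[of x] False
      show ?thesis by (simp add: tnorm_zero)
    qed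
    ultimately show ?thesis by (simp add: generator_def ext(2)[OF \<tau>] zt)
  qed
  show ?thesis
  proof (rule that[OF ext(1)])
    show "F \<tau> y \<ge> 0" for \<tau> y by (simp add: F_def m_nonneg)
    have "F \<tau> y > 0 \<longleftrightarrow> y \<in> ball (z \<tau>) r" for \<tau> y
      using m_pos[of \<tau> y] m_nonneg[of \<tau> y] by (auto simp: F_def zero_less_mult_iff zero_less_power_eq)
    then show "F s y > 0 \<longleftrightarrow> y \<in> ball a r" "F t y > 0 \<longleftrightarrow> y \<in> ball b r" for y
      by (simp_all add: zs zt)
  qed (rule gen)
qed

text \<open>The barrier starts positive around the support point over \<open>a\<close>, so its mean
  is positive at time \<open>s\<close> and stays so. At time \<open>t\<close> it is carried by a
  ball about \<open>b\<close> chosen inside \<open>U\<close>, which therefore cannot be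
  null.\<close>

lemma support_propagates:
  assumes "flow T B \<mu>" "T > 0" and c: "c \<in> A" "cball z0 R \<subseteq> chart_image c"
    and ab: "a \<in> ball z0 R" "b \<in> ball z0 R" and st: "0 \<le> s" "s < t" "t \<le> T"
    and supp: "chart_inv c a \<in> measure_support (\<mu> s)"
  shows "chart_inv c b \<in> measure_support (\<mu> t)"
proof -
  interpret weak_flow \<mu> T by (rule flow_weak[OF assms(1,2)])
  have s: "s \<in> {0..T}" and t: "t \<in> {0..T}" using st by auto
  have "measure (\<mu> t) U > 0" if U: "open U" "chart_inv c b \<in> U" for U
  proof -
    have bc: "b \<in> chart_image c" using ab(2) c(2) by auto
    let ?V = "ball z0 R \<inter> (chart_image c \<inter> chart_inv c -` U)"
    have "open ?V"
      using continuous_open_preimage[OF continuous_chart_inv[OF c(1)] open_chart_image[OF c(1)] U(1)] by auto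
    moreover have "b \<in> ?V" using ab(2) bc U(2) by simp
    ultimately obtain rb where rb: "rb > 0" "cball b rb \<subseteq> ?V"
      using open_contains_cball[of ?V] by blast
    obtain ra where ra: "ra > 0" "cball a ra \<subseteq> ball z0 R"
      using open_contains_cball[of "ball z0 R"] ab(1) open_ball by blast
    \<comment> \<open>The ball moves without changing size, so one radius has to fit at both
      ends.\<close>
    define r where "r = min ra rb"
    have r: "r > 0" "cball a r \<subseteq> cball z0 R" "cball b r \<subseteq> cball z0 R"
      using ra rb by (auto simp: r_def subset_iff)
    have dB: "drift T B" using assms(1) by (simp add: flow_def)
    obtain F :: "real \<Rightarrow> real^'n \<Rightarrow> real" where F: "ext c F \<in> C12b A g T" "\<And>\<tau> y. F \<tau> y \<ge> 0"
      "\<And>y. F s y > 0 \<longleftrightarrow> y \<in> ball a r" "\<And>y. F t y > 0 \<longleftrightarrow> y \<in> ball b r"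
      "\<And>\<tau> x. \<tau> \<in> {0..T} \<Longrightarrow> generator T B (ext c F) \<tau> x \<ge> 0"
      by (rule ex_barrier[OF assms(2) dB c r st(2)]) (rule that)
    obtain K where K: "C12_bound T (ext c F) K" using C12b_bound[OF F(1)] by blast
    have int: "integrable (\<mu> \<tau>) (ext c F \<tau>)" if "\<tau> \<in> {0..T}" for \<tau>
      by (rule integrable_slice[OF continuous_on_slice[OF C12b_cont[OF F(1)] that] _ that])
        (use K that in \<open>auto simp: C12_bound_def\<close>)
    have "(\<integral>x. ext c F s x \<partial>\<mu> s) > 0"
    proof (rule integral_pos_on_open[OF prob[OF s] sets_eq[OF s] int[OF s]])
      let ?W = "fst c \<inter> snd c -` ball a r"
      show op: "open ?W"
        by (rule continuous_open_preimage[OF continuous_chart[OF c(1)] open_dom[OF c(1)]]) simp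
      have "a \<in> chart_image c" using ab(1) c(2) by auto
      then have "chart_inv c a \<in> ?W" using r(1) chart_inv_in[OF c(1)] chart_inv_right[OF c(1)] by simp
      then show "measure (\<mu> s) ?W > 0" using supp op by (auto simp: measure_support_def)
      show "ext c F s x > 0" if "x \<in> ?W" for x using that F(3) by (simp add: ext_def)
    qed (use F(2) in \<open>simp add: ext_def\<close>)
    also have "\<dots> \<le> (\<integral>x. ext c F t x \<partial>\<mu> t)"
      by (rule flow_mono[OF assms(1,2) F(1) F(5)]) (use st in auto)
    finally have pos: "(\<integral>x. ext c F t x \<partial>\<mu> t) > 0" .
    show ?thesis
    proof (rule ccontr)
      assume "\<not> measure (\<mu> t) U > 0"
      then have U0: "measure (\<mu> t) U = 0" using measure_nonneg[of "\<mu> t" U] by linarith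
      interpret prob_space "\<mu> t" by (rule prob[OF t])
      have "U \<in> null_sets (\<mu> t)"
        using U0 U(1) by (intro null_setsI) (simp_all add: emeasure_eq_measure sets_eq[OF t])
      then have "AE x in \<mu> t. x \<notin> U" by (rule AE_not_in)
      then have "AE x in \<mu> t. ext c F t x = 0"
      proof (rule AE_mp, intro AE_I2 impI)
        fix x assume x: "x \<notin> U"
        show "ext c F t x = 0"
        proof (cases "x \<in> fst c")
          case True
          have "snd c x \<notin> ball b r"
          proof
            assume "snd c x \<in> ball b r"
            then have "snd c x \<in> cball b rb" by (simp add: r_def)
            then have "chart_inv c (snd c x) \<in> U" using rb(2) by blast
            then show False using x chart_inv_left[OF c(1) True] by simp
          qed
          then show ?thesis using F(4)[of "snd c x"] F(2)[of t "snd c x"] True by (simp add: ext_def)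
        qed (simp add: ext_def)
      qed
      then have "(\<integral>x. ext c F t x \<partial>\<mu> t) = 0" by (simp add: integral_eq_zero_AE)
      with pos show False by simp
    qed
  qed
  then show ?thesis by (simp add: measure_support_def)
qed

text \<open>By the Lindelof property the complement of the support is a countable union of null open
  sets; were it everything, the total mass would vanish.\<close>

lemma support_nonempty:
  assumes "\<kappa> \<in> borel_probs"
  shows "measure_support (\<kappa> :: 'm measure) \<noteq> {}"
proof
  assume "measure_support \<kappa> = {}"
  interpret prob_space \<kappa> using assms by (simp add: borel_probs_def)
  have s: "sets \<kappa> = sets borel" using assms by (simp add: borel_probs_def)
  let ?\<F> = "{U. open U \<and> measure \<kappa> U = 0}"
  have "x \<in> \<Union>?\<F>" for x
  proof -
    have "x \<notin> measure_support \<kappa>" using \<open>measure_support \<kappa> = {}\<close> by simp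
    then obtain U where "open U" "x \<in> U" "\<not> measure \<kappa> U > 0" by (auto simp: measure_support_def)
    then show ?thesis using measure_nonneg[of \<kappa> U] by (intro UnionI[of U]) (auto simp: not_less)
  qed
  then have cover: "\<Union>?\<F> = UNIV" by blast
  obtain \<G> where \<G>: "\<G> \<subseteq> ?\<F>" "countable \<G>" "\<Union>\<G> = \<Union>?\<F>"
    using Lindelof[of ?\<F>] by auto
  have "(\<Union>U\<in>\<G>. U) \<in> null_sets \<kappa>"
    using \<G>(1,2) by (intro null_sets_UN') (auto intro!: null_setsI simp: emeasure_eq_measure s)
  then have "space \<kappa> \<in> null_sets \<kappa>"
    using \<G>(3) cover sets_eq_imp_space_eq[OF s] by simp
  then show False using emeasure_space_1 by (simp add: null_sets_def)
qed

lemma ex_chart_ball: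
  obtains c R where "c \<in> charts_at A x" "R > 0" "cball (snd c x) R \<subseteq> chart_image c"
proof -
  obtain c where c: "c \<in> charts_at A x" by (rule ex_chart)
  then show ?thesis
    using that open_contains_cball[of "chart_image c"] open_chart_image charts_atD[OF c] by metis
qed

text \<open>Within a chart ball the support spreads in arbitrarily short time. Connectedness
  replaces a chain of balls: the points reached before time \<open>t\<close> form an open and closed
  set.\<close>

lemma full_support:
  assumes "flow T B \<mu>" "T > 0" "0 < t" "t \<le> T"
  shows "measure_support (\<mu> t) = UNIV"
proof -
  interpret weak_flow \<mu> T by (rule flow_weak[OF assms(1,2)])
  define V where "V = (\<Union>s\<in>{0..<t}. measure_support (\<mu> s))"
  have step: "\<exists>W. open W \<and> x \<in> W \<and> (W \<inter> V \<noteq> {} \<longrightarrow> W \<subseteq> V \<inter> measure_support (\<mu> t))" for x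
  proof -
    obtain c R where c: "c \<in> charts_at A x" and R: "R > 0" "cball (snd c x) R \<subseteq> chart_image c"
      by (rule ex_chart_ball)
    note cA = charts_atD[OF c]
    let ?W = "fst c \<inter> snd c -` ball (snd c x) R"
    have "open ?W"
      by (rule continuous_open_preimage[OF continuous_chart[OF cA(1)] open_dom[OF cA(1)]]) simp
    moreover have "x \<in> ?W" using cA R(1) by simp
    moreover have "?W \<subseteq> V \<inter> measure_support (\<mu> t)" if ne: "?W \<inter> V \<noteq> {}"
    proof
      fix q assume q: "q \<in> ?W"
      obtain p s where p: "p \<in> ?W" "s \<in> {0..<t}" "p \<in> measure_support (\<mu> s)"
        using ne unfolding V_def by blast
      have "q \<in> measure_support (\<mu> t')" if "s < t'" "t' \<le> T" for t'
        using support_propagates[OF assms(1,2) cA(1) R(2), of "snd c p" "snd c q" s t'] p q that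
        by (simp add: chart_inv_left[OF cA(1)])
      \<comment> \<open>Two target times: \<open>t\<close> itself gives the membership in the
        support, and a time strictly between \<open>s\<close> and \<open>t\<close> keeps the point
        in \<open>V\<close>, where only earlier times count.\<close>
      from this[of t] this[of "(s + t) / 2"] show "q \<in> V \<inter> measure_support (\<mu> t)"
        using p(2) assms(3,4) by (auto simp: V_def intro!: bexI[of _ "(s + t) / 2"])
    qed
    ultimately show ?thesis by blast
  qed
  have "open V"
  proof (subst open_subopen, rule ballI)
    fix x assume x: "x \<in> V"
    obtain W where W: "open W" "x \<in> W" "W \<inter> V \<noteq> {} \<longrightarrow> W \<subseteq> V \<inter> measure_support (\<mu> t)"
      using step[of x] by blast
    with x have "W \<subseteq> V" by auto
    with W show "\<exists>W. open W \<and> x \<in> W \<and> W \<subseteq> V" by auto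
  qed
  moreover have "open (- V)"
  proof (subst open_subopen, rule ballI)
    fix x assume x: "x \<in> - V"
    obtain W where W: "open W" "x \<in> W" "W \<inter> V \<noteq> {} \<longrightarrow> W \<subseteq> V \<inter> measure_support (\<mu> t)"
      using step[of x] by blast
    with x have "W \<inter> V = {}" by auto
    with W show "\<exists>W. open W \<and> x \<in> W \<and> W \<subseteq> - V" by auto
  qed
  moreover have "V \<noteq> {}"
    using support_nonempty[OF in_borel_probs[of 0]] assms(2,3) by (auto simp: V_def)
  moreover have "connected (UNIV :: 'm set)" using manifold by (simp add: riemannian_manifold_def)
  ultimately have "V = UNIV"
    unfolding connected_clopen closed_def by auto
  have "x \<in> measure_support (\<mu> t)" for x
    using step[of x] \<open>V = UNIV\<close> by auto
  then show ?thesis by auto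
qed

end

section \<open>Uniqueness of the solution\<close>

lemma AE_zero_of_integral_nonpos:
  fixes f :: "real \<Rightarrow> real"
  assumes "set_integrable lborel {0..T} f" "AE t in lborel. t \<in> {0..T} \<longrightarrow> f t \<ge> 0"
    and "(LINT t:{0..T}|lborel. f t) \<le> 0"
  shows "AE t in lborel. t \<in> {0..T} \<longrightarrow> f t = 0"
proof -
  have int: "integrable lborel (\<lambda>t. indicator {0..T} t *\<^sub>R f t)"
    using assms(1) by (simp add: set_integrable_def)
  have nn: "AE t in lborel. 0 \<le> indicator {0..T} t *\<^sub>R f t"
    using assms(2) by (rule AE_mp) (auto intro!: AE_I2 simp: indicator_def)
  have "(\<integral>t. indicator {0..T} t *\<^sub>R f t \<partial>lborel) = 0"
    using integral_nonneg_AE[OF nn] assms(3) by (simp add: set_lebesgue_integral_def)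
  then have "AE t in lborel. indicator {0..T} t *\<^sub>R f t = 0"
    using integral_nonneg_eq_0_iff_AE[OF int nn] by simp
  then show ?thesis by (rule AE_mp) (auto intro!: AE_I2)
qed

context riemannian
begin

section \<open>The Hamiltonian on the fibres\<close>

lemma fibre_grad_DpH:
  assumes "regular_hamiltonian A g T H" "t \<in> {0..T}" "p \<in> TS x"
  shows "fibre_grad A g H t x p (DpH A g H t x p)"
proof -
  obtain X where X: "fibre_grad A g H t x p X"
    using assms unfolding regular_hamiltonian_def by blast
  obtain c where c: "c \<in> charts_at A x" by (rule ex_chart)
  have "Y = X" if Y: "fibre_grad A g H t x p Y" for Y
  proof (rule TS_eqI[OF _ _ c])
    show T: "Y \<in> TS x" "X \<in> TS x" using X Y by (auto simp: fibre_grad_def)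
    have "(\<lambda>w. g x Y (tv c x w)) = (\<lambda>w. g x X (tv c x w))"
      using X Y c unfolding fibre_grad_def by (blast intro: has_derivative_unique)
    then have "g x Y (tv c x w) = g x X (tv c x w)" for w by (rule fun_cong)
    then have "Y c \<bullet> (mm c (snd c x) *v w) = X c \<bullet> (mm c (snd c x) *v w)" for w
      using metric_coords[OF T(1) tv_in[OF c] c] metric_coords[OF T(2) tv_in[OF c] c] by (simp add: tv_self[OF c])
    then show "Y c = X c" by (rule mm_cancel[OF charts_atD(1,3)[OF c]])
  qed
  then show ?thesis unfolding DpH_def using theI[of "fibre_grad A g H t x p", OF X] by blast
qed

lemma DpH_in:
  "regular_hamiltonian A g T H \<Longrightarrow> t \<in> {0..T} \<Longrightarrow> p \<in> TS x \<Longrightarrow> DpH A g H t x p \<in> TS x"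
  using fibre_grad_DpH by (simp add: fibre_grad_def)

text \<open>Convexity along the segment from \<open>p\<close> to \<open>q\<close>, read in one
  chart: the difference quotients of \<open>h\<close> to the right of 0 are at most
  \<open>h 1 - h 0\<close>, and their limit is the pairing with the fibre derivative.\<close>

lemma hamiltonian_above_tangent:
  assumes H: "regular_hamiltonian A g T H" "convex_hamiltonian A T H"
    and t: "t \<in> {0..T}" and p: "p \<in> TS x" and q: "q \<in> TS x"
  shows "H t x p + g x (DpH A g H t x p) (\<lambda>c. q c - p c) \<le> H t x q"
proof -
  obtain c where c: "c \<in> charts_at A x" by (rule ex_chart)
  define h where "h = (\<lambda>a. H t x (tv c x (p c + a *\<^sub>R (q c - p c))))"
  let ?d = "g x (DpH A g H t x p) (\<lambda>c. q c - p c)"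
  have tv: "tv c x (p c + a *\<^sub>R (q c - p c)) = (\<lambda>c. (1 - a) *\<^sub>R p c + a *\<^sub>R q c)" for a
  proof -
    have "p c + a *\<^sub>R (q c - p c) = (1 - a) *\<^sub>R p c + a *\<^sub>R q c" by (simp add: algebra_simps)
    then show ?thesis using tv_linear[OF c, of "1 - a" "p c" a "q c"] tv_eq[OF p c] tv_eq[OF q c] by simp
  qed
  have tvd: "tv c x (q c - p c) = (\<lambda>c. q c - p c)"
    using tv_eq[OF TS_diff[OF q p] c] by simp
  have "(h has_real_derivative ?d) (at 0)"
  proof -
    have 1: "((\<lambda>a. p c + a *\<^sub>R (q c - p c)) has_derivative (\<lambda>a. a *\<^sub>R (q c - p c))) (at 0)"
      by (auto intro!: derivative_eq_intros)
    have 2: "((\<lambda>w. H t x (tv c x w)) has_derivative (\<lambda>w. g x (DpH A g H t x p) (tv c x w)))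
        (at (p c + 0 *\<^sub>R (q c - p c)))"
      using fibre_grad_DpH[OF H(1) t p] c by (simp add: fibre_grad_def)
    have "g x (DpH A g H t x p) (tv c x (a *\<^sub>R (q c - p c))) = ?d * a" for a
    proof -
      have "tv c x (a *\<^sub>R (q c - p c)) = (\<lambda>d. a *\<^sub>R tv c x (q c - p c) d + 0 *\<^sub>R tv c x (q c - p c) d)"
        using tv_linear[OF c, of a "q c - p c" 0 "q c - p c"] by simp
      then show ?thesis
        using metric_lincomb_right[OF TS_diff[OF q p] TS_diff[OF q p] DpH_in[OF H(1) t p], of a 0]
        by (simp add: tvd)
    qed
    then show ?thesis
      using has_derivative_compose[OF 1 2] by (simp add: h_def has_field_derivative_def)
  qed
  then have "((\<lambda>a. (h a - h 0) / a) \<longlongrightarrow> ?d) (at_right 0)"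
    by (auto simp: DERIV_def intro: filterlim_mono at_le)
  moreover have "\<forall>\<^sub>F a in at_right 0. (h a - h 0) / a \<le> h 1 - h 0"
    unfolding eventually_at_right_field
  proof (intro exI[of _ 1] conjI allI impI)
    fix a :: real assume a: "0 < a" "a < 1"
    have "h a \<le> (1 - a) * H t x p + a * H t x q"
      using H(2) t p q a unfolding h_def tv convex_hamiltonian_def by simp
    also have "\<dots> = (1 - a) * h 0 + a * h 1" by (simp add: h_def tv)
    finally have "h a - h 0 \<le> (h 1 - h 0) * a" by (simp add: algebra_simps)
    then show "(h a - h 0) / a \<le> h 1 - h 0" using a(1) by (simp only: pos_divide_le_eq)
  qed simp
  ultimately have "?d \<le> h 1 - h 0"
    by (rule tendsto_upperbound) simp
  then show ?thesis by (simp add: h_def tv)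
qed

text \<open>Continuity of the Hamiltonian is stated in bundle charts; this is the map with which it
  is composed.\<close>

lemma continuous_on_grad_coords:
  assumes "Ctm 2 {0..T} v" "c \<in> A"
  shows "continuous_on ({0..T} \<times> chart_image c)
    (\<lambda>(t, y). (t, y, grad A g (v t) (chart_inv c y) c))"
proof -
  have "continuous_on ({0..T} \<times> chart_image c) (\<lambda>p. grad A g (v (fst p)) (chart_inv c (snd p)) c)"
    using Ctk_on_continuous[OF grad_Ctk[OF assms]]
    by (intro continuous_on_vec_lambda[where f = "\<lambda>k p. grad A g (v (fst p)) (chart_inv c (snd p)) c $ k", simplified])
      (simp add: case_prod_beta)
  then show ?thesis unfolding case_prod_beta by (intro continuous_intros)
qed

lemma tv_grad:
  assumes "Ctm 2 {0..T} v" "t \<in> {0..T}" "c \<in> A" "y \<in> chart_image c"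
  shows "tv c (chart_inv c y) (grad A g (v t) (chart_inv c y) c) = grad A g (v t) (chart_inv c y)"
  by (rule tv_eq[OF grad_in[OF Ctm2_mdiff[OF assms(1,2)]] charts_atI[OF assms(3,4)]])

lemma hamiltonian_continuous:
  assumes H: "regular_hamiltonian A g T H" and v: "Ctm 2 {0..T} v"
  shows "continuous_on ({0..T} \<times> UNIV) (\<lambda>(t, x). H t x (grad A g (v t) x))"
proof (rule continuous_on_charts)
  fix c assume c: "c \<in> A"
  have "continuous_on ({0..T} \<times> chart_image c \<times> UNIV)
      (\<lambda>(t, y, w). H t (chart_inv c y) (tangent_vec A c (chart_inv c y) w))"
    using H c by (simp add: regular_hamiltonian_def)
  from continuous_on_compose2[OF this continuous_on_grad_coords[OF v c]]
  have "continuous_on ({0..T} \<times> chart_image c)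
      (\<lambda>p. (\<lambda>(t, y, w). H t (chart_inv c y) (tv c (chart_inv c y) w)) ((\<lambda>(t, y). (t, y, grad A g (v t) (chart_inv c y) c)) p))"
    by fastforce
  then show "continuous_on ({0..T} \<times> chart_image c) (\<lambda>(t, y). H t (chart_inv c y) (grad A g (v t) (chart_inv c y)))"
    by (rule continuous_on_eq) (auto simp: tv_grad[OF v _ c])
qed

text \<open>The essential bound comes with one exceptional set of times for all points. At a fixed
  point the norm of the drift is continuous in time, so the bound extends to every time.\<close>

lemma drift_mfg_drift:
  assumes T: "T > 0" and H: "regular_hamiltonian A g T H" and v: "v \<in> C12b A g T"
    and L: "mfg_drift A g H v \<in> Linf_C1b A g T"
  shows "drift T (mfg_drift A g H v)"
proof -
  let ?B = "mfg_drift A g H v"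
  note vC = C12b_Ctm[OF v]
  have in_TS: "?B t x \<in> TS x" if "t \<in> {0..T}" for t x
    unfolding mfg_drift_def by (rule TS_minus[OF DpH_in[OF H that grad_in[OF C12b_mdiff[OF v that]]]])
  have cont: "Ctk_on 0 {0..T} (chart_image c) (\<lambda>t y. ?B t (chart_inv c y) c $ k)" if c: "c \<in> A" for c k
  proof -
    have "continuous_on ({0..T} \<times> chart_image c \<times> UNIV)
      (\<lambda>(t, y, w). DpH A g H t (chart_inv c y) (tv c (chart_inv c y) w) c)"
      using H c by (simp add: regular_hamiltonian_def)
    from continuous_on_compose2[OF this continuous_on_grad_coords[OF vC c]]
    have "continuous_on ({0..T} \<times> chart_image c)
      (\<lambda>p. (\<lambda>(t, y, w). DpH A g H t (chart_inv c y) (tv c (chart_inv c y) w) c) ((\<lambda>(t, y). (t, y, grad A g (v t) (chart_inv c y) c)) p))"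
      by fastforce
    then have "continuous_on ({0..T} \<times> chart_image c) (\<lambda>p. (- (\<lambda>(t, y). DpH A g H t (chart_inv c y) (grad A g (v t) (chart_inv c y)) c) p) $ k)"
      by (intro continuous_on_component continuous_on_minus) (erule continuous_on_eq, auto simp: tv_grad[OF vC _ c])
    then show ?thesis by (simp add: mfg_drift_def case_prod_beta)
  qed
  obtain K where K: "AE t in lborel. t \<in> {0..T} \<longrightarrow> C1_vector_field A (?B t) \<and>
     (\<forall>x. tnorm g x (?B t x) \<le> K \<and>
        (\<forall>p\<in>tangent_space A x. tnorm g x (cov_deriv A g (?B t) x p) \<le> K * tnorm g x p))"
    using L by (auto simp: Linf_C1b_def)
  have "tnorm g x (?B t x) \<le> K" if t: "t \<in> {0..T}" for t x
  proof (rule AE_Icc_le[OF T _ _ t, of "\<lambda>t. tnorm g x (?B t x)"])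
    show "AE t in lborel. t \<in> {0<..<T} \<longrightarrow> tnorm g x (?B t x) \<le> K"
      using K by (rule AE_mp) (auto intro!: AE_I2)
    obtain c where c: "c \<in> charts_at A x" by (rule ex_chart)
    note cA = charts_atD[OF c]
    have B: "continuous_on {0..T} (\<lambda>t. ?B t x c $ k)" for k
    proof -
      have "continuous_on {0..T} (\<lambda>t. (t, snd c x))" by (intro continuous_intros)
      from continuous_on_compose2[OF cont[OF cA(1), unfolded Ctk_on.simps] this] show ?thesis
        using cA by auto
    qed
    have "continuous_on {0..T} (\<lambda>t. sqrt (\<Sum>i\<in>UNIV. \<Sum>j\<in>UNIV. ?B t x c $ i * ?B t x c $ j * mm c (snd c x) $ i $ j))"
      by (intro continuous_intros B)
    then show "continuous_on {0..T} (\<lambda>t. tnorm g x (?B t x))"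
      by (rule continuous_on_eq) (simp add: tnorm_coords[OF in_TS c] inner_matrix_vector_sum)
  qed
  then show ?thesis unfolding drift_def using in_TS cont by blast
qed

lemma mfg_solutionD:
  assumes "T > 0" "regular_hamiltonian A g T H" "mfg_solution A g T m0 H F G v \<mu>"
  shows "v \<in> C12b A g T" "flow T (mfg_drift A g H v) \<mu>" "\<mu> 0 = m0" "\<And>x. v T x = G x (\<mu> T)"
    and "\<And>t x. t \<in> {0..<T} \<Longrightarrow>
      time_deriv T v t x + laplace_beltrami A g (v t) x = H t x (grad A g (v t) x) - F t x (\<mu> t)"
proof -
  show v: "v \<in> C12b A g T" and \<mu>0: "\<mu> 0 = m0" and "\<And>x. v T x = G x (\<mu> T)"
    using assms(3) by (auto simp: mfg_solution_def prob_flow_solution_def)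
  show "time_deriv T v t x + laplace_beltrami A g (v t) x = H t x (grad A g (v t) x) - F t x (\<mu> t)"
    if "t \<in> {0..<T}" for t x
  proof -
    have "- time_deriv T v t x - laplace_beltrami A g (v t) x + H t x (grad A g (v t) x) = F t x (\<mu> t)"
      using assms(3) that by (simp add: mfg_solution_def)
    then show ?thesis by linarith
  qed
  have P: "prob_flow_solution A g T m0 (mfg_drift A g H v) \<mu>"
    using assms(3) by (simp add: mfg_solution_def)
  then have "drift T (mfg_drift A g H v)"
    by (intro drift_mfg_drift[OF assms(1,2) v]) (simp add: prob_flow_solution_def)
  with P show "flow T (mfg_drift A g H v) \<mu>"
    unfolding flow_def prob_flow_solution_def generator_def by (simp add: \<mu>0)
qed

section \<open>The generator on differences and squares\<close>

lemma generator_diff: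
  assumes "v \<in> C12b A g T" "u \<in> C12b A g T" "T > 0" "t \<in> {0..T}"
  shows "generator T B (\<lambda>t x. v t x - u t x) t x =
    (time_deriv T v t x + laplace_beltrami A g (v t) x) - (time_deriv T u t x + laplace_beltrami A g (u t) x)
    + g x (B t x) (\<lambda>c. grad A g (v t) x c - grad A g (u t) x c)"
  by (simp add: generator_def C12b_diff(2)[OF assms] laplace_diff[OF C12b_Ctm[OF assms(1)] C12b_Ctm[OF assms(2)] assms(4)]
      grad_diff[OF C12b_mdiff[OF assms(1,4)] C12b_mdiff[OF assms(2,4)]])

text \<open>The drift and the time derivative obey the product rule; the Laplacian alone leaves the
  squared gradient, the carre du champ.\<close>

lemma generator_square:
  assumes "v \<in> C12b A g T" "T > 0" "t \<in> {0..T}" "B t x \<in> TS x"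
  shows "generator T B (\<lambda>t x. v t x * v t x) t x =
    2 * v t x * generator T B v t x + 2 * g x (grad A g (v t) x) (grad A g (v t) x)"
proof -
  note md = C12b_mdiff[OF assms(1,3)]
  have "g x (B t x) (\<lambda>c. (2 * v t x) *\<^sub>R grad A g (v t) x c) = 2 * v t x * g x (B t x) (grad A g (v t) x)"
    using metric_lincomb_right[OF grad_in[OF md] grad_in[OF md] assms(4), of "2 * v t x" 0] by simp
  then show ?thesis
    by (simp add: generator_def C12b_square(2)[OF assms(1-3)] grad_square[OF md]
        laplace_square[OF C12b_Ctm[OF assms(1)] assms(3)] algebra_simps)
qed

text \<open>The convexity remainder of \<open>H\<close> in the Lasry--Lions computation; recall that \<open>mfg_drift\<close> is \<open>- D\<^sub>pH\<close>.\<close>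

definition excess ::
    "(real \<Rightarrow> 'm \<Rightarrow> ('m, 'n) tvec \<Rightarrow> real) \<Rightarrow> (real \<Rightarrow> 'm \<Rightarrow> real) \<Rightarrow> (real \<Rightarrow> 'm \<Rightarrow> real) \<Rightarrow>
      real \<Rightarrow> 'm \<Rightarrow> real" where
  "excess H v u t x = H t x (grad A g (u t) x) - H t x (grad A g (v t) x)
     + g x (mfg_drift A g H v t x) (\<lambda>c. grad A g (u t) x c - grad A g (v t) x c)"

lemma excess_nonneg:
  assumes "regular_hamiltonian A g T H" "convex_hamiltonian A T H" "v \<in> C12b A g T" "u \<in> C12b A g T" "t \<in> {0..T}"
  shows "excess H v u t x \<ge> 0"
proof -
  note p = grad_in[OF C12b_mdiff[OF assms(3,5)], of x] and q = grad_in[OF C12b_mdiff[OF assms(4,5)], of x]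
  show ?thesis
    using hamiltonian_above_tangent[OF assms(1,2,5) p q]
      metric_minus_left[OF DpH_in[OF assms(1,5) p] TS_diff[OF q p]]
    by (simp add: excess_def mfg_drift_def)
qed

lemma excess_continuous:
  assumes "regular_hamiltonian A g T H" "drift T (mfg_drift A g H v)" "v \<in> C12b A g T" "u \<in> C12b A g T" "T > 0"
  shows "continuous_on ({0..T} \<times> UNIV) (\<lambda>(t, x). excess H v u t x)"
proof -
  note vC = C12b_Ctm[OF assms(3)] and uC = C12b_Ctm[OF assms(4)]
  have "continuous_on ({0..T} \<times> UNIV) (\<lambda>(t, x). g x (mfg_drift A g H v t x) (grad A g (\<lambda>x. u t x - v t x) x))"
    by (rule metric_grad_continuous[OF _ _ Ctm_diff[OF uC vC]]) (use assms(2) in \<open>auto simp: drift_def\<close>)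
  then have "continuous_on ({0..T} \<times> UNIV)
      (\<lambda>(t, x). g x (mfg_drift A g H v t x) (\<lambda>c. grad A g (u t) x c - grad A g (v t) x c))"
    by (rule continuous_on_eq) (auto simp: grad_diff C12b_mdiff[OF assms(3)] C12b_mdiff[OF assms(4)])
  then show ?thesis
    using hamiltonian_continuous[OF assms(1) vC] hamiltonian_continuous[OF assms(1) uC]
    unfolding excess_def case_prod_beta by (intro continuous_intros)
qed

text \<open>The values of \<open>H\<close> along the gradients need not be bounded, but they cancel
  in the sum and only pairings of drifts with gradients remain. As both summands are nonnegative,
  each inherits the bound.\<close>

lemma excess_sum_bounded:
  assumes "drift T (mfg_drift A g H v)" "drift T (mfg_drift A g H u)" "v \<in> C12b A g T" "u \<in> C12b A g T"
  obtains K where "\<And>t x. t \<in> {0..T} \<Longrightarrow> excess H v u t x + excess H u v t x \<le> K"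
proof -
  obtain Kv where Kv: "Kv \<ge> 0" "C12_bound T v Kv" using C12b_bound[OF assms(3)] .
  obtain Ku where Ku: "Ku \<ge> 0" "C12_bound T u Ku" using C12b_bound[OF assms(4)] .
  obtain L1 where L1: "\<And>t x. t \<in> {0..T} \<Longrightarrow> tnorm g x (mfg_drift A g H v t x) \<le> L1"
    using assms(1) unfolding drift_def by blast
  obtain L2 where L2: "\<And>t x. t \<in> {0..T} \<Longrightarrow> tnorm g x (mfg_drift A g H u t x) \<le> L2"
    using assms(2) unfolding drift_def by blast
  have *: "g x b (\<lambda>c. grad A g (f t) x c - grad A g (h t) x c) \<le> \<bar>L\<bar> * (Kv + Ku)"
    if t: "t \<in> {0..T}" and b: "b \<in> TS x" "tnorm g x b \<le> L" and fh: "f \<in> C12b A g T" "h \<in> C12b A g T"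
      "tnorm g x (grad A g (f t) x) + tnorm g x (grad A g (h t) x) \<le> Kv + Ku" for t x b f h L
  proof -
    note p = grad_in[OF C12b_mdiff[OF fh(1) t], of x] and q = grad_in[OF C12b_mdiff[OF fh(2) t], of x]
    have "g x b (\<lambda>c. grad A g (f t) x c - grad A g (h t) x c) \<le>
        tnorm g x b * tnorm g x (\<lambda>c. grad A g (f t) x c - grad A g (h t) x c)"
      using metric_Cauchy_Schwarz[OF b(1) TS_diff[OF p q]] by linarith
    also have "\<dots> \<le> \<bar>L\<bar> * (Kv + Ku)"
      using tnorm_lincomb[OF p q, of 1 "-1"] b(2) fh(3) tnorm_nonneg[OF TS_diff[OF p q]]
      by (intro mult_mono) auto
    finally show ?thesis .
  qed
  have "excess H v u t x + excess H u v t x \<le> \<bar>L1\<bar> * (Kv + Ku) + \<bar>L2\<bar> * (Kv + Ku)" if t: "t \<in> {0..T}" for t x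
  proof -
    have b: "tnorm g x (grad A g (v t) x) \<le> Kv" "tnorm g x (grad A g (u t) x) \<le> Ku"
      using Kv(2) Ku(2) t by (simp_all add: C12_bound_def)
    have TSB: "mfg_drift A g H v t x \<in> TS x" "mfg_drift A g H u t x \<in> TS x"
      using assms(1,2) t by (simp_all add: drift_def)
    show ?thesis
      using *[OF t TSB(1) L1[OF t] assms(4,3)] *[OF t TSB(2) L2[OF t] assms(3,4)] b
      by (simp add: excess_def)
  qed
  then show ?thesis by (rule that)
qed

lemma mfg_unique:
  assumes T: "T > 0" and H: "regular_hamiltonian A g T H" "convex_hamiltonian A T H"
    and G: "monotone_coupling G" and F: "\<forall>t\<in>{0..T}. strictly_monotone_coupling (F t)"
    and s1: "mfg_solution A g T m0 H F G v1 \<mu>1" and s2: "mfg_solution A g T m0 H F G v2 \<mu>2"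
  shows "\<forall>t\<in>{0..T}. \<mu>1 t = \<mu>2 t \<and> (\<forall>x. v1 t x = v2 t x)"
proof -
  define B1 where "B1 = mfg_drift A g H v1"
  define B2 where "B2 = mfg_drift A g H v2"
  note S1 = mfg_solutionD[OF T H(1) s1, folded B1_def] and S2 = mfg_solutionD[OF T H(1) s2, folded B2_def]
  interpret m1: weak_flow \<mu>1 T by (rule flow_weak[OF S1(2) T])
  interpret m2: weak_flow \<mu>2 T by (rule flow_weak[OF S2(2) T])
  have d1: "drift T B1" and d2: "drift T B2" using S1(2) S2(2) by (simp_all add: flow_def)
  define w where "w = (\<lambda>t x. v1 t x - v2 t x)"
  have w: "w \<in> C12b A g T" unfolding w_def by (rule C12b_diff(1)[OF S1(1) S2(1) T])
  have grad_w: "grad A g (w t) x = (\<lambda>c. grad A g (v1 t) x c - grad A g (v2 t) x c)" if "t \<in> {0..T}" for t x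
    unfolding w_def by (rule grad_diff[OF C12b_mdiff[OF S1(1) that] C12b_mdiff[OF S2(1) that]])
  define e1 where "e1 = excess H v1 v2"
  define e2 where "e2 = excess H v2 v1"
  \<comment> \<open>\<open>gen1\<close> and \<open>gen2\<close> express \<open>f\<close> at times
    before \<open>T\<close> by bounded continuous functions, so the integrals in
    \<open>monotone_integral\<close> are genuine and not default values.\<close>
  define f where "f = (\<lambda>t x. F t x (\<mu>1 t) - F t x (\<mu>2 t))"
  have e_nonneg: "e1 t x \<ge> 0" "e2 t x \<ge> 0" if "t \<in> {0..T}" for t x
    unfolding e1_def e2_def using excess_nonneg[OF H] S1(1) S2(1) that by blast+
  obtain K where K: "\<And>t x. t \<in> {0..T} \<Longrightarrow> e1 t x + e2 t x \<le> K"
    using excess_sum_bounded[OF d1[unfolded B1_def] d2[unfolded B2_def] S1(1) S2(1)] unfolding e1_def e2_def by blast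
  have e_bound: "\<bar>e1 t x\<bar> \<le> K" "\<bar>e2 t x\<bar> \<le> K" if "t \<in> {0..T}" for t x
    using K[OF that, of x] e_nonneg[OF that, of x] by linarith+
  have e_cont: "continuous_on UNIV (e1 t)" "continuous_on UNIV (e2 t)" if "t \<in> {0..T}" for t
    using continuous_on_slice[OF excess_continuous[OF H(1) d1[unfolded B1_def] S1(1) S2(1) T] that]
      continuous_on_slice[OF excess_continuous[OF H(1) d2[unfolded B2_def] S2(1) S1(1) T] that]
    by (simp_all add: e1_def e2_def)
  have gen1: "generator T B1 w t x = - e1 t x - f t x" if t: "t \<in> {0..<T}" for t x
  proof -
    have t': "t \<in> {0..T}" using t by simp
    note p1 = grad_in[OF C12b_mdiff[OF S1(1) t'], of x] and p2 = grad_in[OF C12b_mdiff[OF S2(1) t'], of x]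
    have b: "B1 t x \<in> TS x" using d1 t' by (simp add: drift_def)
    show ?thesis
      using S1(5)[OF t, of x] S2(5)[OF t, of x] metric_diff_right[OF p1 p2 b] metric_diff_right[OF p2 p1 b]
      unfolding w_def generator_diff[OF S1(1) S2(1) T t'] e1_def excess_def f_def B1_def by simp
  qed
  have gen2: "generator T B2 w t x = e2 t x - f t x" if t: "t \<in> {0..<T}" for t x
  proof -
    have t': "t \<in> {0..T}" using t by simp
    show ?thesis
      using S1(5)[OF t, of x] S2(5)[OF t, of x]
      unfolding w_def generator_diff[OF S1(1) S2(1) T t'] e2_def excess_def f_def B2_def by simp
  qed
  define J1 where "J1 = (\<lambda>t. \<integral>x. generator T B1 w t x \<partial>\<mu>1 t)"
  define J2 where "J2 = (\<lambda>t. \<integral>x. generator T B2 w t x \<partial>\<mu>2 t)"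
  have J_int: "set_integrable lborel {0..T} J1" "set_integrable lborel {0..T} J2"
    unfolding J1_def J2_def by (rule generator_integrable[OF S1(2) T w], rule generator_integrable[OF S2(2) T w])
  have J_diff: "J2 t - J1 t = (\<integral>x. e1 t x \<partial>\<mu>1 t) + (\<integral>x. e2 t x \<partial>\<mu>2 t) + monotone_integral (F t) (\<mu>1 t) (\<mu>2 t)"
    if t: "t \<in> {0..<T}" for t
  proof -
    have t': "t \<in> {0..T}" using t by simp
    obtain L1 where "\<And>t x. t \<in> {0..T} \<Longrightarrow> \<bar>generator T B1 w t x\<bar> \<le> L1" using generator_bound[OF d1 w] by blast
    then have i1: "integrable (\<mu>1 t) (generator T B1 w t)" "integrable (\<mu>1 t) (e1 t)"
      using m1.integrable_slice[OF continuous_on_slice[OF generator_continuous[OF d1 w] t'] _ t']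
        m1.integrable_slice[OF e_cont(1)[OF t'] e_bound(1)[OF t'] t'] t' by blast+
    obtain L2 where "\<And>t x. t \<in> {0..T} \<Longrightarrow> \<bar>generator T B2 w t x\<bar> \<le> L2" using generator_bound[OF d2 w] by blast
    then have i2: "integrable (\<mu>2 t) (generator T B2 w t)" "integrable (\<mu>2 t) (e2 t)"
      using m2.integrable_slice[OF continuous_on_slice[OF generator_continuous[OF d2 w] t'] _ t']
        m2.integrable_slice[OF e_cont(2)[OF t'] e_bound(2)[OF t'] t'] t' by blast+
    have "(\<integral>x. f t x \<partial>\<mu>1 t) = (\<integral>x. - generator T B1 w t x - e1 t x \<partial>\<mu>1 t)"
      by (simp add: gen1[OF t])
    also have "\<dots> = - J1 t - (\<integral>x. e1 t x \<partial>\<mu>1 t)" using i1 by (simp add: J1_def)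
    finally have 1: "(\<integral>x. f t x \<partial>\<mu>1 t) = - J1 t - (\<integral>x. e1 t x \<partial>\<mu>1 t)" .
    have "(\<integral>x. f t x \<partial>\<mu>2 t) = (\<integral>x. e2 t x - generator T B2 w t x \<partial>\<mu>2 t)"
      by (simp add: gen2[OF t])
    also have "\<dots> = (\<integral>x. e2 t x \<partial>\<mu>2 t) - J2 t" using i2 by (simp add: J2_def)
    finally show ?thesis using 1 by (simp add: monotone_integral_def f_def)
  qed
  have mono: "monotone_integral (F t) (\<mu>1 t) (\<mu>2 t) \<ge> 0" if t: "t \<in> {0..T}" for t
    using F t m1.in_borel_probs[OF t] m2.in_borel_probs[OF t]
    by (cases "\<mu>1 t = \<mu>2 t") (auto simp: strictly_monotone_coupling_def monotone_integral_def less_imp_le)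
  \<comment> \<open>The Hamilton-Jacobi equation is imposed before \<open>T\<close> only, so the
    final time is discarded as a null set.\<close>
  have ae_T: "AE t in lborel. t \<noteq> T" by (rule AE_lborel_singleton)
  have e_int: "(\<integral>x. e1 t x \<partial>\<mu>1 t) \<ge> 0" "(\<integral>x. e2 t x \<partial>\<mu>2 t) \<ge> 0" if "t \<in> {0..T}" for t
    using e_nonneg[OF that] by (simp_all add: integral_nonneg)
  have "AE t in lborel. t \<in> {0..T} \<longrightarrow> J2 t - J1 t = 0"
  proof (rule AE_zero_of_integral_nonpos)
    show "set_integrable lborel {0..T} (\<lambda>t. J2 t - J1 t)" using J_int by (intro set_integral_diff)
    show "AE t in lborel. t \<in> {0..T} \<longrightarrow> 0 \<le> J2 t - J1 t"
      using ae_T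
    proof (rule AE_mp, intro AE_I2 impI)
      fix t assume "t \<noteq> T" "t \<in> {0..T}"
      then show "0 \<le> J2 t - J1 t" using J_diff[of t] mono[of t] e_int[of t] by simp
    qed
    \<comment> \<open>Both flows start at \<open>m0\<close>, so the terms at time 0 cancel in the
      difference; the terminal condition rewrites those at time \<open>T\<close> through
      \<open>G\<close>.\<close>
    have "(LINT t:{0..T}|lborel. J1 t) = (\<integral>x. w T x \<partial>\<mu>1 T) - (\<integral>x. w 0 x \<partial>m0)"
      "(LINT t:{0..T}|lborel. J2 t) = (\<integral>x. w T x \<partial>\<mu>2 T) - (\<integral>x. w 0 x \<partial>m0)"
      using flow_identity[OF S1(2) w, of T] flow_identity[OF S2(2) w, of T] S1(3) S2(3) T
      by (simp_all add: J1_def J2_def)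
    moreover have "monotone_integral G (\<mu>1 T) (\<mu>2 T) \<ge> 0"
      using G m1.in_borel_probs[of T] m2.in_borel_probs[of T] T by (simp add: monotone_coupling_def)
    ultimately show "(LINT t:{0..T}|lborel. J2 t - J1 t) \<le> 0"
      using set_integral_diff(2)[OF J_int(2,1)] by (simp add: monotone_integral_def w_def S1(4) S2(4))
  qed
  then have ae: "AE t in lborel. t \<in> {0..T} \<longrightarrow> J2 t - J1 t = 0 \<and> t \<noteq> T \<and> t \<noteq> 0"
    using ae_T AE_lborel_singleton[of 0] by eventually_elim simp
  have \<mu>_eq: "\<mu>1 t = \<mu>2 t" if t: "t \<in> {0..T}" for t
  proof (rule borel_probs_eqI[OF m1.in_borel_probs[OF t] m2.in_borel_probs[OF t]])
    fix h :: "'m \<Rightarrow> real" assume h: "continuous_on UNIV h" "bounded (range h)"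
    \<comment> \<open>For a fixed test function the discrepancy is continuous in time and vanishes
      at almost every time.\<close>
    have "\<bar>(\<integral>x. h x \<partial>\<mu>1 t) - (\<integral>x. h x \<partial>\<mu>2 t)\<bar> \<le> 0"
    proof (rule AE_Icc_le[OF T _ _ t])
      show "continuous_on {0..T} (\<lambda>t. \<bar>(\<integral>x. h x \<partial>\<mu>1 t) - (\<integral>x. h x \<partial>\<mu>2 t)\<bar>)"
        by (intro continuous_intros m1.integral_continuous m2.integral_continuous h)
      show "AE t in lborel. t \<in> {0<..<T} \<longrightarrow> \<bar>(\<integral>x. h x \<partial>\<mu>1 t) - (\<integral>x. h x \<partial>\<mu>2 t)\<bar> \<le> 0"
        using ae
      proof (rule AE_mp, intro AE_I2 impI)
        fix t assume 1: "t \<in> {0..T} \<longrightarrow> J2 t - J1 t = 0 \<and> t \<noteq> T \<and> t \<noteq> 0" and "t \<in> {0<..<T}"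
        then have t: "t \<in> {0..T}" "t \<in> {0..<T}" by auto
        have "\<not> monotone_integral (F t) (\<mu>1 t) (\<mu>2 t) > 0"
          using 1 t(1) J_diff[OF t(2)] e_int[OF t(1)] by auto
        then have "\<mu>1 t = \<mu>2 t"
          using F t(1) m1.in_borel_probs[OF t(1)] m2.in_borel_probs[OF t(1)]
          unfolding strictly_monotone_coupling_def by blast
        then show "\<bar>(\<integral>x. h x \<partial>\<mu>1 t) - (\<integral>x. h x \<partial>\<mu>2 t)\<bar> \<le> 0" by simp
      qed
    qed
    then show "(\<integral>x. h x \<partial>\<mu>1 t) = (\<integral>x. h x \<partial>\<mu>2 t)" by simp
  qed
  have supp: "x \<in> measure_support (\<mu>1 t)" if "t \<in> {0..T}" "t \<noteq> 0" for t x
    using full_support[OF S1(2) T, of t] that by simp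
  \<comment> \<open>At such a time \<open>e1\<close> is nonnegative and continuous with integral 0
    against a measure of full support, and \<open>f\<close> vanishes because the two measures
    coincide.\<close>
  have gen0: "generator T B1 w t x = 0"
    if t: "t \<in> {0..T}" and z: "J2 t - J1 t = 0 \<and> t \<noteq> T \<and> t \<noteq> 0" for t x
  proof -
    have t': "t \<in> {0..<T}" using t z by auto
    have "(\<integral>x. e1 t x \<partial>\<mu>1 t) \<le> 0" using J_diff[OF t'] z mono[OF t] e_int[OF t] by simp
    then have "e1 t x = 0"
      using continuous_zero_on_support[OF m1.prob[OF t] m1.sets_eq[OF t] e_cont(1)[OF t]
          m1.integrable_slice[OF e_cont(1)[OF t] e_bound(1)[OF t] t] e_nonneg(1)[OF t]] supp t z by blast
    then show ?thesis using gen1[OF t', of x] \<mu>_eq[OF t] by (simp add: f_def)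
  qed
  define q where "q = (\<lambda>t x. w t x * w t x)"
  have q: "q \<in> C12b A g T" unfolding q_def by (rule C12b_square(1)[OF w T])
  have w_T: "w T x = 0" for x
    using S1(4)[of x] S2(4)[of x] \<mu>_eq[of T] T by (simp add: w_def)
  have gen_q: "generator T B1 q t x = 2 * g x (grad A g (w t) x) (grad A g (w t) x)"
    if t: "t \<in> {0..T}" and z: "J2 t - J1 t = 0 \<and> t \<noteq> T \<and> t \<noteq> 0" for t x
    using generator_square[OF w T t, of B1 x] gen0[OF t z, of x] d1 t by (simp add: q_def drift_def)
  have g_nonneg: "g x (grad A g (w t) x) (grad A g (w t) x) \<ge> 0" if "t \<in> {0..T}" for t x
    by (rule metric_nonneg[OF grad_in[OF C12b_mdiff[OF w that]]])
  have "AE t in lborel. t \<in> {0..T} \<longrightarrow> (\<integral>x. generator T B1 q t x \<partial>\<mu>1 t) = 0"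
  proof (rule AE_zero_of_integral_nonpos[OF generator_integrable[OF S1(2) T q]])
    show "AE t in lborel. t \<in> {0..T} \<longrightarrow> 0 \<le> (\<integral>x. generator T B1 q t x \<partial>\<mu>1 t)"
      using ae by (rule AE_mp) (auto intro!: AE_I2 integral_nonneg simp: gen_q g_nonneg)
    \<comment> \<open>The energy vanishes at the final time and is nonnegative at the initial one,
      so the flow identity leaves no room for a positive dissipation.\<close>
    have "(\<integral>x. q 0 x \<partial>\<mu>1 0) \<ge> 0" by (simp add: q_def)
    moreover have "(\<integral>x. q T x \<partial>\<mu>1 T) = 0" by (simp add: q_def w_T)
    ultimately show "(LINT t:{0..T}|lborel. (\<integral>x. generator T B1 q t x \<partial>\<mu>1 t)) \<le> 0"
      using flow_identity[OF S1(2) q, of T] T by simp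
  qed
  then have "AE t in lborel. t \<in> {0..T} \<longrightarrow> (\<forall>x. time_deriv T w t x = 0)"
    using ae
  proof (eventually_elim, intro impI allI)
    fix t x
    assume "t \<in> {0..T} \<longrightarrow> (\<integral>x. generator T B1 q t x \<partial>\<mu>1 t) = 0"
      and "t \<in> {0..T} \<longrightarrow> J2 t - J1 t = 0 \<and> t \<noteq> T \<and> t \<noteq> 0" and t: "t \<in> {0..T}"
    then have i: "(\<integral>x. generator T B1 q t x \<partial>\<mu>1 t) \<le> 0" and z: "J2 t - J1 t = 0 \<and> t \<noteq> T \<and> t \<noteq> 0" by auto
    obtain L where L: "\<And>t x. t \<in> {0..T} \<Longrightarrow> \<bar>generator T B1 q t x\<bar> \<le> L" using generator_bound[OF d1 q] by blast
    note cq = continuous_on_slice[OF generator_continuous[OF d1 q] t]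
    have nn: "generator T B1 q t x \<ge> 0" for x using gen_q[OF t z] g_nonneg[OF t] by simp
    have "generator T B1 q t x = 0" for x
      using continuous_zero_on_support[OF m1.prob[OF t] m1.sets_eq[OF t] cq
          m1.integrable_slice[OF cq L[OF t] t] nn i] supp[OF t] z by blast
    then have "g x (grad A g (w t) x) (grad A g (w t) x) = 0" for x using gen_q[OF t z] by simp
    then have gz: "grad A g (w t) x = (\<lambda>c. 0)" for x
      using metric_pos[OF grad_in[OF C12b_mdiff[OF w t]], of x] by (metis less_irrefl)
    obtain d where d: "d \<in> charts_at A x" by (rule ex_chart)
    \<comment> \<open>The gradient vanishes on the whole time slice, so locality applies with the
      entire manifold as the open set.\<close>
    have "laplace_beltrami A g (w t) x = 0"
      unfolding laplace_beltrami_def divergence_eq[OF grad_diff_field[OF C12b_Ctm[OF w] t] d]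
      using cov_deriv_zero[OF grad_diff_field[OF C12b_Ctm[OF w] t] open_UNIV UNIV_I gz tv_in[OF d]] by simp
    moreover have "g x (B1 t x) (grad A g (w t) x) = 0"
    proof -
      have "B1 t x \<in> TS x" using d1 t by (simp add: drift_def)
      from metric_Cauchy_Schwarz[OF this grad_in[OF C12b_mdiff[OF w t], of x]]
      show ?thesis by (simp add: gz tnorm_zero)
    qed
    ultimately show "time_deriv T w t x = 0" using gen0[OF t z, of x] by (simp add: generator_def)
  qed
  then have td_ae: "AE t in lborel. t \<in> {0<..<T} \<longrightarrow> \<bar>time_deriv T w t x\<bar> \<le> 0" for x
    by (rule AE_mp) (auto intro!: AE_I2)
  \<comment> \<open>Almost every time is covered so far; continuity of the time derivative gives the
    rest, including both end points.\<close>
  have td0: "time_deriv T w t x = 0" if t: "t \<in> {0..T}" for t x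
  proof -
    have "continuous_on {0..T} (\<lambda>t. (t, x))" by (intro continuous_intros)
    from continuous_on_compose2[OF C12b_time_cont[OF w] this]
    have "continuous_on {0..T} (\<lambda>t. \<bar>time_deriv T w t x\<bar>)" by (auto intro!: continuous_intros)
    from AE_Icc_le[OF T this td_ae t] show ?thesis by simp
  qed
  have "w t x = 0" if t: "t \<in> {0..T}" for t x
  proof -
    have D: "((\<lambda>s. w s x) has_vector_derivative 0) (at s within {0..T})" if "s \<in> {0..T}" for s
      using C12b_time_diff[OF w that, of x] td0[OF that] by simp
    obtain k where k: "\<And>s. s \<in> {0..T} \<Longrightarrow> w s x = k"
    proof (rule has_vector_derivative_zero_constant[of "{0..T}" "\<lambda>s. w s x"])
      show "((\<lambda>s. w s x) has_vector_derivative 0) (at s within {0..T})" if "s \<in> {0..T}" for s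
        by (rule D[OF that])
    qed (simp, rule that)
    show ?thesis using k[OF t] k[of T] w_T[of x] T by simp
  qed
  then show ?thesis using \<mu>_eq by (auto simp: w_def)
qed

end

theorem theorem2p7:
  fixes A :: "('m::{second_countable_topology, t2_space}, 'n::finite) chart set"
    and g :: "('m, 'n) metric"
    and T :: real
    and m0 :: "'m measure"
    and H :: "real \<Rightarrow> 'm \<Rightarrow> ('m, 'n) tvec \<Rightarrow> real"
    and F :: "real \<Rightarrow> 'm \<Rightarrow> 'm measure \<Rightarrow> real"
    and G :: "'m \<Rightarrow> 'm measure \<Rightarrow> real"
    and v1 v2 :: "real \<Rightarrow> 'm \<Rightarrow> real"
    and \<mu>1 \<mu>2 :: "real \<Rightarrow> 'm measure"
  assumes "riemannian_manifold A g"
    and "T > 0"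
    and "m0 \<in> borel_probs"
    and "regular_hamiltonian A g T H"
    and "monotone_coupling G"
    and "\<forall>t\<in>{0..T}. strictly_monotone_coupling (F t)"
    and "convex_hamiltonian A T H"
    and "mfg_solution A g T m0 H F G v1 \<mu>1"
    and "mfg_solution A g T m0 H F G v2 \<mu>2"
  shows "\<forall>t\<in>{0..T}. \<mu>1 t = \<mu>2 t \<and> (\<forall>x. v1 t x = v2 t x)"
proof -
  interpret riemannian A g by unfold_locales (rule assms(1))
  show ?thesis by (rule mfg_unique[OF assms(2,4,7,5,6,8,9)])
qed

end
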